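(* Let $D_1$ and $D_2$ be self-adjoint regular operators on $E$ with equal domains such that, for some $0<\alpha\le1$, the operator $(F_{D_1}-F_{D_2})\langle D_1\rangle^\alpha$ is bounded on $\operatorname{dom}\langle D_1\rangle^\alpha$. Then there exist a bounded invertible operator $\mu$ and a self-adjoint regular operator $T$ such that $$D_2=\mu D_1\mu^*+T$$ and both $\langle D_1\rangle^{-1/2}T\langle D_1\rangle^{-1/2+\alpha}$ and $\big([F_{D_1},\mu]-T\langle D_2\rangle^{-1}\big)\langle D_1\rangle^\alpha$ are bounded. Furthermore, if $1/2\le\alpha$, then $T\langle D_1\rangle^{-1+\alpha}$ and $[F_{D_1},\mu]\langle D_1\rangle^\alpha$ are bounded.
   Context: $E$ is a countably generated right Hilbert $B$-module over a C*-algebra $B$. For a self-adjoint regular operator $D$ on $E$: $\langle D\rangle=(1+D^2)^{1/2}$ and $F_D=D(1+D^2)^{-1/2}$. A densely defined operator is called bounded if it extends to a bounded operator on $E$. *)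

theory Defs
  imports "HOL-Analysis.Analysis" "HOL-Computational_Algebra.Polynomial"
begin

section \<open>C*-algebras and Hilbert C*-modules\<close>

class complex_vector = real_vector +
  fixes scaleC :: "complex \<Rightarrow> 'a \<Rightarrow> 'a" (infixr "*\<^sub>C" 75)
  assumes scaleC_of_real: "complex_of_real r *\<^sub>C x = r *\<^sub>R x"
    and scaleC_add_right: "c *\<^sub>C (x + y) = c *\<^sub>C x + c *\<^sub>C y"
    and scaleC_add_left: "(c + d) *\<^sub>C x = c *\<^sub>C x + d *\<^sub>C x"
    and scaleC_scaleC: "c *\<^sub>C (d *\<^sub>C x) = (c * d) *\<^sub>C x"

text \<open>No unit is assumed.\<close>

class cstar_algebra = complex_vector + real_normed_algebra + banach +
  fixes cstar :: "'a \<Rightarrow> 'a"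
  assumes norm_scaleC: "norm (c *\<^sub>C x) = cmod c * norm x"
    and mult_scaleC_left: "(c *\<^sub>C x) * y = c *\<^sub>C (x * y)"
    and mult_scaleC_right: "x * (c *\<^sub>C y) = c *\<^sub>C (x * y)"
    and cstar_cstar: "cstar (cstar x) = x"
    and cstar_add: "cstar (x + y) = cstar x + cstar y"
    and cstar_scaleC: "cstar (c *\<^sub>C x) = cnj c *\<^sub>C cstar x"
    and cstar_mult: "cstar (x * y) = cstar y * cstar x"
    and cstar_identity: "norm (cstar x * x) = (norm x)\<^sup>2"

definition cstar_pos :: "'b::cstar_algebra \<Rightarrow> bool" where
  "cstar_pos a \<longleftrightarrow> (\<exists>b. a = cstar b * b)"

text \<open>A right Hilbert module over the C*-algebra \<open>'b\<close>, carried by the whole type \<open>'e\<close>, with inner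
  product \<open>ip\<close> (linear in the second variable) and right action \<open>act\<close>. Completeness for the norm of
  the inner product is the combination of \<open>norm_ip\<close> with the class \<open>banach\<close>.\<close>

locale hilbert_module =
  fixes ip :: "'e::{complex_vector, banach} \<Rightarrow> 'e \<Rightarrow> 'b::cstar_algebra"
    and act :: "'e \<Rightarrow> 'b \<Rightarrow> 'e"
  assumes act_add_left: "act (x + y) b = act x b + act y b"
    and act_add_right: "act x (b + c) = act x b + act x c"
    and act_act: "act (act x b) c = act x (b * c)"
    and act_scaleC_left: "act (k *\<^sub>C x) b = k *\<^sub>C act x b"
    and act_scaleC_right: "act x (k *\<^sub>C b) = k *\<^sub>C act x b"
    and ip_add_right: "ip x (y + z) = ip x y + ip x z"
    and ip_scaleC_right: "ip x (k *\<^sub>C y) = k *\<^sub>C ip x y"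
    and ip_act_right: "ip x (act y b) = ip x y * b"
    and cstar_ip: "cstar (ip x y) = ip y x"
    and ip_pos: "cstar_pos (ip x x)"
    and norm_ip: "norm x = sqrt (norm (ip x x))"

text \<open>The real span suffices, as \<open>k *\<^sub>C act x b = act x (k *\<^sub>C b)\<close>.\<close>

definition countably_generated :: "('e::{complex_vector, banach} \<Rightarrow> 'b::cstar_algebra \<Rightarrow> 'e) \<Rightarrow> bool" where
  "countably_generated act \<longleftrightarrow>
     (\<exists>S. countable S \<and> closure (span {act x b |x b. x \<in> S}) = UNIV)"


section \<open>Unbounded operators\<close>

text \<open>An unbounded operator is a partial map \<open>'e \<rightharpoonup> 'e\<close>, an everywhere defined \<open>X\<close> being identified
  with \<open>Some \<circ> X\<close> and the identity with \<open>Some\<close>. Equality of operators thus includes equality of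
  domains, and \<open>\<circ>\<^sub>m\<close> is composition with its natural domain.\<close>

definition op_add :: "('e::real_normed_vector \<rightharpoonup> 'e) \<Rightarrow> ('e \<rightharpoonup> 'e) \<Rightarrow> ('e \<rightharpoonup> 'e)" (infixl "+\<^sub>o" 52) where
  "(S +\<^sub>o T) x = (case (S x, T x) of (Some u, Some v) \<Rightarrow> Some (u + v) | _ \<Rightarrow> None)"

definition op_diff :: "('e::real_normed_vector \<rightharpoonup> 'e) \<Rightarrow> ('e \<rightharpoonup> 'e) \<Rightarrow> ('e \<rightharpoonup> 'e)" (infixl "-\<^sub>o" 52) where
  "(S -\<^sub>o T) x = (case (S x, T x) of (Some u, Some v) \<Rightarrow> Some (u - v) | _ \<Rightarrow> None)"

text \<open>The inverse of an injective operator, defined on its range.\<close>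

definition op_inv :: "('e \<rightharpoonup> 'e) \<Rightarrow> ('e \<rightharpoonup> 'e)" where
  "op_inv T y = (if \<exists>!x. T x = Some y then Some (THE x. T x = Some y) else None)"

definition densely_defined :: "('e::real_normed_vector \<rightharpoonup> 'e) \<Rightarrow> bool" where
  "densely_defined T \<longleftrightarrow> closure (dom T) = UNIV"

definition module_linear :: "('e::complex_vector \<Rightarrow> 'b \<Rightarrow> 'e) \<Rightarrow> ('e \<rightharpoonup> 'e) \<Rightarrow> bool" where
  "module_linear act T \<longleftrightarrow>
     T 0 = Some 0 \<and>
     (\<forall>x y u v. T x = Some u \<longrightarrow> T y = Some v \<longrightarrow> T (x + y) = Some (u + v)) \<and>
     (\<forall>x u c. T x = Some u \<longrightarrow> T (c *\<^sub>C x) = Some (c *\<^sub>C u)) \<and>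
     (\<forall>x u b. T x = Some u \<longrightarrow> T (act x b) = Some (act u b))"

text \<open>If \<open>T\<close> is densely defined, there is at most one \<open>z\<close> with the stated property.\<close>

definition op_adjoint :: "('e \<Rightarrow> 'e \<Rightarrow> 'b) \<Rightarrow> ('e \<rightharpoonup> 'e) \<Rightarrow> ('e \<rightharpoonup> 'e)" where
  "op_adjoint ip T y =
     (if \<exists>!z. \<forall>x\<in>dom T. ip (the (T x)) y = ip x z
      then Some (THE z. \<forall>x\<in>dom T. ip (the (T x)) y = ip x z) else None)"

definition regular_op ::
  "('e::{complex_vector, banach} \<Rightarrow> 'e \<Rightarrow> 'b::cstar_algebra) \<Rightarrow> ('e \<Rightarrow> 'b \<Rightarrow> 'e) \<Rightarrow> ('e \<rightharpoonup> 'e) \<Rightarrow> bool" where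
  "regular_op ip act T \<longleftrightarrow>
     module_linear act T \<and> densely_defined T \<and> closed (Map.graph T) \<and>
     densely_defined (op_adjoint ip T) \<and>
     closure (ran (Some +\<^sub>o (op_adjoint ip T \<circ>\<^sub>m T))) = UNIV"

definition self_adjoint_regular ::
  "('e::{complex_vector, banach} \<Rightarrow> 'e \<Rightarrow> 'b::cstar_algebra) \<Rightarrow> ('e \<Rightarrow> 'b \<Rightarrow> 'e) \<Rightarrow> ('e \<rightharpoonup> 'e) \<Rightarrow> bool" where
  "self_adjoint_regular ip act T \<longleftrightarrow> regular_op ip act T \<and> op_adjoint ip T = T"

definition bounded_op :: "('e::{complex_vector, banach} \<Rightarrow> 'b \<Rightarrow> 'e) \<Rightarrow> ('e \<Rightarrow> 'e) \<Rightarrow> bool" where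
  "bounded_op act X \<longleftrightarrow> bounded_linear X \<and> module_linear act (Some \<circ> X)"

text \<open>The densely defined operators that extend to a bounded operator on the whole module.\<close>

definition op_bounded :: "('e::{complex_vector, banach} \<Rightarrow> 'b \<Rightarrow> 'e) \<Rightarrow> ('e \<rightharpoonup> 'e) \<Rightarrow> bool" where
  "op_bounded act T \<longleftrightarrow>
     densely_defined T \<and> (\<exists>X. bounded_op act X \<and> T \<subseteq>\<^sub>m Some \<circ> X)"

definition adjointable ::
  "('e::{complex_vector, banach} \<Rightarrow> 'e \<Rightarrow> 'b::cstar_algebra) \<Rightarrow> ('e \<Rightarrow> 'b \<Rightarrow> 'e) \<Rightarrow> ('e \<Rightarrow> 'e) \<Rightarrow> bool" where
  "adjointable ip act X \<longleftrightarrow>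
     bounded_op act X \<and> (\<exists>Y. bounded_op act Y \<and> (\<forall>x y. ip (X x) y = ip x (Y y)))"

text \<open>The invertible elements of the C*-algebra of adjointable operators.\<close>

definition bounded_invertible ::
  "('e::{complex_vector, banach} \<Rightarrow> 'e \<Rightarrow> 'b::cstar_algebra) \<Rightarrow> ('e \<Rightarrow> 'b \<Rightarrow> 'e) \<Rightarrow> ('e \<Rightarrow> 'e) \<Rightarrow> bool" where
  "bounded_invertible ip act X \<longleftrightarrow>
     adjointable ip act X \<and> (\<exists>Y. adjointable ip act Y \<and> X \<circ> Y = id \<and> Y \<circ> X = id)"


section \<open>Real powers, and the operators \<open>\<langle>D\<rangle>\<close> and \<open>F\<^sub>D\<close>\<close>

definition op_poly :: "real poly \<Rightarrow> ('e::real_normed_vector \<Rightarrow> 'e) \<Rightarrow> 'e \<Rightarrow> 'e" where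
  "op_poly p A x = (\<Sum>i\<le>degree p. coeff p i *\<^sub>R (A ^^ i) x)"

text \<open>Continuous functional calculus for a positive adjointable operator \<open>A\<close>, whose spectrum lies in
  \<open>[0, \<parallel>A\<parallel>]\<close>: \<open>f(A)\<close> is the norm limit of \<open>p\<^sub>n(A)\<close> for polynomials \<open>p\<^sub>n\<close> converging uniformly to \<open>f\<close>
  on that interval. This characterises \<open>f(A)\<close> if \<open>f\<close> is continuous there.\<close>

definition op_cfc :: "(real \<Rightarrow> real) \<Rightarrow> ('e::real_normed_vector \<Rightarrow> 'e) \<Rightarrow> 'e \<Rightarrow> 'e" where
  "op_cfc f A = (THE S. bounded_linear S \<and>
     (\<forall>p. uniform_limit {0..onorm A} (\<lambda>n. poly (p n)) f sequentially \<longrightarrow>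
          (\<lambda>n. onorm (\<lambda>x. op_poly (p n) A x - S x)) \<longlonglongrightarrow> 0))"

text \<open>The power \<open>P\<^sup>s\<close> of a positive self-adjoint regular operator \<open>P\<close> whose inverse is everywhere
  defined and bounded: negative powers are the powers of that inverse, given by functional calculus,
  and positive powers are the (in general unbounded) inverses of the negative ones. The case
  \<open>s = 0\<close> is separate because \<open>0 powr 0 = 0\<close>.\<close>

definition op_pow :: "('e::real_normed_vector \<rightharpoonup> 'e) \<Rightarrow> real \<Rightarrow> ('e \<rightharpoonup> 'e)" where
  "op_pow P s =
     (if s = 0 then Some
      else if s < 0 then Some \<circ> op_cfc (\<lambda>t. t powr (- s)) (the \<circ> op_inv P)
      else op_inv (Some \<circ> op_cfc (\<lambda>t. t powr s) (the \<circ> op_inv P)))"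

definition bracket :: "('e::real_normed_vector \<rightharpoonup> 'e) \<Rightarrow> ('e \<rightharpoonup> 'e)" where
  "bracket D = op_pow (Some +\<^sub>o (D \<circ>\<^sub>m D)) (1/2)"

definition bounded_transform :: "('e::real_normed_vector \<rightharpoonup> 'e) \<Rightarrow> ('e \<rightharpoonup> 'e)" where
  "bounded_transform D = D \<circ>\<^sub>m op_pow (Some +\<^sub>o (D \<circ>\<^sub>m D)) (- 1/2)"

definition op_commutator :: "('e::real_normed_vector \<rightharpoonup> 'e) \<Rightarrow> ('e \<rightharpoonup> 'e) \<Rightarrow> ('e \<rightharpoonup> 'e)" where
  "op_commutator S T = (S \<circ>\<^sub>m T) -\<^sub>o (T \<circ>\<^sub>m S)"

end

theory Submission
  imports Defs
begin

text \<open>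
Write \<open>b\<^sub>i = \<langle>D\<^sub>i\<rangle>\<^sup>-\<^sup>1\<close>, \<open>F\<^sub>i\<close> for the bounded transforms and \<open>G = F\<^sub>2 - F\<^sub>1\<close>, and let \<open>H\<^sup>s\<close> be the scale of
domains of \<open>\<langle>D\<^sub>1\<rangle>\<^sup>s\<close>. As the domains agree, \<open>b\<^sub>1\<^sup>-\<^sup>1 b\<^sub>2\<close> is bounded and invertible, and by interpolation so
is \<open>b\<^sub>1\<^sup>-\<^sup>1\<^sup>/\<^sup>2 b\<^sub>2\<^sup>1\<^sup>/\<^sup>2\<close>. Since \<open>D\<^sub>i = \<langle>D\<^sub>i\<rangle>\<^sup>1\<^sup>/\<^sup>2 F\<^sub>i \<langle>D\<^sub>i\<rangle>\<^sup>1\<^sup>/\<^sup>2\<close>, the obvious choice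
\<open>\<mu> = \<langle>D\<^sub>2\<rangle>\<^sup>1\<^sup>/\<^sup>2 \<langle>D\<^sub>1\<rangle>\<^sup>-\<^sup>1\<^sup>/\<^sup>2\<close> leaves the remainder \<open>\<langle>D\<^sub>2\<rangle>\<^sup>1\<^sup>/\<^sup>2 G \<langle>D\<^sub>2\<rangle>\<^sup>1\<^sup>/\<^sup>2\<close>. It is symmetric, but for \<open>\<alpha> < 1\<close> it may
be unbounded, and then its self-adjointness is in doubt. Instead take
\<open>\<mu> = \<langle>D\<^sub>2\<rangle>\<^sup>1\<^sup>/\<^sup>2 Z \<langle>D\<^sub>1\<rangle>\<^sup>-\<^sup>1\<^sup>/\<^sup>2\<close> with a unitary \<open>Z\<close> that intertwines \<open>F\<^sub>1\<close> and \<open>F\<^sub>2\<close> modulo smoothing operators, that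
is, operators \<open>b\<^sub>1\<^sup>1\<^sup>/\<^sup>2 k b\<^sub>1\<^sup>1\<^sup>/\<^sup>2\<close> with adjointable \<open>k\<close>. The remainder
\<open>T = \<langle>D\<^sub>2\<rangle>\<^sup>1\<^sup>/\<^sup>2 (F\<^sub>2 - Z F\<^sub>1 Z\<^sup>*) \<langle>D\<^sub>2\<rangle>\<^sup>1\<^sup>/\<^sup>2\<close> is then a bounded self-adjoint operator, and all the other assertions
become statements about factors of \<open>b\<^sub>1\<^sup>\<alpha>\<close>: \<open>G\<close>, \<open>Z - 1\<close> and \<open>Z\<^sup>* - 1\<close> are of the form \<open>R b\<^sub>1\<^sup>\<alpha>\<close>, and
\<open>[F\<^sub>1, \<mu>] = - G \<mu>\<close> up to an operator of the form \<open>R b\<^sub>1\<close> (\<open>bounded_perturbation\<close>).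

To construct \<open>Z\<close>, note that \<open>F\<^sub>i\<^sup>2 = 1 - b\<^sub>i\<^sup>2\<close>. So the \<open>F\<^sub>i\<close> are symmetries modulo smoothing operators, and for
symmetries \<open>(1 + F\<^sub>2 F\<^sub>1) / 2 = 1 - F\<^sub>2 G / 2\<close> is an intertwiner. The hypothesis \<open>G = R b\<^sub>1\<^sup>\<alpha>\<close> makes \<open>F\<^sub>2 G h\<close> small
in norm for the cutoff \<open>h = (1 - b\<^sub>1)\<^sup>n\<close> with large \<open>n\<close>, while \<open>1 - h\<close> is smoothing. As \<open>F\<^sub>2 G h\<close> is bounded on \<open>H\<^sup>1\<close>
uniformly in \<open>n\<close>, interpolation makes it small on \<open>H\<^sup>1\<^sup>/\<^sup>2\<close> as well (\<open>small_intertwiner\<close>,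
\<open>small_intertwiner_smoothing\<close>). Hence \<open>Z\<^sub>0 = 1 - F\<^sub>2 G h / 2\<close> is invertible, and
\<open>Z = (Z\<^sub>0 Z\<^sub>0\<^sup>*)\<^sup>-\<^sup>1\<^sup>/\<^sup>2 Z\<^sub>0\<close> is given by a power series that converges on \<open>H\<^sup>1\<^sup>/\<^sup>2\<close> too and commutes with \<open>F\<^sub>2\<close> modulo
smoothing operators (\<open>unitary_intertwiner\<close>).

The analysis of Hilbert modules behind this is kept elementary. The Cauchy--Schwarz inequality with constant 3
follows from the triangle inequality. A self-adjoint \<open>w\<close> with \<open>norm (w\<^sup>2) < 1\<close> is the real part of the unitary
\<open>w + i (1 - w\<^sup>2)\<^sup>1\<^sup>/\<^sup>2\<close>, so that the Chebyshev polynomials of \<open>w\<close> are contractions; together with the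
C*-identity this bounds \<open>p(w)\<close> by the supremum of \<open>p\<close> and gives the functional calculus
(\<open>peval_bound_symmetric\<close>). Interpolation rests on Reid's inequality for operators that are symmetric with
respect to a second inner product (\<open>reid_inequality\<close>, \<open>heinz_half\<close>, \<open>heinz_interpolation\<close>). For a self-adjoint
regular \<open>D\<close> the operator \<open>2 (1 + D\<^sup>2)\<^sup>-\<^sup>1 - 1\<close> is the real part of the Cayley transform, which places the
spectrum of the resolvent in \<open>[0, 1]\<close> (\<open>bounded_transform_exists\<close>).
\<close>

section \<open>The Banach algebra of bounded operators\<close>

text \<open>A copy of the space of bounded operators on which composition is the multiplication of a normed
  algebra. The unit laws come from \<^class>\<open>monoid_mult\<close>, since on the zero module \<open>1 = 0\<close>.\<close>

typedef (overloaded) 'a endo = "UNIV :: ('a::real_normed_vector \<Rightarrow>\<^sub>L 'a) set" ..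

setup_lifting type_definition_endo

lift_definition app :: "'a::real_normed_vector endo \<Rightarrow> 'a \<Rightarrow> 'a" (infixr "\<cdot>" 75) is blinfun_apply .

lemma endo_eqI: "(\<And>x. X \<cdot> x = Y \<cdot> x) \<Longrightarrow> X = Y"
  by transfer (simp add: blinfun_eqI)

instantiation endo :: (real_normed_vector) real_normed_vector
begin

lift_definition zero_endo :: "'a endo" is 0 .
lift_definition plus_endo :: "'a endo \<Rightarrow> 'a endo \<Rightarrow> 'a endo" is "(+)" .
lift_definition minus_endo :: "'a endo \<Rightarrow> 'a endo \<Rightarrow> 'a endo" is "(-)" .
lift_definition uminus_endo :: "'a endo \<Rightarrow> 'a endo" is uminus .
lift_definition scaleR_endo :: "real \<Rightarrow> 'a endo \<Rightarrow> 'a endo" is scaleR .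
lift_definition norm_endo :: "'a endo \<Rightarrow> real" is norm .
definition sgn_endo :: "'a endo \<Rightarrow> 'a endo" where "sgn_endo x = scaleR (inverse (norm x)) x"
definition dist_endo :: "'a endo \<Rightarrow> 'a endo \<Rightarrow> real" where "dist_endo x y = norm (x - y)"
definition uniformity_endo :: "('a endo \<times> 'a endo) filter" where
  "uniformity_endo = (INF e\<in>{0<..}. principal {(x, y). dist x y < e})"
definition open_endo :: "'a endo set \<Rightarrow> bool" where
  "open_endo U = (\<forall>x\<in>U. \<forall>\<^sub>F (x', y) in uniformity. x' = x \<longrightarrow> y \<in> U)"

instance
proof
  show "dist x y = norm (x - y)" for x y :: "'a endo" by (simp add: dist_endo_def)
  show "sgn x = scaleR (inverse (norm x)) x" for x :: "'a endo" by (simp add: sgn_endo_def)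
  show "uniformity = (INF e\<in>{0<..}. principal {(x::'a endo, y). dist x y < e})"
    by (simp add: uniformity_endo_def)
  show "open U = (\<forall>x\<in>U. \<forall>\<^sub>F (x', y) in uniformity. x' = x \<longrightarrow> y \<in> U)" for U :: "'a endo set"
    by (simp add: open_endo_def)
qed (transfer; simp add: algebra_simps norm_triangle_ineq)+

end

instantiation endo :: (real_normed_vector) "{real_normed_algebra, monoid_mult}"
begin

lift_definition one_endo :: "'a endo" is id_blinfun .
lift_definition times_endo :: "'a endo \<Rightarrow> 'a endo \<Rightarrow> 'a endo" is "(o\<^sub>L)" .

instance
proof
  show "norm (x * y) \<le> norm x * norm y" for x y :: "'a endo"
    by transfer (rule norm_blinfun_compose)
qed (transfer; auto intro!: blinfun_eqI simp: blinfun.bilinear_simps)+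

end

instance endo :: (banach) banach
proof
  fix X :: "nat \<Rightarrow> 'a endo"
  assume "Cauchy X"
  then have "Cauchy (\<lambda>n. Rep_endo (X n))"
    unfolding Cauchy_def dist_norm by transfer simp
  then obtain L where L: "(\<lambda>n. Rep_endo (X n)) \<longlonglongrightarrow> L"
    using Cauchy_convergent convergent_def by blast
  have "(\<lambda>n. norm (Rep_endo (X n) - L)) \<longlonglongrightarrow> 0"
    using L LIM_zero tendsto_norm_zero by blast
  then have "(\<lambda>n. norm (X n - Abs_endo L)) \<longlonglongrightarrow> 0"
    by (simp add: norm_endo.rep_eq minus_endo.rep_eq Abs_endo_inverse)
  then show "convergent X"
    by (metis LIM_zero_cancel convergent_def tendsto_norm_zero_iff)
qed

lemma app_simps [simp]:
  "0 \<cdot> x = 0" "(X + Y) \<cdot> x = X \<cdot> x + Y \<cdot> x" "(X - Y) \<cdot> x = X \<cdot> x - Y \<cdot> x"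
  "(- X) \<cdot> x = - (X \<cdot> x)" "(c *\<^sub>R X) \<cdot> x = c *\<^sub>R (X \<cdot> x)" "1 \<cdot> x = x" "(X * Y) \<cdot> x = X \<cdot> Y \<cdot> x"
  by (transfer; simp add: blinfun.bilinear_simps)+

lemma bounded_linear_app: "bounded_linear (app X)"
  by transfer (rule blinfun.bounded_linear_right)

lemma bounded_bilinear_app: "bounded_bilinear app"
  unfolding app_def
  apply (rule bounded_bilinear.intro)
      apply (auto simp: app_def blinfun.bilinear_simps plus_endo.rep_eq scaleR_endo.rep_eq norm_endo.rep_eq)
  by (metis mult.commute mult.left_neutral norm_blinfun)

lemma app_linear [simp]:
  "X \<cdot> (x + y) = X \<cdot> x + X \<cdot> y" "X \<cdot> (x - y) = X \<cdot> x - X \<cdot> y" "X \<cdot> (- x) = - (X \<cdot> x)"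
  "X \<cdot> (c *\<^sub>R x) = c *\<^sub>R (X \<cdot> x)" "X \<cdot> 0 = 0"
  by (transfer; simp add: blinfun.bilinear_simps)+

lemma norm_app: "norm (X \<cdot> x) \<le> norm X * norm x"
  by transfer (rule norm_blinfun)

lemma norm_endo_onorm: "norm X = onorm (app X)"
  by transfer (simp add: norm_blinfun.rep_eq)

lemma norm_endo_bound: "0 \<le> M \<Longrightarrow> (\<And>x. norm (X \<cdot> x) \<le> M * norm x) \<Longrightarrow> norm X \<le> M"
  unfolding norm_endo_onorm by (rule onorm_bound)

lemma norm_one_endo: "norm (1::'a::real_normed_vector endo) \<le> 1"
  by (rule norm_endo_bound) auto

lemma norm_power_endo: "norm (X ^ n) \<le> norm X ^ n" for X :: "'a::real_normed_vector endo"
proof (induction n)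
  case (Suc n)
  then show ?case
    by (metis mult_left_mono norm_ge_zero norm_mult_ineq order_trans power_Suc)
qed (simp add: norm_one_endo)

definition Endo :: "('a::real_normed_vector \<Rightarrow> 'a) \<Rightarrow> 'a endo" where
  "Endo f = Abs_endo (Blinfun f)"

lemma app_Endo: "bounded_linear f \<Longrightarrow> Endo f \<cdot> x = f x"
  by (simp add: Endo_def app.abs_eq bounded_linear_Blinfun_apply)

lemma tendsto_app: "(f \<longlongrightarrow> X) F \<Longrightarrow> (g \<longlongrightarrow> x) F \<Longrightarrow> ((\<lambda>n. f n \<cdot> g n) \<longlongrightarrow> X \<cdot> x) F"
  by (rule bounded_bilinear.tendsto[OF bounded_bilinear_app])

lemma app_power: "(X ^ n) \<cdot> x = (app X ^^ n) x"
  by (induction n) auto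

abbreviation dense_range :: "'a::real_normed_vector endo \<Rightarrow> bool" where
  "dense_range R \<equiv> closure (range (app R)) = UNIV"

lemma continuous_eq_on_dense:
  fixes f g :: "'a::topological_space \<Rightarrow> 'b::t2_space"
  assumes "continuous_on UNIV f" "continuous_on UNIV g" "closure S = UNIV" "\<And>x. x \<in> S \<Longrightarrow> f x = g x"
  shows "f x = g x"
proof -
  have "closed {x. f x = g x}"
    using assms by (intro closed_Collect_eq) auto
  moreover have "S \<subseteq> {x. f x = g x}" using assms by auto
  ultimately have "closure S \<subseteq> {x. f x = g x}" by (rule closure_minimal[rotated])
  then show ?thesis using assms by auto
qed

lemma continuous_on_app [continuous_intros]:
  "continuous_on S f \<Longrightarrow> continuous_on S (\<lambda>x. X \<cdot> f x)"
  by (rule bounded_linear.continuous_on[OF bounded_linear_app])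

lemma dense_range_cancel:
  assumes "dense_range R" "X * R = Y * R"
  shows "X = Y"
proof (rule endo_eqI)
  fix x
  show "X \<cdot> x = Y \<cdot> x"
  proof (rule continuous_eq_on_dense[where S = "range (app R)" and f = "app X" and g = "app Y"])
    fix x assume "x \<in> range (app R)"
    then obtain y where "x = R \<cdot> y" by auto
    then show "X \<cdot> x = Y \<cdot> x" using assms(2) by (metis app_simps(7))
  qed (use assms in \<open>auto intro!: linear_continuous_on bounded_linear_app\<close>)
qed

lemma inj_cancel:
  assumes "inj (app R)" "R * X = R * Y"
  shows "X = Y"
  by (rule endo_eqI) (metis app_simps(7) assms injD)

text \<open>Douglas factorization: the bound makes \<open>N y\<close> a Lipschitz function of \<open>R y\<close>, which extends from the
  dense range of \<open>R\<close>.\<close>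

lemma endo_factor:
  fixes R N :: "'a::banach endo"
  assumes dense: "dense_range R" and C: "0 \<le> C" and bound: "\<And>y. norm (N \<cdot> y) \<le> C * norm (R \<cdot> y)"
  obtains M where "M * R = N" "norm M \<le> C"
proof -
  let ?S = "range (app R)"
  define f where "f x = N \<cdot> (SOME y. R \<cdot> y = x)" for x
  have f: "f (R \<cdot> y) = N \<cdot> y" for y
  proof -
    define y' where "y' = (SOME y'. R \<cdot> y' = R \<cdot> y)"
    have "R \<cdot> y' = R \<cdot> y" unfolding y'_def by (rule someI) simp
    then have "norm (N \<cdot> (y' - y)) \<le> 0"
      using bound[of "y' - y"] by simp
    then show ?thesis by (simp add: f_def y'_def)
  qed
  have lip: "C-lipschitz_on ?S f"
  proof (rule lipschitz_onI)
    fix x y assume "x \<in> ?S" "y \<in> ?S"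
    then obtain u v where [simp]: "x = R \<cdot> u" "y = R \<cdot> v" by auto
    have "norm (N \<cdot> (u - v)) \<le> C * norm (R \<cdot> (u - v))" by (rule bound)
    then show "dist (f x) (f y) \<le> C * dist x y"
      by (simp add: f dist_norm)
  qed (rule C)
  have uc: "uniformly_continuous_on ?S f" using lip by (rule lipschitz_on_uniformly_continuous)
  obtain g where g: "uniformly_continuous_on (closure ?S) g" "\<And>x. x \<in> ?S \<Longrightarrow> f x = g x"
    using uniformly_continuous_on_extension_on_closure[OF uc] by metis
  have cg: "continuous_on UNIV g"
    using g(1) dense uniformly_continuous_imp_continuous by metis
  have cg': "continuous_on T (\<lambda>x. g (h x))" if "continuous_on T h" for h :: "'a \<Rightarrow> 'a" and T
    using continuous_on_compose2[OF cg that] by auto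
  have gR: "g (R \<cdot> y) = N \<cdot> y" for y using g(2)[of "R \<cdot> y"] f by simp
  have add: "g (x + y) = g x + g y" for x y
  proof (rule continuous_eq_on_dense[OF _ _ dense, of "\<lambda>x. g (x + y)" "\<lambda>x. g x + g y"])
    fix x assume "x \<in> ?S"
    then obtain u where x: "x = R \<cdot> u" by auto
    show "g (x + y) = g x + g y"
    proof (rule continuous_eq_on_dense[OF _ _ dense, of "\<lambda>y. g (x + y)" "\<lambda>y. g x + g y"])
      fix y assume "y \<in> ?S"
      then obtain v where y: "y = R \<cdot> v" by auto
      show "g (x + y) = g x + g y" unfolding x y
        by (metis app_linear(1) gR)
    qed (auto intro!: continuous_intros cg')
  qed (auto intro!: continuous_intros cg')
  have scale: "g (c *\<^sub>R x) = c *\<^sub>R g x" for c x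
  proof (rule continuous_eq_on_dense[OF _ _ dense, of "\<lambda>x. g (c *\<^sub>R x)" "\<lambda>x. c *\<^sub>R g x"])
    fix x assume "x \<in> ?S"
    then obtain u where x: "x = R \<cdot> u" by auto
    show "g (c *\<^sub>R x) = c *\<^sub>R g x" unfolding x by (metis app_linear(4) gR)
  qed (auto intro!: continuous_intros cg')
  have bd: "norm (g x) \<le> norm x * C" for x
  proof -
    have "closed {x. norm (g x) \<le> norm x * C}"
      by (intro closed_Collect_le continuous_intros cg')
    moreover have "?S \<subseteq> {x. norm (g x) \<le> norm x * C}"
      using bound by (auto simp: gR mult.commute)
    ultimately have "closure ?S \<subseteq> {x. norm (g x) \<le> norm x * C}" by (rule closure_minimal[rotated])
    then show ?thesis using dense by auto
  qed
  have bl: "bounded_linear g"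
    by (rule bounded_linear_intro[OF add scale bd])
  have "Endo g * R = N" by (rule endo_eqI) (simp add: app_Endo[OF bl] gR)
  moreover have "norm (Endo g) \<le> C"
    by (rule norm_endo_bound) (use C bd in \<open>auto simp: app_Endo[OF bl] mult.commute\<close>)
  ultimately show thesis by (rule that)
qed

section \<open>The closed graph theorem\<close>

text \<open>Baire's theorem makes some set \<open>{x. norm (f x) \<le> n}\<close> dense in a ball; successive halving of the
  error then writes every vector as a series along which \<open>f\<close> converges absolutely, and closedness of
  the graph identifies the limit.\<close>

lemma closed_graph_theorem:
  fixes f :: "'a::banach \<Rightarrow> 'b::banach"
  assumes lin: "linear f"
    and graph: "\<And>X x y. X \<longlonglongrightarrow> x \<Longrightarrow> (\<lambda>n. f (X n)) \<longlonglongrightarrow> y \<Longrightarrow> f x = y"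
  shows "bounded_linear f"
proof -
  interpret linear f by (rule lin)
  define A where "A n = closure {x. norm (f x) \<le> real n}" for n
  have cover: "(\<Union>n. A n) = UNIV"
  proof -
    have "\<exists>n. x \<in> A n" for x
    proof -
      obtain n where "norm (f x) \<le> real n" using real_arch_simple by blast
      then have "x \<in> {x. norm (f x) \<le> real n}" by simp
      then show ?thesis unfolding A_def by (meson closure_subset subsetD)
    qed
    then show ?thesis by auto
  qed
  have "\<exists>n. interior (A n) \<noteq> {}"
  proof (rule ccontr)
    assume *: "\<not> ?thesis"
    have "(euclidean::'a topology) interior_of \<Union>(range A) = {}"
    proof (rule Baire_category_alt)
      show "completely_metrizable_space (euclidean::'a topology) \<or> locally_compact_space (euclidean::'a topology) \<and> regular_space (euclidean::'a topology)"
        by (intro disjI1 completely_metrizable_space_euclidean)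
      show "closedin euclidean T \<and> (euclidean::'a topology) interior_of T = {}" if "T \<in> range A" for T
        using that * by (auto simp: A_def)
    qed simp
    then show False using cover by simp
  qed
  then obtain n x0 where "x0 \<in> interior (A n)" by (metis ex_in_conv)
  then obtain e where e: "e > 0" "cball x0 e \<subseteq> A n"
    unfolding mem_interior_cball by (elim exE conjE)
  define K where "K = 2 * real n / e"
  have K0: "K \<ge> 0" using e by (simp add: K_def)
  \<comment> \<open>every vector is approximated, within half its norm, by one on which \<open>f\<close> is controlled\<close>
  have approx: "\<exists>y. norm (x - y) \<le> norm x / 2 \<and> norm (f y) \<le> K * norm x" for x
  proof (cases "x = 0")
    case True then show ?thesis by (intro exI[of _ 0]) (simp add: zero)
  next
    case False
    define c where "c = e / norm x"
    have c: "c > 0" using False e by (simp add: c_def)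
    have near: "\<exists>u. norm (f u) \<le> n \<and> dist u z < e / 4" if "z \<in> cball x0 e" for z
    proof -
      have "z \<in> closure {x. norm (f x) \<le> real n}" using e that unfolding A_def by blast
      moreover have "e / 4 > 0" using e by simp
      ultimately show ?thesis unfolding closure_approachable by blast
    qed
    obtain u where u: "norm (f u) \<le> n" "dist u x0 < e / 4"
      using near[of x0] e by auto
    have "x0 + c *\<^sub>R x \<in> cball x0 e" using False e by (simp add: dist_norm c_def)
    then obtain v where v: "norm (f v) \<le> n" "dist v (x0 + c *\<^sub>R x) < e / 4"
      using near by blast
    have "norm (c *\<^sub>R x - (v - u)) = norm ((u - x0) - (v - (x0 + c *\<^sub>R x)))"
      by (simp add: algebra_simps)
    also have "\<dots> \<le> dist u x0 + dist v (x0 + c *\<^sub>R x)"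
      unfolding dist_norm by (rule norm_triangle_ineq4)
    also have "\<dots> \<le> e / 2" using u v by simp
    finally have 1: "norm (c *\<^sub>R x - (v - u)) \<le> e / 2" .
    have "norm (f (v - u)) \<le> norm (f v) + norm (f u)" by (simp add: diff norm_triangle_ineq4)
    then have 2: "norm (f (v - u)) \<le> 2 * n" using u v by simp
    have "x - (v - u) /\<^sub>R c = (c *\<^sub>R x - (v - u)) /\<^sub>R c"
      using c by (simp add: scaleR_diff_right)
    then have "norm (x - (v - u) /\<^sub>R c) = norm (c *\<^sub>R x - (v - u)) / c"
      using c by (simp add: divide_inverse mult.commute)
    also have "\<dots> \<le> (e / 2) / c" using 1 c by (intro divide_right_mono) auto
    also have "\<dots> = norm x / 2" using e False by (simp add: c_def)
    finally have "norm (x - (v - u) /\<^sub>R c) \<le> norm x / 2" .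
    moreover have "norm (f ((v - u) /\<^sub>R c)) \<le> K * norm x"
    proof -
      have "norm (f ((v - u) /\<^sub>R c)) = norm (f (v - u)) / c"
        using c by (simp add: scale divide_inverse mult.commute)
      also have "\<dots> \<le> 2 * n / c" using 2 c by (intro divide_right_mono) auto
      finally show ?thesis by (simp add: c_def K_def)
    qed
    ultimately show ?thesis by blast
  qed
  then obtain g where g: "\<And>x. norm (x - g x) \<le> norm x / 2" "\<And>x. norm (f (g x)) \<le> K * norm x"
    by metis
  have "norm (f x) \<le> norm x * (2 * K)" for x
  proof -
    define r where "r k = ((\<lambda>x. x - g x) ^^ k) x" for k
    have r0: "r 0 = x" and rS: "r (Suc k) = r k - g (r k)" for k by (auto simp: r_def)
    have rb: "norm (r k) \<le> norm x * (1/2) ^ k" for k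
    proof (induction k)
      case (Suc k)
      have "norm (r (Suc k)) \<le> norm (r k) / 2" using g(1) by (simp add: rS)
      with Suc show ?case by simp
    qed (simp add: r0)
    define h where "h k = f (g (r k))" for k
    have geo: "(\<lambda>k. K * norm x * (1/2::real) ^ k) sums (K * norm x * 2)"
      using sums_mult[OF geometric_sums[of "1/2::real"], of "K * norm x"] by simp
    have hb: "norm (h k) \<le> K * norm x * (1/2) ^ k" for k
    proof -
      have "norm (h k) \<le> K * norm (r k)" unfolding h_def by (rule g)
      also have "\<dots> \<le> K * (norm x * (1/2) ^ k)" using rb K0 by (rule mult_left_mono)
      finally show ?thesis by simp
    qed
    have sh: "summable h" by (rule summable_comparison_test'[OF sums_summable[OF geo] hb])
    have nh: "norm (suminf h) \<le> K * norm x * 2"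
      using norm_suminf_le[OF hb sums_summable[OF geo]] sums_unique[OF geo] by simp
    have part: "(\<Sum>k<m. g (r k)) = x - r m" for m
      by (induction m) (auto simp: r0 rS algebra_simps)
    have "(\<lambda>m. norm x * (1/2) ^ m) \<longlonglongrightarrow> norm x * 0"
      by (intro tendsto_intros LIMSEQ_power_zero) auto
    then have "r \<longlonglongrightarrow> 0"
      by (intro Lim_null_comparison[of r "\<lambda>m. norm x * (1/2) ^ m"]) (use rb in auto)
    then have "(\<lambda>m. \<Sum>k<m. g (r k)) \<longlonglongrightarrow> x - 0"
      unfolding part by (intro tendsto_intros)
    moreover have "(\<lambda>m. f (\<Sum>k<m. g (r k))) \<longlonglongrightarrow> suminf h"
      using summable_LIMSEQ[OF sh] by (simp add: sum h_def)
    ultimately have "f x = suminf h" using graph by force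
    then show ?thesis using nh by (simp add: mult_ac)
  qed
  then show ?thesis
    by (intro bounded_linear_intro[of f "2 * K"]) (auto simp: add scale)
qed

text \<open>The factor \<open>R\<^sup>-\<^sup>1 N\<close> is everywhere defined and its graph is closed.\<close>

lemma range_factor:
  fixes R N :: "'a::banach endo"
  assumes inj: "inj (app R)" and ran: "range (app N) \<subseteq> range (app R)"
  obtains Y where "R * Y = N"
proof -
  define f where "f x = (THE y. R \<cdot> y = N \<cdot> x)" for x
  have f: "R \<cdot> f x = N \<cdot> x" for x
  proof -
    have "N \<cdot> x \<in> range (app R)" using ran by (rule subsetD) simp
    then obtain y where y: "R \<cdot> y = N \<cdot> x" by (metis rangeE)
    show ?thesis unfolding f_def
    proof (rule theI)
      show "R \<cdot> y = N \<cdot> x" by (rule y)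
      show "y' = y" if "R \<cdot> y' = N \<cdot> x" for y'
        by (rule injD[OF inj]) (simp only: that y)
    qed
  qed
  have eq: "f x = y" if "R \<cdot> y = N \<cdot> x" for x y
    by (rule injD[OF inj]) (simp only: f that)
  have "bounded_linear f"
  proof (rule closed_graph_theorem)
    show "linear f" by (rule linearI) (auto intro!: eq simp: f)
    fix X x y assume X: "X \<longlonglongrightarrow> x" and Y: "(\<lambda>n. f (X n)) \<longlonglongrightarrow> y"
    have "(\<lambda>n. R \<cdot> f (X n)) \<longlonglongrightarrow> R \<cdot> y" by (rule tendsto_app[OF tendsto_const Y])
    moreover have "(\<lambda>n. N \<cdot> X n) \<longlonglongrightarrow> N \<cdot> x" by (rule tendsto_app[OF tendsto_const X])
    ultimately have "R \<cdot> y = N \<cdot> x" unfolding f by (rule LIMSEQ_unique)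
    then show "f x = y" by (rule eq)
  qed
  then have "R * Endo f = N" by (intro endo_eqI) (simp add: app_Endo f)
  then show thesis by (rule that)
qed

section \<open>Adjointable operators on a Hilbert module\<close>

lemma norm_cstar: "norm (cstar a) = norm (a::'b::cstar_algebra)"
proof -
  have le: "norm a \<le> norm (cstar a)" for a :: 'b
  proof (cases "a = 0")
    case False
    have "norm a * norm a \<le> norm (cstar a) * norm a"
      using cstar_identity[of a] norm_mult_ineq[of "cstar a" a] by (simp add: power2_eq_square)
    then show ?thesis using False by simp
  qed simp
  show ?thesis using le[of a] le[of "cstar a"] by (simp add: cstar_cstar)
qed

context hilbert_module
begin

lemma ip_add_left: "ip (x + y) z = ip x z + ip y z"
  by (metis cstar_add cstar_ip ip_add_right)

lemma ip_scaleC_left: "ip (k *\<^sub>C x) z = cnj k *\<^sub>C ip x z"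
  by (metis cstar_scaleC cstar_ip ip_scaleC_right)

lemma ip_scaleR_right: "ip x (r *\<^sub>R y) = r *\<^sub>R ip x y"
  by (metis ip_scaleC_right scaleC_of_real)

lemma ip_scaleR_left: "ip (r *\<^sub>R x) y = r *\<^sub>R ip x y"
  by (metis complex_cnj_complex_of_real ip_scaleC_left scaleC_of_real)

lemma ip_act_left: "ip (act x b) y = cstar b * ip x y"
  by (metis cstar_ip cstar_mult ip_act_right)

lemma norm_ip_self: "norm (ip x x) = (norm x)\<^sup>2"
  by (simp add: norm_ip)

lemma norm_act: "norm (act x b) \<le> norm x * norm b"
proof -
  have "(norm (act x b))\<^sup>2 = norm (cstar b * (ip x x * b))"
    by (simp flip: norm_ip_self add: ip_act_left ip_act_right mult.assoc)
  also have "\<dots> \<le> norm (cstar b) * (norm (ip x x) * norm b)"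
    by (meson mult_left_mono norm_ge_zero norm_mult_ineq order_trans)
  also have "\<dots> = (norm x * norm b)\<^sup>2"
    by (simp add: norm_cstar norm_ip_self power2_eq_square)
  finally show ?thesis by (rule power2_le_imp_le) simp
qed

text \<open>Cauchy--Schwarz up to a constant: in the expansion of \<open>ip (x + t v) (x + t v)\<close> for
  \<open>v = y \<langle>y, x\<rangle>\<close> the mixed terms add up to \<open>2 t \<langle>x, y\<rangle> \<langle>x, y\<rangle>\<^sup>*\<close>, and the triangle inequality for the
  norm of the module bounds everything else.\<close>

lemma cauchy_schwarz: "norm (ip x y) \<le> 3 * norm x * norm y"
proof (cases "ip x y = 0 \<or> x = 0 \<or> y = 0")
  case True
  then show ?thesis
  proof (elim disjE)
    assume "x = 0" then have "ip x y = 0" using ip_scaleR_left[of 0 0 y] by simp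
    then show ?thesis by simp
  next
    assume "y = 0" then have "ip x y = 0" using ip_scaleR_right[of x 0 0] by simp
    then show ?thesis by simp
  qed simp
next
  case False
  define a where "a = ip x y"
  define v where "v = act y (cstar a)"
  define q where "q = norm y * norm a"
  define t where "t = norm x / q"
  have q: "q > 0" and a: "norm a > 0" and x: "norm x > 0" using False by (auto simp: q_def a_def)
  then have t: "t > 0" by (simp add: t_def)
  have v: "norm v \<le> q" using norm_act[of y "cstar a"] by (simp add: v_def q_def norm_cstar)
  have xv: "ip x v = a * cstar a" and vx: "ip v x = a * cstar a"
    unfolding v_def by (simp_all add: ip_act_right ip_act_left cstar_cstar a_def cstar_ip)
  have "norm (cstar (cstar a) * cstar a) = (norm (cstar a))\<^sup>2" by (rule cstar_identity)
  then have na: "norm (a * cstar a) = (norm a)\<^sup>2" by (simp add: norm_cstar cstar_cstar)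
  have exp: "(2 * t) *\<^sub>R (a * cstar a) = ip (x + t *\<^sub>R v) (x + t *\<^sub>R v) - ip x x - (t * t) *\<^sub>R ip v v"
    by (simp add: ip_add_left ip_add_right ip_scaleR_left ip_scaleR_right xv vx algebra_simps
        flip: scaleR_2)
  have "2 * t * (norm a)\<^sup>2 = norm ((2 * t) *\<^sub>R (a * cstar a))" using t na by simp
  also have "\<dots> \<le> norm (ip (x + t *\<^sub>R v) (x + t *\<^sub>R v)) + norm (ip x x) + norm ((t * t) *\<^sub>R ip v v)"
    unfolding exp
    using norm_triangle_ineq4[of "ip (x + t *\<^sub>R v) (x + t *\<^sub>R v) - ip x x" "(t * t) *\<^sub>R ip v v"]
      norm_triangle_ineq4[of "ip (x + t *\<^sub>R v) (x + t *\<^sub>R v)" "ip x x"] by linarith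
  also have "\<dots> = (norm (x + t *\<^sub>R v))\<^sup>2 + (norm x)\<^sup>2 + (t * norm v)\<^sup>2"
    using t by (simp add: norm_ip_self power2_eq_square mult.assoc mult.left_commute)
  also have "\<dots> \<le> (norm x + norm x)\<^sup>2 + (norm x)\<^sup>2 + (norm x)\<^sup>2"
  proof -
    have tv: "t * norm v \<le> norm x"
    proof -
      have "t * norm v \<le> t * q" using v t by simp
      also have "\<dots> = norm x" using q by (simp add: t_def)
      finally show ?thesis .
    qed
    have "norm (x + t *\<^sub>R v) \<le> norm x + norm x"
      using norm_triangle_ineq[of x "t *\<^sub>R v"] tv t by simp
    then show ?thesis using tv t by (intro add_mono power_mono) auto
  qed
  also have "\<dots> = 6 * (norm x)\<^sup>2" by (simp add: power2_eq_square)
  finally have "2 * (norm x / q) * (norm a)\<^sup>2 \<le> 6 * (norm x)\<^sup>2" by (simp add: t_def)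
  then have "(norm a)\<^sup>2 \<le> 3 * norm x * q"
    using q x by (simp add: field_simps power2_eq_square)
  then have "norm a * norm a \<le> (3 * norm x * norm y) * norm a"
    by (simp add: q_def power2_eq_square mult.assoc)
  then show ?thesis using a by (simp add: a_def)
qed

lemma bounded_bilinear_ip: "bounded_bilinear ip"
  by (rule bounded_bilinear.intro)
     (auto simp: ip_add_left ip_add_right ip_scaleR_left ip_scaleR_right mult.assoc
       intro!: exI[of _ 3] order_trans[OF cauchy_schwarz])

lemmas ip_bilinear [simp] =
  bounded_bilinear.zero_left[OF bounded_bilinear_ip] bounded_bilinear.zero_right[OF bounded_bilinear_ip]
  bounded_bilinear.minus_left[OF bounded_bilinear_ip] bounded_bilinear.minus_right[OF bounded_bilinear_ip]
  bounded_bilinear.diff_left[OF bounded_bilinear_ip] bounded_bilinear.diff_right[OF bounded_bilinear_ip]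
  ip_add_left ip_add_right ip_scaleR_left ip_scaleR_right

lemmas tendsto_ip = bounded_bilinear.tendsto[OF bounded_bilinear_ip]
lemmas continuous_on_ip [continuous_intros] = bounded_bilinear.continuous_on[OF bounded_bilinear_ip]

lemma ip_self_zero: "ip x x = 0 \<Longrightarrow> x = 0"
  using norm_ip_self[of x] by simp

lemma ip_ext_left: "(\<And>z. ip x z = ip y z) \<Longrightarrow> x = y"
  using ip_self_zero[of "x - y"] by simp

lemma ip_ext: "(\<And>z. ip z x = ip z y) \<Longrightarrow> x = y"
  using ip_self_zero[of "x - y"] by simp

lemma norm_scaleC_module: "norm (c *\<^sub>C x) = cmod c * norm (x::'e)"
proof -
  have "ip (c *\<^sub>C x) (c *\<^sub>C x) = (c * cnj c) *\<^sub>C ip x x"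
    by (simp only: ip_scaleC_left ip_scaleC_right scaleC_scaleC)
  then have "(norm (c *\<^sub>C x))\<^sup>2 = cmod (c * cnj c) * norm (ip x x)"
    by (simp only: norm_scaleC flip: norm_ip_self)
  also have "\<dots> = (cmod c * norm x)\<^sup>2"
    by (simp only: norm_mult complex_mod_cnj norm_ip_self power2_eq_square mult_ac)
  finally show ?thesis by (rule power2_eq_imp_eq) simp_all
qed

definition adj :: "'e endo \<Rightarrow> 'e endo \<Rightarrow> bool" where
  "adj X Y \<longleftrightarrow> (\<forall>x y. ip (X \<cdot> x) y = ip x (Y \<cdot> y))"

abbreviation selfadj :: "'e endo \<Rightarrow> bool" where "selfadj X \<equiv> adj X X"

lemma adjD: "adj X Y \<Longrightarrow> ip (X \<cdot> x) y = ip x (Y \<cdot> y)" by (simp add: adj_def)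

lemma adj_sym: "adj X Y \<Longrightarrow> adj Y X"
  unfolding adj_def by (metis cstar_ip)

lemma adj_add: "adj X X' \<Longrightarrow> adj Y Y' \<Longrightarrow> adj (X + Y) (X' + Y')" by (simp add: adj_def)
lemma adj_diff: "adj X X' \<Longrightarrow> adj Y Y' \<Longrightarrow> adj (X - Y) (X' - Y')" by (simp add: adj_def)
lemma adj_minus: "adj X X' \<Longrightarrow> adj (- X) (- X')" by (simp add: adj_def)
lemma adj_scaleR: "adj X X' \<Longrightarrow> adj (r *\<^sub>R X) (r *\<^sub>R X')" by (simp add: adj_def)
lemma adj_mult: "adj X X' \<Longrightarrow> adj Y Y' \<Longrightarrow> adj (X * Y) (Y' * X')" by (simp add: adj_def)
lemma adj_one: "adj 1 1" by (simp add: adj_def)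
lemma adj_zero: "adj 0 0" by (simp add: adj_def)
lemma adj_power: "adj X X' \<Longrightarrow> adj (X ^ n) (X' ^ n)"
proof (induction n)
  case (Suc n)
  then have "adj (X * X ^ n) (X' ^ n * X')" by (intro adj_mult)
  then show ?case by (simp add: power_commutes)
qed (simp add: adj_one)
lemma adj_sum: "(\<And>i. i \<in> I \<Longrightarrow> adj (X i) (X' i)) \<Longrightarrow> adj (sum X I) (sum X' I)"
  by (induction I rule: infinite_finite_induct) (auto simp: adj_zero adj_add)

lemmas adj_intros = adj_add adj_diff adj_minus adj_scaleR adj_mult adj_one adj_zero adj_power

lemma adj_unique: "adj X Y \<Longrightarrow> adj X Z \<Longrightarrow> Y = Z"
  by (intro endo_eqI ip_ext) (metis adjD)

lemma adj_norm: "adj X Y \<Longrightarrow> norm Y \<le> 3 * norm X"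
proof (rule norm_endo_bound)
  fix y assume XY: "adj X Y"
  have "(norm (Y \<cdot> y))\<^sup>2 = norm (ip (X \<cdot> Y \<cdot> y) y)"
    using XY by (simp add: adjD norm_ip_self)
  also have "\<dots> \<le> 3 * norm (X \<cdot> Y \<cdot> y) * norm y" by (rule cauchy_schwarz)
  also have "\<dots> \<le> 3 * (norm X * norm (Y \<cdot> y)) * norm y"
    by (intro mult_right_mono mult_left_mono norm_app) auto
  finally have "norm (Y \<cdot> y) * norm (Y \<cdot> y) \<le> (3 * norm X * norm y) * norm (Y \<cdot> y)"
    by (simp add: power2_eq_square mult_ac)
  then show "norm (Y \<cdot> y) \<le> 3 * norm X * norm y"
    by (metis mult_le_cancel_right_pos mult_nonneg_nonneg norm_ge_zero zero_le_numeral zero_less_norm_iff norm_zero)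
qed simp

text \<open>Adjoints converge along with the operators because of the uniform bound in \<open>adj_norm\<close>.\<close>

lemma adj_limit:
  assumes S: "S \<longlonglongrightarrow> X" and SS: "\<And>n. adj (S n) (S' n)"
  obtains X' where "adj X X'" "S' \<longlonglongrightarrow> X'"
proof -
  have "Cauchy S'"
  proof (rule metric_CauchyI)
    fix e :: real assume "e > 0"
    then obtain N where N: "\<And>m n. m \<ge> N \<Longrightarrow> n \<ge> N \<Longrightarrow> dist (S m) (S n) < e / 3"
      using metric_CauchyD[OF LIMSEQ_imp_Cauchy[OF S], of "e / 3"] by auto
    have "dist (S' m) (S' n) < e" if "m \<ge> N" "n \<ge> N" for m n
      using N[OF that] adj_norm[OF adj_diff[OF SS[of m] SS[of n]]] by (simp add: dist_norm)
    then show "\<exists>M. \<forall>m\<ge>M. \<forall>n\<ge>M. dist (S' m) (S' n) < e" by blast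
  qed
  then obtain X' where X': "S' \<longlonglongrightarrow> X'" using Cauchy_convergent convergent_def by blast
  have "adj X X'" unfolding adj_def
  proof (intro allI)
    fix x y
    have "(\<lambda>n. ip (S n \<cdot> x) y) \<longlonglongrightarrow> ip (X \<cdot> x) y"
      by (intro tendsto_ip tendsto_app S tendsto_const)
    then have "(\<lambda>n. ip x (S' n \<cdot> y)) \<longlonglongrightarrow> ip (X \<cdot> x) y"
      by (simp only: adjD[OF SS])
    moreover have "(\<lambda>n. ip x (S' n \<cdot> y)) \<longlonglongrightarrow> ip x (X' \<cdot> y)"
      by (intro tendsto_ip tendsto_app X' tendsto_const)
    ultimately show "ip (X \<cdot> x) y = ip x (X' \<cdot> y)" by (rule LIMSEQ_unique)
  qed
  with X' show thesis using that by blast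
qed

lemma selfadj_limit: "S \<longlonglongrightarrow> X \<Longrightarrow> (\<And>n. selfadj (S n)) \<Longrightarrow> selfadj X"
  by (metis LIMSEQ_unique adj_limit)

text \<open>Testing the formal adjoint \<open>N\<close> on \<open>v = N z\<close> bounds \<open>norm (N z)\<close> by \<open>norm (R z)\<close>, so that \<open>N\<close> factors
  through \<open>R\<close>; the factor is the adjoint of \<open>M\<close>.\<close>

lemma adjointable_of_dense:
  assumes R: "dense_range R" and M: "\<And>v z. ip (M \<cdot> v) (R \<cdot> z) = ip v (N \<cdot> z)"
  obtains M' where "adj M M'" "M' * R = N"
proof -
  have "norm (N \<cdot> z) \<le> (3 * norm M) * norm (R \<cdot> z)" for z
  proof -
    have "(norm (N \<cdot> z))\<^sup>2 = norm (ip (M \<cdot> N \<cdot> z) (R \<cdot> z))"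
      by (simp add: M norm_ip_self)
    also have "\<dots> \<le> 3 * norm (M \<cdot> N \<cdot> z) * norm (R \<cdot> z)" by (rule cauchy_schwarz)
    also have "\<dots> \<le> 3 * (norm M * norm (N \<cdot> z)) * norm (R \<cdot> z)"
      by (intro mult_right_mono mult_left_mono norm_app) auto
    finally have "norm (N \<cdot> z) * norm (N \<cdot> z) \<le> (3 * norm M * norm (R \<cdot> z)) * norm (N \<cdot> z)"
      by (simp add: power2_eq_square mult_ac)
    then show ?thesis
      by (metis mult_le_cancel_right_pos mult_nonneg_nonneg norm_ge_zero zero_le_numeral zero_less_norm_iff norm_zero)
  qed
  then obtain M' where M': "M' * R = N" using endo_factor[OF R, of "3 * norm M" N] by auto
  have "adj M M'" unfolding adj_def
  proof (intro allI)
    fix x y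
    show "ip (M \<cdot> x) y = ip x (M' \<cdot> y)"
    proof (rule continuous_eq_on_dense[OF _ _ R, of "\<lambda>y. ip (M \<cdot> x) y" "\<lambda>y. ip x (M' \<cdot> y)"])
      fix y assume "y \<in> range (app R)"
      then show "ip (M \<cdot> x) y = ip x (M' \<cdot> y)" using M M' by (auto simp flip: app_simps(7))
    qed (auto intro!: continuous_intros)
  qed
  with M' show thesis using that by blast
qed

lemma selfadj_dense_inj:
  assumes "selfadj R" "dense_range R"
  shows "inj (app R)"
proof (rule injI)
  fix x y assume "R \<cdot> x = R \<cdot> y"
  then have *: "ip (x - y) (R \<cdot> z) = 0" for z
    using adjD[OF assms(1), of "x - y" z] by simp
  have "ip (x - y) z = 0" for z
    by (rule continuous_eq_on_dense[OF _ _ assms(2), of "\<lambda>z. ip (x - y) z" "\<lambda>_. 0"])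
       (use * in \<open>auto intro!: continuous_intros\<close>)
  then show "x = y" using ip_self_zero[of "x - y"] by simp
qed

lemma isometryD:
  assumes "adj u u'" "u' * u = 1"
  shows "norm (u \<cdot> x) = norm x"
proof -
  have "(norm (u \<cdot> x))\<^sup>2 = (norm x)\<^sup>2"
    using assms by (simp flip: norm_ip_self app_simps(7) add: adjD)
  then show ?thesis by simp
qed

definition mlin :: "'e endo \<Rightarrow> bool" where
  "mlin X \<longleftrightarrow> (\<forall>x b. X \<cdot> act x b = act (X \<cdot> x) b) \<and> (\<forall>c x. X \<cdot> (c *\<^sub>C x) = c *\<^sub>C (X \<cdot> x))"

lemma adj_mlin: "adj X Y \<Longrightarrow> mlin X"
  unfolding mlin_def
  by (intro conjI allI ip_ext_left) (simp_all add: adjD ip_act_left ip_scaleC_left)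

lemma mlin_mult: "mlin X \<Longrightarrow> mlin Y \<Longrightarrow> mlin (X * Y)" by (simp add: mlin_def)

lemma act_linear_left:
  "act (x - y) b = act x b - act y b" "act (x + y) b = act x b + act y b" "act (- x) b = - act x b"
  "act (r *\<^sub>R x) b = r *\<^sub>R act x b"
proof -
  interpret additive "\<lambda>x. act x b" by standard (rule act_add_left)
  show "act (x - y) b = act x b - act y b" "act (- x) b = - act x b" by (rule diff minus)+
  show "act (x + y) b = act x b + act y b" by (rule act_add_left)
  show "act (r *\<^sub>R x) b = r *\<^sub>R act x b" by (metis act_scaleC_left scaleC_of_real)
qed

lemma scaleC_linear: "c *\<^sub>C (x - y) = c *\<^sub>C x - c *\<^sub>C (y::'e)" "c *\<^sub>C (- x) = - (c *\<^sub>C (x::'e))"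
  "c *\<^sub>C (r *\<^sub>R x) = r *\<^sub>R (c *\<^sub>C (x::'e))"
proof -
  interpret additive "\<lambda>x::'e. c *\<^sub>C x" by standard (rule scaleC_add_right)
  show "c *\<^sub>C (x - y) = c *\<^sub>C x - c *\<^sub>C (y::'e)" "c *\<^sub>C (- x) = - (c *\<^sub>C (x::'e))" by (rule diff minus)+
  show "c *\<^sub>C (r *\<^sub>R x) = r *\<^sub>R (c *\<^sub>C (x::'e))"
    by (metis scaleC_of_real scaleC_scaleC mult.commute)
qed

lemma mlin_diff: "mlin X \<Longrightarrow> mlin Y \<Longrightarrow> mlin (X - Y)"
  and mlin_add: "mlin X \<Longrightarrow> mlin Y \<Longrightarrow> mlin (X + Y)"
  and mlin_minus: "mlin X \<Longrightarrow> mlin (- X)"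
  and mlin_scaleR: "mlin X \<Longrightarrow> mlin (r *\<^sub>R X)"
  by (simp_all add: mlin_def act_linear_left scaleC_linear scaleC_add_right)

lemma bounded_linear_act: "bounded_linear (\<lambda>x. act x b)"
  by (rule bounded_linear_intro[OF _ _ norm_act]) (simp_all add: act_linear_left)

lemma bounded_linear_scaleC: "bounded_linear (\<lambda>x::'e. c *\<^sub>C x)"
  by (rule bounded_linear_intro[of _ "cmod c"])
     (simp_all add: scaleC_linear scaleC_add_right norm_scaleC_module mult.commute)

text \<open>Factors that are obtained by extension from a dense range need not be adjointable, but they
  inherit module linearity; this is the notion of boundedness for the unbounded products below.\<close>

lemma mlin_factor:
  assumes R: "dense_range R" "mlin R" and N: "mlin N" and M: "M * R = N"
  shows "mlin M"
  unfolding mlin_def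
proof (intro conjI allI)
  have MR: "M \<cdot> R \<cdot> x = N \<cdot> x" for x using M by (metis app_simps(7))
  have cont: "continuous_on UNIV (\<lambda>x. act x b)" "continuous_on UNIV (\<lambda>x::'e. c *\<^sub>C x)" for b c
    by (intro linear_continuous_on bounded_linear_act bounded_linear_scaleC)+
  show "M \<cdot> act x b = act (M \<cdot> x) b" for x b
    by (rule continuous_eq_on_dense[OF _ _ R(1), of "\<lambda>x. M \<cdot> act x b" "\<lambda>x. act (M \<cdot> x) b"])
       (use R(2) N MR in \<open>auto simp: mlin_def intro!: continuous_on_app cont
          continuous_on_compose2[OF cont(1)] linear_continuous_on[OF bounded_linear_app]\<close>,
        metis MR)
  show "M \<cdot> (c *\<^sub>C x) = c *\<^sub>C (M \<cdot> x)" for c x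
    by (rule continuous_eq_on_dense[OF _ _ R(1), of "\<lambda>x. M \<cdot> (c *\<^sub>C x)" "\<lambda>x. c *\<^sub>C (M \<cdot> x)"])
       (use R(2) N MR in \<open>auto simp: mlin_def intro!: continuous_on_app cont
          continuous_on_compose2[OF cont(2)] linear_continuous_on[OF bounded_linear_app]\<close>,
        metis MR)
qed

definition imag :: "'e endo" where "imag = Endo (\<lambda>x. \<i> *\<^sub>C x)"

lemma app_imag [simp]: "imag \<cdot> x = \<i> *\<^sub>C x"
  by (simp add: imag_def app_Endo bounded_linear_scaleC)

lemma imag_sq: "imag * imag = -1"
proof (rule endo_eqI)
  fix x :: 'e
  have "\<i> *\<^sub>C \<i> *\<^sub>C x = complex_of_real (-1) *\<^sub>C x" by (simp add: scaleC_scaleC)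
  also have "\<dots> = - x" unfolding scaleC_of_real by simp
  finally show "(imag * imag) \<cdot> x = (-1) \<cdot> x" by simp
qed

lemma adj_imag: "adj imag (- imag)"
proof -
  have "cnj \<i> *\<^sub>C b = - (\<i> *\<^sub>C b)" for b :: 'b
  proof -
    have "cnj \<i> *\<^sub>C b + \<i> *\<^sub>C b = complex_of_real 0 *\<^sub>C b"
      by (simp flip: scaleC_add_left)
    then show ?thesis unfolding scaleC_of_real by (simp add: eq_neg_iff_add_eq_0)
  qed
  then show ?thesis by (simp add: adj_def ip_scaleC_left ip_scaleC_right)
qed

lemma imag_commute: "mlin X \<Longrightarrow> X * imag = imag * X"
  by (rule endo_eqI) (simp add: mlin_def)

end

section \<open>The inverse square root series\<close>

text \<open>The coefficients of the binomial series of \<open>(1 - x)\<^sup>-\<^sup>1\<^sup>/\<^sup>2\<close>.\<close>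

definition isq_coeff :: "nat \<Rightarrow> real" where
  "isq_coeff n = (-1) ^ n * ((-1/2) gchoose n)"

definition isq :: "'a::banach endo \<Rightarrow> 'a endo" where
  "isq X = (\<Sum>n. isq_coeff n *\<^sub>R X ^ n)"

lemma isq_coeff_0: "isq_coeff 0 = 1"
  by (simp add: isq_coeff_def)

lemma isq_coeff_Suc: "isq_coeff (Suc n) = isq_coeff n * ((real n + 1/2) / (real n + 1))"
proof -
  have "(real n + 1) * ((-1/2) gchoose Suc n) = (-1/2 - real n) * ((-1/2::real) gchoose n)"
    using gbinomial_mult_1[of "-1/2::real" n] by (simp add: algebra_simps)
  then have "((-1/2::real) gchoose Suc n) = - ((real n + 1/2) / (real n + 1)) * ((-1/2) gchoose n)"
    by (simp add: field_simps)
  then show ?thesis unfolding isq_coeff_def by simp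
qed

lemma isq_coeff_bound: "norm (isq_coeff n) \<le> 1"
proof -
  have "0 \<le> isq_coeff n \<and> isq_coeff n \<le> 1"
  proof (induction n)
    case (Suc n)
    have "isq_coeff n * ((real n + 1/2) / (real n + 1)) \<le> 1 * 1"
      using Suc by (intro mult_mono) auto
    then show ?case using Suc by (simp add: isq_coeff_Suc)
  qed (simp add: isq_coeff_0)
  then show ?thesis by simp
qed

text \<open>The square of the series is the geometric series: Vandermonde's identity at \<open>-1/2 - 1/2 = -1\<close>.\<close>

lemma isq_coeff_convolution: "(\<Sum>i\<le>n. isq_coeff i * isq_coeff (n - i)) = 1"
proof -
  have "(\<Sum>i\<le>n. isq_coeff i * isq_coeff (n - i)) =
      (\<Sum>i\<in>{0..n}. (-1) ^ n * (((-1/2) gchoose i) * ((-1/2) gchoose (n - i))))"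
    unfolding atLeast0AtMost
    by (intro sum.cong refl) (simp add: isq_coeff_def power_add[symmetric] mult_ac flip: power_add)
  also have "\<dots> = (-1) ^ n * ((-1/2 + -1/2 :: real) gchoose n)"
    by (simp only: gbinomial_Vandermonde flip: sum_distrib_left)
  also have "((-1/2 + -1/2 :: real) gchoose n) = (-1) ^ n * ((1 + real n - 1) gchoose n)"
    using gbinomial_minus[of "1::real" n] by simp
  finally show ?thesis by (simp add: binomial_gbinomial[symmetric] flip: power_mult_distrib)
qed

lemma summable_power_series_endo:
  fixes X :: "'a::banach endo"
  assumes "norm X < 1" "\<And>n. norm (c n) \<le> (1::real)"
  shows "summable (\<lambda>n. norm (c n *\<^sub>R X ^ n))"
proof (rule summable_comparison_test')
  show "summable (\<lambda>n. norm X ^ n)" using assms(1) by (intro summable_geometric) simp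
  fix n
  show "norm (norm (c n *\<^sub>R X ^ n)) \<le> norm X ^ n"
    using mult_mono[OF assms(2)[of n] norm_power_endo[of X n]] by simp
qed

lemma isq_summable: "norm (X::'a::banach endo) < 1 \<Longrightarrow> summable (\<lambda>n. norm (isq_coeff n *\<^sub>R X ^ n))"
  by (rule summable_power_series_endo[OF _ isq_coeff_bound])

lemma isq_LIMSEQ: "norm X < 1 \<Longrightarrow> (\<lambda>n. \<Sum>k<n. isq_coeff k *\<^sub>R X ^ k) \<longlonglongrightarrow> isq X"
  unfolding isq_def by (rule summable_LIMSEQ) (rule summable_norm_cancel[OF isq_summable])

lemma power_intertwine:
  fixes X :: "'a::real_normed_vector endo"
  assumes "X * R = R * Y" shows "X ^ n * R = R * Y ^ n"
proof (induction n)
  case (Suc n)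
  have "X ^ Suc n * R = X * (R * Y ^ n)" by (simp add: mult.assoc Suc)
  also have "\<dots> = R * Y * Y ^ n" using assms by (simp add: mult.assoc[symmetric])
  finally show ?case by (simp add: mult.assoc)
qed simp

lemma isq_intertwine:
  assumes "norm X < 1" "norm Y < 1" "X * R = R * Y"
  shows "isq X * R = R * isq Y"
proof (rule LIMSEQ_unique)
  show "(\<lambda>n. (\<Sum>k<n. isq_coeff k *\<^sub>R X ^ k) * R) \<longlonglongrightarrow> isq X * R"
    by (intro tendsto_mult isq_LIMSEQ assms tendsto_const)
  have "(\<lambda>n. R * (\<Sum>k<n. isq_coeff k *\<^sub>R Y ^ k)) \<longlonglongrightarrow> R * isq Y"
    by (intro tendsto_mult isq_LIMSEQ assms tendsto_const)
  then show "(\<lambda>n. (\<Sum>k<n. isq_coeff k *\<^sub>R X ^ k) * R) \<longlonglongrightarrow> R * isq Y"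
    by (simp add: sum_distrib_left sum_distrib_right power_intertwine[OF assms(3)])
qed

lemma isq_sq:
  assumes X: "norm X < 1"
  shows "isq X * isq X * (1 - X) = 1" "(1 - X) * (isq X * isq X) = 1"
proof -
  have geo: "summable (\<lambda>n. norm (X ^ n))"
    using summable_power_series_endo[OF X, of "\<lambda>_. 1"] by simp
  have "isq X * isq X = (\<Sum>n. \<Sum>i\<le>n. (isq_coeff i *\<^sub>R X ^ i) * (isq_coeff (n - i) *\<^sub>R X ^ (n - i)))"
    unfolding isq_def by (rule Cauchy_product[OF isq_summable[OF X] isq_summable[OF X]])
  also have "\<dots> = (\<Sum>n. X ^ n)"
  proof (intro suminf_cong)
    fix n
    have "(\<Sum>i\<le>n. (isq_coeff i *\<^sub>R X ^ i) * (isq_coeff (n - i) *\<^sub>R X ^ (n - i))) =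
        (\<Sum>i\<le>n. (isq_coeff i * isq_coeff (n - i)) *\<^sub>R X ^ n)"
      by (intro sum.cong refl) (simp flip: power_add)
    also have "\<dots> = X ^ n" by (simp flip: scaleR_left.sum add: isq_coeff_convolution)
    finally show "(\<Sum>i\<le>n. (isq_coeff i *\<^sub>R X ^ i) * (isq_coeff (n - i) *\<^sub>R X ^ (n - i))) = X ^ n" .
  qed
  finally have sq: "isq X * isq X = (\<Sum>n. X ^ n)" .
  have s: "summable (\<lambda>n. X ^ n)" using geo by (rule summable_norm_cancel)
  have "(\<Sum>n. X ^ Suc n) = (\<Sum>n. X ^ n) - 1"
    using suminf_split_head[OF s] by simp
  then have l: "X * (\<Sum>n. X ^ n) = (\<Sum>n. X ^ n) - 1" and r: "(\<Sum>n. X ^ n) * X = (\<Sum>n. X ^ n) - 1"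
    using bounded_linear.suminf[OF bounded_linear_mult_right s, of X]
      bounded_linear.suminf[OF bounded_linear_mult_left s, of X]
    by (simp_all add: power_commutes)
  show "isq X * isq X * (1 - X) = 1" "(1 - X) * (isq X * isq X) = 1"
    unfolding sq by (simp_all add: algebra_simps l r)
qed

context hilbert_module
begin

lemma isq_adjointable:
  assumes "norm X < 1" "adj X X'"
  obtains Q' where "adj (isq X) Q'"
proof (rule adj_limit[OF isq_LIMSEQ[OF assms(1)]])
  show "adj (\<Sum>k<n. isq_coeff k *\<^sub>R X ^ k) (\<Sum>k<n. isq_coeff k *\<^sub>R X' ^ k)" for n
    by (intro adj_sum adj_scaleR adj_power assms)
qed (rule that)

lemma isq_selfadj: "norm X < 1 \<Longrightarrow> selfadj X \<Longrightarrow> selfadj (isq X)"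
  by (rule selfadj_limit[OF isq_LIMSEQ]) (simp_all add: adj_sum adj_scaleR adj_power)

text \<open>All terms but the constant one contain the factor \<open>X\<close>; divisibility properties of \<open>X\<close> on the right
  thereby pass to \<open>isq X - 1\<close>.\<close>

lemma isq_tail:
  assumes X: "norm X < 1" and a: "adj X X'"
  obtains L L' where "isq X = 1 + L * X" "adj L L'"
proof -
  define L where "L = (\<Sum>n. isq_coeff (Suc n) *\<^sub>R X ^ n)"
  have s: "summable (\<lambda>n. isq_coeff (Suc n) *\<^sub>R X ^ n)"
    by (rule summable_norm_cancel[OF summable_power_series_endo[OF X isq_coeff_bound]])
  have "L * X = (\<Sum>n. isq_coeff (Suc n) *\<^sub>R X ^ Suc n)"
    unfolding L_def using bounded_linear.suminf[OF bounded_linear_mult_left s, of X]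
    by (simp add: power_commutes)
  also have "\<dots> = isq X - 1"
    using suminf_split_head[OF summable_norm_cancel[OF isq_summable[OF X]]] 
    by (simp add: isq_def isq_coeff_0)
  finally have 1: "isq X = 1 + L * X" by simp
  have "(\<lambda>n. \<Sum>k<n. isq_coeff (Suc k) *\<^sub>R X ^ k) \<longlonglongrightarrow> L"
    unfolding L_def by (rule summable_LIMSEQ[OF s])
  then obtain L' where "adj L L'"
  proof (rule adj_limit)
    show "adj (\<Sum>k<n. isq_coeff (Suc k) *\<^sub>R X ^ k) (\<Sum>k<n. isq_coeff (Suc k) *\<^sub>R X' ^ k)" for n
      by (intro adj_sum adj_scaleR adj_power a)
  qed
  with 1 show thesis by (rule that)
qed

text \<open>Commutators with a power series inherit a factorization \<open>r \<kappa> r\<close>: by the Leibniz rule the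
  commutator with \<open>Y ^ n\<close> is \<open>r \<kappa>\<^sub>n r\<close> with \<open>norm \<kappa>\<^sub>n = O(n \<rho> ^ (n - 1))\<close>.\<close>

lemma isq_commutator:
  assumes comm: "F * Y - Y * F = r * k * r" and p: "Y * r = r * Yp" and m: "r * Y = Ym * r"
    and nY: "norm Y < 1" and np: "norm Yp < 1" and nm: "norm Ym < 1"
    and adjs: "adj k k'" "adj Yp Yp'" "adj Ym Ym'"
  obtains K K' where "F * isq Y - isq Y * F = r * K * r" "adj K K'"
proof -
  define \<rho> where "\<rho> = max (norm Yp) (norm Ym)"
  have \<rho>: "norm Yp \<le> \<rho>" "norm Ym \<le> \<rho>" "\<rho> < 1" "0 \<le> \<rho>"
    using np nm by (auto simp: \<rho>_def le_max_iff_disj)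
  define c where "c = rec_nat (0::'e endo) (\<lambda>n x. Yp * x + k * Ym ^ n)"
  define c' where "c' = rec_nat (0::'e endo) (\<lambda>n x. x * Yp' + Ym' ^ n * k')"
  have c0: "c 0 = 0" and cS: "c (Suc n) = Yp * c n + k * Ym ^ n" for n by (auto simp: c_def)
  have c'0: "c' 0 = 0" and c'S: "c' (Suc n) = c' n * Yp' + Ym' ^ n * k'" for n by (auto simp: c'_def)
  have adjc: "adj (c n) (c' n)" for n
    by (induction n) (auto simp: c0 c'0 cS c'S intro!: adj_intros adjs)
  have comm_n: "F * Y ^ n - Y ^ n * F = r * c n * r" for n
  proof (induction n)
    case (Suc n)
    have "F * Y ^ Suc n - Y ^ Suc n * F = (F * Y - Y * F) * Y ^ n + Y * (F * Y ^ n - Y ^ n * F)"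
      by (simp add: algebra_simps)
    also have "\<dots> = r * k * (r * Y ^ n) + (Y * r) * c n * r"
      by (simp add: comm Suc mult.assoc)
    also have "r * Y ^ n = Ym ^ n * r" using power_intertwine[OF m[symmetric]] by simp
    finally show ?case by (simp add: p cS algebra_simps)
  qed (simp add: c0)
  have bound: "norm (c (Suc n)) \<le> norm k * (real (Suc n) * \<rho> ^ n)" for n
  proof (induction n)
    case 0
    have "norm (k * 1) \<le> norm k * norm (1::'e endo)" by (rule norm_mult_ineq)
    also have "\<dots> \<le> norm k * 1" by (intro mult_left_mono norm_one_endo) simp
    finally show ?case by (simp add: cS c0)
  next
    case (Suc n)
    have "norm (Yp * c (Suc n)) \<le> \<rho> * (norm k * (real (Suc n) * \<rho> ^ n))"
      by (rule order_trans[OF norm_mult_ineq]) (intro mult_mono Suc \<rho> norm_ge_zero)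
    moreover have "norm (k * Ym ^ Suc n) \<le> norm k * \<rho> ^ Suc n"
      by (rule order_trans[OF norm_mult_ineq], intro mult_left_mono norm_ge_zero)
         (rule order_trans[OF norm_power_endo], intro power_mono \<rho> norm_ge_zero)
    ultimately have "norm (c (Suc (Suc n))) \<le> \<rho> * (norm k * (real (Suc n) * \<rho> ^ n)) + norm k * \<rho> ^ Suc n"
      unfolding cS[of "Suc n"] by (meson add_mono norm_triangle_ineq order_trans)
    then show ?case by (simp add: algebra_simps)
  qed
  have "summable (\<lambda>n. norm k * (real (Suc n) * \<rho> ^ n))"
    using geometric_deriv_sums[of \<rho>] \<rho> by (intro summable_mult) (auto simp: sums_iff)
  then have "summable (\<lambda>n. isq_coeff (Suc n) *\<^sub>R c (Suc n))"
  proof (rule summable_comparison_test')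
    fix n
    show "norm (isq_coeff (Suc n) *\<^sub>R c (Suc n)) \<le> norm k * (real (Suc n) * \<rho> ^ n)"
      using mult_mono[OF isq_coeff_bound[of "Suc n"] bound[of n]] by simp
  qed
  then have s: "summable (\<lambda>n. isq_coeff n *\<^sub>R c n)" by (subst (asm) summable_Suc_iff)
  define K where "K = (\<Sum>n. isq_coeff n *\<^sub>R c n)"
  have lim: "(\<lambda>n. \<Sum>j<n. isq_coeff j *\<^sub>R c j) \<longlonglongrightarrow> K"
    unfolding K_def by (rule summable_LIMSEQ[OF s])
  obtain K' where K': "adj K K'"
  proof (rule adj_limit[OF lim])
    show "adj (\<Sum>j<n. isq_coeff j *\<^sub>R c j) (\<Sum>j<n. isq_coeff j *\<^sub>R c' j)" for n
      by (intro adj_sum adj_scaleR adjc)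
  qed
  have part: "F * (\<Sum>j<n. isq_coeff j *\<^sub>R Y ^ j) - (\<Sum>j<n. isq_coeff j *\<^sub>R Y ^ j) * F =
      r * (\<Sum>j<n. isq_coeff j *\<^sub>R c j) * r" for n
    by (simp add: sum_distrib_left sum_distrib_right comm_n scaleR_diff_right[symmetric]
        flip: sum_subtractf)
  have "(\<lambda>n. F * (\<Sum>j<n. isq_coeff j *\<^sub>R Y ^ j) - (\<Sum>j<n. isq_coeff j *\<^sub>R Y ^ j) * F)
      \<longlonglongrightarrow> F * isq Y - isq Y * F"
    by (intro tendsto_diff tendsto_mult tendsto_const isq_LIMSEQ nY)
  then have "(\<lambda>n. r * (\<Sum>j<n. isq_coeff j *\<^sub>R c j) * r) \<longlonglongrightarrow> F * isq Y - isq Y * F"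
    unfolding part .
  moreover have "(\<lambda>n. r * (\<Sum>j<n. isq_coeff j *\<^sub>R c j) * r) \<longlonglongrightarrow> r * K * r"
    by (intro tendsto_mult tendsto_const lim)
  ultimately have "F * isq Y - isq Y * F = r * K * r" by (rule LIMSEQ_unique)
  with K' show thesis using that by blast
qed

end

section \<open>Polynomials of an operator\<close>

definition peval :: "real poly \<Rightarrow> 'a::real_normed_vector endo \<Rightarrow> 'a endo" where
  "peval p X = (\<Sum>i\<le>degree p. coeff p i *\<^sub>R X ^ i)"

lemma peval_altdef: "degree p \<le> n \<Longrightarrow> peval p X = (\<Sum>i\<le>n. coeff p i *\<^sub>R X ^ i)"
  unfolding peval_def by (rule sum.mono_neutral_left) (auto simp: coeff_eq_0)

lemma op_poly_app: "op_poly p (app X) = app (peval p X)"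
proof -
  have "app (\<Sum>i\<in>I. coeff p i *\<^sub>R X ^ i) x = (\<Sum>i\<in>I. coeff p i *\<^sub>R (app X ^^ i) x)" for I x
    by (induction I rule: infinite_finite_induct) (auto simp: app_power)
  then show ?thesis by (auto simp: op_poly_def peval_def)
qed

lemma peval_0 [simp]: "peval 0 X = 0" by (simp add: peval_def)

lemma peval_1 [simp]: "peval 1 X = 1" by (simp add: peval_def)

lemma peval_add: "peval (p + q) X = peval p X + peval q X"
proof -
  let ?n = "max (degree p) (degree q)"
  have "degree (p + q) \<le> ?n" by (rule degree_add_le) auto
  then show ?thesis
    using peval_altdef[of p ?n X] peval_altdef[of q ?n X] peval_altdef[of "p + q" ?n X]
    by (simp add: sum.distrib scaleR_add_left)
qed

lemma peval_smult: "peval (smult c p) X = c *\<^sub>R peval p X"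
  using peval_altdef[of "smult c p" "degree p" X] by (simp add: peval_def scaleR_sum_right degree_smult_le)

lemma peval_diff: "peval (p - q) X = peval p X - peval q X"
  using peval_add[of p "- q" X] peval_smult[of "-1" q X] by simp

lemma peval_pCons: "peval (pCons c p) X = c *\<^sub>R 1 + X * peval p X"
proof -
  have "peval (pCons c p) X = (\<Sum>i\<le>Suc (degree p). coeff (pCons c p) i *\<^sub>R X ^ i)"
    by (rule peval_altdef) (rule degree_pCons_le)
  also have "\<dots> = c *\<^sub>R 1 + (\<Sum>i\<le>degree p. coeff p i *\<^sub>R X ^ Suc i)"
    by (subst sum.atMost_Suc_shift) simp
  finally show ?thesis by (simp add: peval_def sum_distrib_left)
qed

lemma peval_mult: "peval (p * q) X = peval p X * peval q X"
  by (induction p) (auto simp: peval_pCons peval_add peval_smult algebra_simps)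

lemma peval_power: "peval (p ^ n) X = peval p X ^ n"
  by (induction n) (auto simp: peval_mult)

lemma peval_pcompose: "peval (pcompose p q) X = peval p (peval q X)"
  by (induction p) (auto simp: pcompose_pCons peval_add peval_mult peval_pCons)

lemma peval_sum: "peval (sum f I) X = (\<Sum>i\<in>I. peval (f i) X)"
  by (induction I rule: infinite_finite_induct) (auto simp: peval_add)

lemma peval_commute:
  assumes "X * R = R * X" shows "peval p X * R = R * peval p X"
  by (simp add: peval_def sum_distrib_left sum_distrib_right power_intertwine[OF assms])

lemma (in hilbert_module) peval_selfadj: "selfadj X \<Longrightarrow> selfadj (peval p X)"
  unfolding peval_def by (intro adj_sum adj_scaleR adj_power)

section \<open>Chebyshev expansions\<close>

fun cheb :: "nat \<Rightarrow> real poly" where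
  "cheb 0 = 1"
| "cheb (Suc 0) = [:0, 1:]"
| "cheb (Suc (Suc n)) = [:0, 2:] * cheb (Suc n) - cheb n"

lemma cheb_cos: "poly (cheb n) (cos t) = cos (real n * t)"
proof (induction n rule: cheb.induct)
  case (3 n)
  have "cos (real (Suc (Suc n)) * t) + cos (real n * t) = 2 * cos t * cos (real (Suc n) * t)"
    using cos_add[of "real (Suc n) * t" t] cos_diff[of "real (Suc n) * t" t]
    by (simp add: algebra_simps)
  then show ?case using 3 by simp
qed auto

lemma cheb_degree: "degree (cheb n) \<le> n"
proof (induction n rule: cheb.induct)
  case (3 n)
  have "degree ([:0, 2:] * cheb (Suc n)) \<le> Suc (Suc n)"
    using degree_mult_le[of "[:0, 2:]" "cheb (Suc n)"] 3 by (auto split: if_splits)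
  then show ?case using 3 by (auto intro: degree_diff_le)
qed auto

lemma cheb_lead: "coeff (cheb n) n \<noteq> 0"
proof (induction n rule: cheb.induct)
  case (3 n)
  have "coeff (cheb n) (Suc (Suc n)) = 0"
    using cheb_degree[of n] by (intro coeff_eq_0) simp
  then show ?case using 3 by simp
qed auto

lemma cheb_expansion: "degree p \<le> n \<Longrightarrow> \<exists>a. p = (\<Sum>k\<le>n. smult (a k) (cheb k))"
proof (induction n arbitrary: p)
  case 0
  then obtain c where "p = [:c:]" by (auto elim: degree_eq_zeroE)
  then show ?case by (intro exI[of _ "\<lambda>_. c"]) auto
next
  case (Suc n)
  define c where "c = coeff p (Suc n) / coeff (cheb (Suc n)) (Suc n)"
  define q where "q = p - smult c (cheb (Suc n))"
  have q0: "coeff q (Suc n) = 0" using cheb_lead[of "Suc n"] by (simp add: q_def c_def)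
  have "degree q \<le> Suc n"
    unfolding q_def by (intro degree_diff_le Suc.prems order_trans[OF degree_smult_le] cheb_degree)
  have "degree q \<le> n"
  proof (rule degree_le, intro allI impI)
    fix i assume "n < i"
    then show "coeff q i = 0"
      using q0 \<open>degree q \<le> Suc n\<close> by (cases "i = Suc n") (auto intro: coeff_eq_0)
  qed
  then obtain a where a: "q = (\<Sum>k\<le>n. smult (a k) (cheb k))" using Suc.IH by blast
  have "p = (\<Sum>k\<le>Suc n. smult ((a(Suc n := c)) k) (cheb k))"
  proof -
    have "(\<Sum>k\<le>n. smult ((a(Suc n := c)) k) (cheb k)) = q"
      unfolding a by (intro sum.cong) auto
    then show ?thesis by (simp add: q_def)
  qed
  then show ?case by blast
qed

text \<open>The real part of a geometric sum over the \<open>m\<close>-th roots of unity.\<close>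

lemma sum_cos_roots_of_unity:
  assumes "d < m"
  shows "(\<Sum>l<m. cos (real d * (2 * pi * real l / real m))) = (if d = 0 then real m else 0)"
proof (cases "d = 0")
  case False
  define z where "z = cis (2 * pi * real d / real m)"
  have m: "m > 0" using assms by simp
  have "z ^ m = cis (2 * pi * real d)"
    using m by (simp add: z_def Complex.DeMoivre)
  then have zm: "z ^ m = 1" by (simp add: cis_multiple_2pi)
  have z1: "z \<noteq> 1"
  proof
    assume "z = 1"
    then have "cos (2 * pi * real d / real m) = 1" by (simp add: z_def complex_eq_iff)
    then obtain k :: int where "2 * pi * real d / real m = real_of_int k * 2 * pi"
      using cos_one_2pi_int by (metis mult.assoc)
    then have "real d = real_of_int k * real m" using m by (simp add: field_simps)
    then have "int d = k * int m" by (metis of_int_eq_iff of_int_mult of_int_of_nat_eq)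
    moreover have "0 < int d" "int d < int m" using False assms by auto
    ultimately show False
      by (metis dvd_triv_right zdvd_not_zless)
  qed
  have "(\<Sum>l<m. z ^ l) = 0" using z1 zm by (simp add: geometric_sum)
  then have "Re (\<Sum>l<m. z ^ l) = 0" by simp
  moreover have "Re (z ^ l) = cos (real d * (2 * pi * real l / real m))" for l
    by (simp add: z_def Complex.DeMoivre mult_ac)
  ultimately show ?thesis using False by simp
qed simp

text \<open>Averaging \<open>p (cos t) cos (j t)\<close> over \<open>2 n + 1\<close> equidistant angles isolates the coefficient of index \<open>j\<close>,
  since the frequencies \<open>k + j\<close> and \<open>\<bar>k - j\<bar>\<close> stay below \<open>2 n + 1\<close>.\<close>

lemma cheb_coeff_bound:
  assumes p: "p = (\<Sum>k\<le>n. smult (a k) (cheb k))"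
    and M: "\<And>t. \<bar>t\<bar> \<le> 1 \<Longrightarrow> \<bar>poly p t\<bar> \<le> M" and j: "j \<le> n"
  shows "\<bar>a j\<bar> \<le> 2 * M"
proof -
  define m where "m = Suc (2 * n)"
  have m: "real m > 0" by (simp add: m_def)
  define \<theta> where "\<theta> l = 2 * pi * real l / real m" for l
  define S where "S d = (\<Sum>l<m. cos (real d * \<theta> l))" for d
  have S: "S d = (if d = 0 then real m else 0)" if "d < m" for d
    unfolding S_def \<theta>_def by (rule sum_cos_roots_of_unity[OF that])
  define d where "d k = (if k \<le> j then j - k else k - j)" for k
  have orth: "(\<Sum>l<m. cos (real k * \<theta> l) * cos (real j * \<theta> l)) = (S (k + j) + S (d k)) / 2" for k
  proof -
    have "cos (real k * \<theta> l) * cos (real j * \<theta> l) = (cos (real (k + j) * \<theta> l) + cos (real (d k) * \<theta> l)) / 2" for l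
    proof -
      have "cos (real (d k) * \<theta> l) = cos (real k * \<theta> l - real j * \<theta> l)"
      proof (cases "k \<le> j")
        case True
        then have "real (d k) * \<theta> l = - (real k * \<theta> l - real j * \<theta> l)"
          by (simp add: d_def of_nat_diff algebra_simps)
        then show ?thesis by (simp only: cos_minus)
      next
        case False
        then show ?thesis by (simp add: d_def of_nat_diff algebra_simps)
      qed
      then show ?thesis by (simp add: cos_add cos_diff algebra_simps)
    qed
    then show ?thesis unfolding S_def by (simp only: sum.distrib sum_divide_distrib add_divide_distrib)
  qed
  have "(\<Sum>l<m. poly p (cos (\<theta> l)) * cos (real j * \<theta> l)) =
      (\<Sum>l<m. \<Sum>k\<le>n. a k * (cos (real k * \<theta> l) * cos (real j * \<theta> l)))"
    by (simp add: p poly_sum cheb_cos sum_distrib_right mult.assoc)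
  also have "\<dots> = (\<Sum>k\<le>n. a k * (\<Sum>l<m. cos (real k * \<theta> l) * cos (real j * \<theta> l)))"
    by (subst sum.swap) (simp add: sum_distrib_left)
  also have "\<dots> = (\<Sum>k\<le>n. if k = j then a j * (S (j + j) + real m) / 2 else 0)"
  proof (intro sum.cong refl)
    fix k assume k: "k \<in> {..n}"
    then have "k + j < m" "d k < m" "d k = 0 \<longleftrightarrow> k = j" using j by (auto simp: m_def d_def)
    then show "a k * (\<Sum>l<m. cos (real k * \<theta> l) * cos (real j * \<theta> l)) =
      (if k = j then a j * (S (j + j) + real m) / 2 else 0)"
      unfolding orth using S[of "k + j"] S[of "d k"] by auto
  qed
  also have "\<dots> = a j * (S (j + j) + real m) / 2" using j by simp
  finally have eq: "(\<Sum>l<m. poly p (cos (\<theta> l)) * cos (real j * \<theta> l)) = a j * (S (j + j) + real m) / 2" .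
  have "\<bar>\<Sum>l<m. poly p (cos (\<theta> l)) * cos (real j * \<theta> l)\<bar> \<le> (\<Sum>l<m. M)"
  proof (rule order_trans[OF sum_abs], rule sum_mono)
    fix l
    have "\<bar>poly p (cos (\<theta> l))\<bar> * \<bar>cos (real j * \<theta> l)\<bar> \<le> M * 1"
      using M[of "cos (\<theta> l)"] M[of 0] by (intro mult_mono) (auto simp: abs_cos_le_one)
    then show "\<bar>poly p (cos (\<theta> l)) * cos (real j * \<theta> l)\<bar> \<le> M" by (simp add: abs_mult)
  qed
  then have "\<bar>a j\<bar> * (S (j + j) + real m) / 2 \<le> real m * M"
    unfolding eq using S[of "j + j"] j by (auto simp: abs_mult m_def split: if_splits)
  moreover have "S (j + j) \<ge> 0" using S[of "j + j"] j by (auto simp: m_def)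
  then have "\<bar>a j\<bar> * (real m / 2) \<le> \<bar>a j\<bar> * (S (j + j) + real m) / 2" by (simp add: mult_left_mono field_simps)
  ultimately have "real m * \<bar>a j\<bar> \<le> real m * (2 * M)" by (simp add: mult_ac)
  then show ?thesis using m by simp
qed

section \<open>Functional calculus for self-adjoint operators\<close>

context hilbert_module
begin

text \<open>If \<open>w\<^sup>2 + s\<^sup>2 = 1\<close> then \<open>w\<close> is the real part of the unitary \<open>w + i s\<close>, so that \<open>T\<^sub>k(w)\<close>
  is the real part of its \<open>k\<close>-th power.\<close>

lemma cheb_norm:
  assumes w: "selfadj w" and s: "selfadj s" and ws: "w * s = s * w" and sq: "w * w + s * s = 1"
  shows "norm (peval (cheb k) w) \<le> 1"
proof -
  define u where "u = w + imag * s"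
  define v where "v = w - imag * s"
  have iw: "w * imag = imag * w" and si: "s * imag = imag * s"
    using adj_mlin w s imag_commute by blast+
  have iss: "imag * s * (imag * s) = - (s * s)"
  proof -
    have "imag * s * (imag * s) = imag * (s * imag) * s" by (simp only: mult.assoc)
    also have "\<dots> = (imag * imag) * (s * s)" by (simp only: si mult.assoc)
    finally show ?thesis by (simp add: imag_sq)
  qed
  have wis: "w * (imag * s) = imag * s * w"
  proof -
    have "w * (imag * s) = (w * imag) * s" by (simp only: mult.assoc)
    also have "\<dots> = imag * (w * s)" by (simp only: iw mult.assoc)
    finally show ?thesis by (simp only: ws mult.assoc)
  qed
  have vu: "v * u = 1" and uv: "u * v = 1"
    unfolding u_def v_def using sq by (simp_all add: algebra_simps iss[unfolded mult.assoc] wis[unfolded mult.assoc])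
  have "adj (imag * s) (s * (- imag))" by (intro adj_intros s adj_imag)
  then have "adj (imag * s) (- (imag * s))" by (simp add: si)
  then have uv': "adj u v" unfolding u_def v_def using adj_add[OF w] by fastforce
  have "norm (u ^ k \<cdot> x) = norm x" for x
    by (induction k) (auto simp: isometryD[OF uv' vu])
  then have nu: "norm (u ^ k) \<le> 1" by (intro norm_endo_bound) auto
  have "norm (v ^ k \<cdot> x) = norm x" for x
    by (induction k) (auto simp: isometryD[OF adj_sym[OF uv'] uv])
  then have nv: "norm (v ^ k) \<le> 1" by (intro norm_endo_bound) auto
  have w2: "2 *\<^sub>R w = u + v" by (simp add: u_def v_def scaleR_2)
  have "2 *\<^sub>R peval (cheb k) w = u ^ k + v ^ k"
  proof (induction k rule: cheb.induct)
    case (3 n)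
    have "2 *\<^sub>R peval (cheb (Suc (Suc n))) w = (2 *\<^sub>R w) * (2 *\<^sub>R peval (cheb (Suc n)) w) - 2 *\<^sub>R peval (cheb n) w"
      by (simp add: peval_diff peval_mult peval_pCons peval_smult scaleR_diff_right)
    also have "\<dots> = (u + v) * (u ^ Suc n + v ^ Suc n) - (u ^ n + v ^ n)"
      by (simp only: 3 w2)
    also have "\<dots> = u ^ Suc (Suc n) + v ^ Suc (Suc n) + ((u * v) * v ^ n + (v * u) * u ^ n - (u ^ n + v ^ n))"
      by (simp add: algebra_simps)
    finally show ?case by (simp add: uv vu)
  qed (use w2 in \<open>simp_all add: peval_pCons scaleR_2\<close>)
  then have "2 * norm (peval (cheb k) w) = norm (u ^ k + v ^ k)" by (metis norm_scaleR abs_numeral)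
  also have "\<dots> \<le> 2" using norm_triangle_ineq[of "u ^ k" "v ^ k"] nu nv by simp
  finally show ?thesis by simp
qed

text \<open>The series gives \<open>(1 - w\<^sup>2)\<^sup>1\<^sup>/\<^sup>2 = (1 - w\<^sup>2) (1 - w\<^sup>2)\<^sup>-\<^sup>1\<^sup>/\<^sup>2\<close>.\<close>

lemma complement_root:
  assumes w: "selfadj w" and n: "norm (w * w) < 1"
  obtains s where "selfadj s" "w * s = s * w" "w * w + s * s = 1"
proof -
  define X where "X = w * w"
  define s where "s = (1 - X) * isq X"
  have X: "selfadj X" and nX: "norm X < 1" using adj_mult[OF w w] n by (auto simp: X_def)
  have qX: "isq X * X = X * isq X" by (rule isq_intertwine[OF nX nX]) simp
  have qw: "isq X * w = w * isq X" by (rule isq_intertwine[OF nX nX]) (simp add: X_def mult.assoc)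
  have "adj s (isq X * (1 - X))" unfolding s_def by (intro adj_intros isq_selfadj X nX)
  then have 1: "selfadj s" by (simp add: s_def algebra_simps qX)
  have wX: "w * (1 - X) = (1 - X) * w" by (simp add: X_def algebra_simps)
  have "w * s = (w * (1 - X)) * isq X" by (simp only: s_def mult.assoc)
  also have "\<dots> = (1 - X) * (isq X * w)" by (simp only: wX mult.assoc qw)
  finally have 2: "w * s = s * w" by (simp only: s_def mult.assoc)
  have c: "(1 - X) * isq X = isq X * (1 - X)" by (simp add: algebra_simps qX)
  have "s * s = (1 - X) * (isq X * ((1 - X) * isq X))" by (simp only: s_def mult.assoc)
  also have "\<dots> = (1 - X) * (isq X * isq X * (1 - X))" unfolding c by (simp only: mult.assoc)
  finally have "s * s = 1 - X" by (simp add: isq_sq[OF nX])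
  then have "w * w + s * s = 1" by (simp add: X_def)
  with 1 2 show thesis by (rule that)
qed

text \<open>The C*-identity with its exact constant: scaled to \<open>norm (w\<^sup>2) < 1\<close>, a self-adjoint \<open>w\<close> is the real
  part of a unitary.\<close>

lemma selfadj_norm_sq: "selfadj S \<Longrightarrow> (norm S)\<^sup>2 \<le> norm (S * S)"
proof -
  assume S: "selfadj S"
  have "norm S \<le> sqrt (norm (S * S)) + e" if e: "e > 0" for e
  proof -
    define c where "c = sqrt (norm (S * S)) + e"
    have c: "c > 0" using e by (simp add: c_def add_nonneg_pos)
    have c2: "norm (S * S) < c\<^sup>2"
    proof -
      have "(sqrt (norm (S * S)))\<^sup>2 < c\<^sup>2" using e by (intro power_strict_mono) (auto simp: c_def)
      then show ?thesis by simp
    qed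
    define w where "w = (1 / c) *\<^sub>R S"
    have w: "selfadj w" unfolding w_def by (intro adj_scaleR S)
    have "norm (w * w) < 1" using c c2 by (simp add: w_def power2_eq_square field_simps)
    then obtain s where "selfadj s" "w * s = s * w" "w * w + s * s = 1" by (rule complement_root[OF w])
    then have "norm (peval (cheb 1) w) \<le> 1" by (intro cheb_norm w)
    then have "norm w \<le> 1" by (simp add: peval_pCons)
    then have "norm S \<le> c" using c by (simp add: w_def field_simps)
    then show ?thesis by (simp only: c_def)
  qed
  then have "norm S \<le> sqrt (norm (S * S))" by (rule field_le_epsilon)
  then show ?thesis by (metis norm_ge_zero power_mono real_sqrt_pow2)
qed

lemma selfadj_norm_power: "selfadj S \<Longrightarrow> norm S ^ (2 ^ n) \<le> norm (S ^ (2 ^ n))"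
proof (induction n)
  case (Suc n)
  have "norm S ^ (2 ^ Suc n) = (norm S ^ (2 ^ n))\<^sup>2" by (simp flip: power_mult add: mult.commute)
  also have "\<dots> \<le> (norm (S ^ (2 ^ n)))\<^sup>2" using Suc by (intro power_mono) auto
  also have "\<dots> \<le> norm (S ^ (2 ^ n) * S ^ (2 ^ n))" using Suc by (intro selfadj_norm_sq adj_power)
  finally show ?case by (simp flip: power_add add: mult_2)
qed simp

text \<open>Chebyshev expansions bound \<open>norm (q(w))\<close> by the supremum of \<open>q\<close> times a factor linear in the
  degree. Applied to \<open>q = p ^ 2 ^ n\<close> this factor disappears in the limit.\<close>

lemma peval_bound_symmetric:
  assumes w: "selfadj w" and s: "selfadj s" and ws: "w * s = s * w" and sq: "w * w + s * s = 1"
    and M: "\<And>t. \<bar>t\<bar> \<le> 1 \<Longrightarrow> \<bar>poly p t\<bar> \<le> M"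
  shows "norm (peval p w) \<le> M"
proof (rule ccontr)
  assume "\<not> norm (peval p w) \<le> M"
  then have less: "M < norm (peval p w)" by simp
  have M0: "M \<ge> 0" using M[of 0] by simp
  define S where "S = peval p w"
  define d where "d = degree p"
  have crude: "norm (peval q w) \<le> 2 * B * real (Suc n)"
    if q: "degree q \<le> n" and B: "\<And>t. \<bar>t\<bar> \<le> 1 \<Longrightarrow> \<bar>poly q t\<bar> \<le> B" for q n B
  proof -
    obtain a where a: "q = (\<Sum>k\<le>n. smult (a k) (cheb k))" using cheb_expansion[OF q] by blast
    have "norm (peval q w) \<le> (\<Sum>k\<le>n. norm (a k *\<^sub>R peval (cheb k) w))"
      by (subst a) (simp add: peval_sum peval_smult norm_sum del: norm_scaleR)
    also have "\<dots> \<le> (\<Sum>k\<le>n. 2 * B)"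
    proof (rule sum_mono)
      fix k assume "k \<in> {..n}"
      then have "\<bar>a k\<bar> \<le> 2 * B" using cheb_coeff_bound[OF a] B by simp
      then have "\<bar>a k\<bar> * norm (peval (cheb k) w) \<le> (2 * B) * 1"
        using cheb_norm[OF w s ws sq] by (intro mult_mono) auto
      then show "norm (a k *\<^sub>R peval (cheb k) w) \<le> 2 * B" by simp
    qed
    finally show ?thesis by (simp add: mult.commute)
  qed
  have S0: "norm S > 0" using less M0 unfolding S_def by linarith
  define x where "x = M / norm S"
  have x: "norm x < 1" "x \<ge> 0" using less M0 S0 by (auto simp: x_def S_def)
  have key: "1 \<le> 2 * real d * (real (2 ^ n) * x ^ (2 ^ n)) + 2 * x ^ (2 ^ n)" for n
  proof -
    have "norm S ^ (2 ^ n) \<le> norm (peval (p ^ (2 ^ n)) w)"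
      unfolding peval_power S_def by (rule selfadj_norm_power[OF peval_selfadj[OF w]])
    also have "\<dots> \<le> 2 * (M ^ (2 ^ n)) * real (Suc (2 ^ n * d))"
    proof (rule crude)
      show "degree (p ^ (2 ^ n)) \<le> 2 ^ n * d"
        using degree_power_le[of p "2 ^ n"] by (simp add: d_def mult.commute)
      show "\<bar>poly (p ^ (2 ^ n)) t\<bar> \<le> M ^ (2 ^ n)" if "\<bar>t\<bar> \<le> 1" for t
        using power_mono[OF M[OF that]] by (simp add: poly_power power_abs)
    qed
    finally have "norm S ^ (2 ^ n) \<le> (2 * real (Suc (2 ^ n * d))) * M ^ (2 ^ n)" by (simp add: algebra_simps)
    then have "1 \<le> (2 * real (Suc (2 ^ n * d))) * x ^ (2 ^ n)"
      using S0 by (simp add: x_def power_divide divide_simps)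
    then show ?thesis by (simp add: algebra_simps)
  qed
  have sub: "filterlim (\<lambda>n::nat. 2 ^ n :: nat) sequentially sequentially"
    by (rule filterlim_subseq) (simp add: strict_mono_def)
  have 1: "(\<lambda>n. real (2 ^ n) * x ^ (2 ^ n)) \<longlonglongrightarrow> 0"
    using filterlim_compose[OF powser_times_n_limit_0[OF x(1)] sub] by simp
  have 2: "(\<lambda>n. x ^ (2 ^ n)) \<longlonglongrightarrow> 0"
    using filterlim_compose[OF LIMSEQ_power_zero[OF x(1)] sub] by simp
  have "(\<lambda>n. 2 * real d * (real (2 ^ n) * x ^ (2 ^ n)) + 2 * x ^ (2 ^ n)) \<longlonglongrightarrow> 2 * real d * 0 + 2 * 0"
    by (intro tendsto_add tendsto_mult tendsto_const 1 2)
  then have "(1::real) \<le> 2 * real d * 0 + 2 * 0"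
    using key by (intro LIMSEQ_le_const) auto
  then show False by simp
qed

lemma peval_bound_selfadj:
  assumes S: "selfadj S" and c: "c > 0" "norm (S * S) < c\<^sup>2"
    and M: "\<And>t. \<bar>t\<bar> \<le> c \<Longrightarrow> \<bar>poly p t\<bar> \<le> M"
  shows "norm (peval p S) \<le> M"
proof -
  define w where "w = (1 / c) *\<^sub>R S"
  have w: "selfadj w" unfolding w_def by (intro adj_scaleR S)
  have "norm (w * w) < 1" using c by (simp add: w_def power2_eq_square field_simps)
  then obtain s where s: "selfadj s" "w * s = s * w" "w * w + s * s = 1" by (rule complement_root[OF w])
  have "peval p S = peval (pcompose p [:0, c:]) w"
    using c by (simp add: peval_pcompose peval_pCons w_def)
  also have "norm \<dots> \<le> M"
  proof (rule peval_bound_symmetric[OF w s])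
    fix t :: real assume "\<bar>t\<bar> \<le> 1"
    then have "\<bar>c * t\<bar> \<le> c" using c by (simp add: abs_mult mult_left_le)
    then show "\<bar>poly (pcompose p [:0, c:]) t\<bar> \<le> M" using M by (simp add: poly_pcompose mult.commute)
  qed
  finally show ?thesis .
qed

text \<open>The predicate says that the spectrum of the self-adjoint \<open>A\<close> lies in \<open>[0, c]\<close>, in the form of the
  estimate that makes the polynomial calculus on \<open>[0, c]\<close> continuous.\<close>

definition spec_in :: "real \<Rightarrow> 'e endo \<Rightarrow> bool" where
  "spec_in c A \<longleftrightarrow> selfadj A \<and> 0 \<le> c \<and>
     (\<forall>p M. (\<forall>t\<in>{0..c}. \<bar>poly p t\<bar> \<le> M) \<longrightarrow> norm (peval p A) \<le> M)"

text \<open>\<open>p (S\<^sup>2)\<close> is the value at \<open>S\<close> of the even polynomial \<open>p (t\<^sup>2)\<close>, which is bounded on \<open>[- c, c]\<close> for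
  every \<open>c\<^sup>2 > norm (S\<^sup>2)\<close>; continuity of \<open>p\<close> then closes the gap.\<close>

lemma spec_in_square:
  assumes S: "selfadj S"
  shows "spec_in (norm (S * S)) (S * S)"
  unfolding spec_in_def
proof (intro conjI allI impI)
  show "selfadj (S * S)" by (intro adj_mult S)
  fix p M assume M: "\<forall>t\<in>{0..norm (S * S)}. \<bar>poly p t\<bar> \<le> M"
  define A where "A = norm (S * S)"
  have A0: "A \<ge> 0" by (simp add: A_def)
  show "norm (peval p (S * S)) \<le> M"
  proof (rule field_le_epsilon)
    fix e :: real assume e: "e > 0"
    have "isCont (poly p) A" by simp
    then obtain d where d: "d > 0" "\<And>t. \<bar>t - A\<bar> < d \<Longrightarrow> \<bar>poly p t - poly p A\<bar> < e"
      using e unfolding continuous_at_eps_delta dist_real_def by blast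
    define c where "c = sqrt (A + d / 2)"
    have c: "c > 0" "c\<^sup>2 = A + d / 2" using A0 d(1) by (auto simp: c_def)
    have bd: "\<bar>poly p t\<bar> \<le> M + e" if "0 \<le> t" "t \<le> A + d / 2" for t
    proof (cases "t \<le> A")
      case True
      then have "\<bar>poly p t\<bar> \<le> M" using M that by (simp add: A_def)
      then show ?thesis using e by simp
    next
      case False
      then have "\<bar>poly p t - poly p A\<bar> < e" using that d(1) by (intro d(2)) auto
      moreover have "\<bar>poly p A\<bar> \<le> M" using M A0 unfolding A_def[symmetric] by auto
      ultimately show ?thesis by linarith
    qed
    have "norm (peval (pcompose p [:0, 0, 1:]) S) \<le> M + e"
    proof (rule peval_bound_selfadj[OF S c(1)])
      show "norm (S * S) < c\<^sup>2" using c d(1) by (simp add: A_def)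
      fix t :: real assume "\<bar>t\<bar> \<le> c"
      then have "t\<^sup>2 \<le> A + d / 2" using c by (simp flip: c(2) add: power2_le_iff_abs_le)
      then show "\<bar>poly (pcompose p [:0, 0, 1:]) t\<bar> \<le> M + e"
        using bd[of "t\<^sup>2"] by (simp add: poly_pcompose power2_eq_square)
    qed
    then show "norm (peval p (S * S)) \<le> M + e"
      by (simp add: peval_pcompose peval_pCons)
  qed
qed simp

end

lemma weierstrass_poly:
  fixes f :: "real \<Rightarrow> real"
  assumes "continuous_on {0..c} f"
  obtains p where "uniform_limit {0..c} (\<lambda>n. poly (p n)) f sequentially"
proof -
  obtain g where g: "uniform_limit {0..c} g f sequentially" and poly: "\<And>n. polynomial_function (g n)"
    using Stone_Weierstrass_uniform_limit[OF compact_Icc assms] by blast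
  have "\<exists>p. g n = poly p" for n
  proof -
    obtain a m where "g n = (\<lambda>x. \<Sum>i\<le>m. a i * x ^ i)"
      using poly[of n] by (auto simp: real_polynomial_function_eq[symmetric] real_polynomial_function_iff_sum)
    then have "g n = poly (\<Sum>i\<le>m. monom (a i) i)" by (simp add: fun_eq_iff poly_sum poly_monom)
    then show ?thesis by blast
  qed
  then obtain p where "\<And>n. g n = poly (p n)" by metis
  then have "g = (\<lambda>n. poly (p n))" by blast
  then show thesis using g that by blast
qed

lemma uniform_limit_sequentiallyE:
  assumes "uniform_limit S p f sequentially" "0 < e"
  obtains N where "\<And>n t. n \<ge> N \<Longrightarrow> t \<in> S \<Longrightarrow> dist (p n t) (f t) < e"
  using uniform_limitD[OF assms] unfolding eventually_sequentially by blast

text \<open>The bound \<open>c\<close> of the spectrum is a parameter that may exceed \<open>norm A\<close>: the spectrum of a resolvent is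
  first located in \<open>[0, 1]\<close>, and only its square root shows that it lies in \<open>[0, norm A]\<close>.\<close>

definition fcal :: "real \<Rightarrow> (real \<Rightarrow> real) \<Rightarrow> 'a::real_normed_vector endo \<Rightarrow> 'a endo" where
  "fcal c f A = (THE S. \<forall>p. uniform_limit {0..c} (\<lambda>n. poly (p n)) f sequentially \<longrightarrow>
     (\<lambda>n. peval (p n) A) \<longlonglongrightarrow> S)"

context hilbert_module
begin

lemma spec_inD: "spec_in c A \<Longrightarrow> (\<And>t. 0 \<le> t \<Longrightarrow> t \<le> c \<Longrightarrow> \<bar>poly p t\<bar> \<le> M) \<Longrightarrow> norm (peval p A) \<le> M"
  by (auto simp: spec_in_def)

lemma fcal_convergent:
  assumes A: "spec_in c A" and p: "uniform_limit {0..c} (\<lambda>n. poly (p n)) f sequentially"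
  shows "convergent (\<lambda>n. peval (p n) A)"
proof (rule Cauchy_convergent, rule metric_CauchyI)
  fix e :: real assume e: "e > 0"
  then have "e / 4 > 0" by simp
  with p obtain N where N: "\<And>n t. n \<ge> N \<Longrightarrow> t \<in> {0..c} \<Longrightarrow> dist (poly (p n) t) (f t) < e / 4"
    by (rule uniform_limit_sequentiallyE) blast
  have "dist (peval (p m) A) (peval (p n) A) < e" if "m \<ge> N" "n \<ge> N" for m n
  proof -
    have "norm (peval (p m - p n) A) \<le> e / 2"
    proof (rule spec_inD[OF A])
      fix t assume "0 \<le> t" "t \<le> c"
      then show "\<bar>poly (p m - p n) t\<bar> \<le> e / 2"
        using dist_triangle_half_l[of "poly (p m) t" "f t" "e / 2" "poly (p n) t"]
            N[OF that(1), of t] N[OF that(2), of t] by (simp add: dist_real_def)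
    qed
    then show ?thesis using e by (simp add: peval_diff dist_norm)
  qed
  then show "\<exists>M. \<forall>m\<ge>M. \<forall>n\<ge>M. dist (peval (p m) A) (peval (p n) A) < e" by blast
qed

lemma fcal_same_limit:
  assumes A: "spec_in c A"
    and p: "uniform_limit {0..c} (\<lambda>n. poly (p n)) f sequentially"
    and q: "uniform_limit {0..c} (\<lambda>n. poly (q n)) f sequentially"
    and S: "(\<lambda>n. peval (p n) A) \<longlonglongrightarrow> S"
  shows "(\<lambda>n. peval (q n) A) \<longlonglongrightarrow> S"
proof -
  have "(\<lambda>n. peval (q n) A - peval (p n) A) \<longlonglongrightarrow> 0"
  proof (rule LIMSEQ_I)
    fix e :: real assume e: "e > 0"
    then have e4: "e / 4 > 0" by simp
    with p obtain N where N: "\<And>n t. n \<ge> N \<Longrightarrow> t \<in> {0..c} \<Longrightarrow> dist (poly (p n) t) (f t) < e / 4"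
      by (rule uniform_limit_sequentiallyE) blast
    obtain N' where N': "\<And>n t. n \<ge> N' \<Longrightarrow> t \<in> {0..c} \<Longrightarrow> dist (poly (q n) t) (f t) < e / 4"
      using q e4 by (rule uniform_limit_sequentiallyE) blast
    have "norm (peval (q n) A - peval (p n) A - 0) < e" if "n \<ge> max N N'" for n
    proof -
      have "norm (peval (q n - p n) A) \<le> e / 2"
      proof (rule spec_inD[OF A])
        fix t assume "0 \<le> t" "t \<le> c"
        then show "\<bar>poly (q n - p n) t\<bar> \<le> e / 2"
          using dist_triangle_half_l[of "poly (q n) t" "f t" "e / 2" "poly (p n) t"]
            N[of n t] N'[of n t] that by (simp add: dist_real_def)
      qed
      then show ?thesis using e by (simp add: peval_diff)
    qed
    then show "\<exists>no. \<forall>n\<ge>no. norm (peval (q n) A - peval (p n) A - 0) < e" by blast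
  qed
  from tendsto_add[OF this S] show ?thesis by simp
qed

lemma fcal_lim:
  assumes A: "spec_in c A" and f: "continuous_on {0..c} f"
    and p: "uniform_limit {0..c} (\<lambda>n. poly (p n)) f sequentially"
  shows "(\<lambda>n. peval (p n) A) \<longlonglongrightarrow> fcal c f A"
proof -
  obtain S where S: "(\<lambda>n. peval (p n) A) \<longlonglongrightarrow> S"
    using fcal_convergent[OF A p] by (auto simp: convergent_def)
  have all: "\<forall>q. uniform_limit {0..c} (\<lambda>n. poly (q n)) f sequentially \<longrightarrow> (\<lambda>n. peval (q n) A) \<longlonglongrightarrow> S"
    using fcal_same_limit[OF A p _ S] by blast
  have "fcal c f A = S"
    unfolding fcal_def
  proof (rule the_equality, rule all)
    fix S' assume "\<forall>q. uniform_limit {0..c} (\<lambda>n. poly (q n)) f sequentially \<longrightarrow> (\<lambda>n. peval (q n) A) \<longlonglongrightarrow> S'"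
    then have "(\<lambda>n. peval (p n) A) \<longlonglongrightarrow> S'" using p by blast
    then show "S' = S" using S by (rule LIMSEQ_unique)
  qed
  with S show ?thesis by simp
qed

lemma fcal_approx:
  assumes A: "spec_in c A" and f: "continuous_on {0..c} f"
  obtains p where "uniform_limit {0..c} (\<lambda>n. poly (p n)) f sequentially" "(\<lambda>n. peval (p n) A) \<longlonglongrightarrow> fcal c f A"
  using weierstrass_poly[OF f] fcal_lim[OF A f] by blast

lemma fcal_eqI:
  assumes A: "spec_in c A" and f: "continuous_on {0..c} f"
    and p: "uniform_limit {0..c} (\<lambda>n. poly (p n)) f sequentially" and "(\<lambda>n. peval (p n) A) \<longlonglongrightarrow> S"
  shows "fcal c f A = S"
  using fcal_lim[OF A f p] assms(4) by (rule LIMSEQ_unique)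

lemma fcal_poly:
  assumes A: "spec_in c A" and f: "\<And>t. 0 \<le> t \<Longrightarrow> t \<le> c \<Longrightarrow> f t = poly p t"
  shows "fcal c f A = peval p A"
proof (rule fcal_eqI[OF A, where p = "\<lambda>_. p"])
  show "uniform_limit {0..c} (\<lambda>n. poly p) f sequentially"
    by (rule uniform_limitI) (use f in auto)
  show "continuous_on {0..c} f"
    by (rule continuous_on_eq[of _ "poly p"]) (use f in \<open>auto intro: continuous_intros\<close>)
qed auto

lemma fcal_cong:
  assumes A: "spec_in c A" and f: "continuous_on {0..c} f" and eq: "\<And>t. 0 \<le> t \<Longrightarrow> t \<le> c \<Longrightarrow> f t = g t"
  shows "fcal c g A = fcal c f A"
proof -
  obtain p where p: "uniform_limit {0..c} (\<lambda>n. poly (p n)) f sequentially" "(\<lambda>n. peval (p n) A) \<longlonglongrightarrow> fcal c f A"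
    using fcal_approx[OF A f] .
  show ?thesis
  proof (rule fcal_eqI[OF A _ _ p(2)])
    show "continuous_on {0..c} g" by (rule continuous_on_eq[OF f]) (use eq in auto)
    show "uniform_limit {0..c} (\<lambda>n. poly (p n)) g sequentially"
      using p(1) eq by (subst uniform_limit_cong'[where g = "\<lambda>n. poly (p n)" and i = f]) auto
  qed
qed

lemma fcal_diff:
  assumes A: "spec_in c A" and f: "continuous_on {0..c} f" and g: "continuous_on {0..c} g"
  shows "fcal c (\<lambda>t. f t - g t) A = fcal c f A - fcal c g A"
proof -
  obtain p where p: "uniform_limit {0..c} (\<lambda>n. poly (p n)) f sequentially" "(\<lambda>n. peval (p n) A) \<longlonglongrightarrow> fcal c f A"
    using fcal_approx[OF A f] .
  obtain q where q: "uniform_limit {0..c} (\<lambda>n. poly (q n)) g sequentially" "(\<lambda>n. peval (q n) A) \<longlonglongrightarrow> fcal c g A"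
    using fcal_approx[OF A g] .
  have "uniform_limit {0..c} (\<lambda>n t. poly (p n) t - poly (q n) t) (\<lambda>t. f t - g t) sequentially"
    by (rule uniform_limit_minus[OF p(1) q(1)])
  moreover have "(\<lambda>n t. poly (p n) t - poly (q n) t) = (\<lambda>n. poly (p n - q n))" by (simp add: fun_eq_iff)
  ultimately have "uniform_limit {0..c} (\<lambda>n. poly (p n - q n)) (\<lambda>t. f t - g t) sequentially" by simp
  moreover have "(\<lambda>n. peval (p n - q n) A) \<longlonglongrightarrow> fcal c f A - fcal c g A"
    unfolding peval_diff by (intro tendsto_diff p q)
  ultimately show ?thesis by (intro fcal_eqI[OF A] continuous_on_diff f g)
qed

lemma fcal_mult:
  assumes A: "spec_in c A" and f: "continuous_on {0..c} f" and g: "continuous_on {0..c} g"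
  shows "fcal c (\<lambda>t. f t * g t) A = fcal c f A * fcal c g A"
proof -
  obtain p where p: "uniform_limit {0..c} (\<lambda>n. poly (p n)) f sequentially" "(\<lambda>n. peval (p n) A) \<longlonglongrightarrow> fcal c f A"
    using fcal_approx[OF A f] .
  obtain q where q: "uniform_limit {0..c} (\<lambda>n. poly (q n)) g sequentially" "(\<lambda>n. peval (q n) A) \<longlonglongrightarrow> fcal c g A"
    using fcal_approx[OF A g] .
  have bd: "bounded (f ` {0..c})" "bounded (g ` {0..c})"
    using f g compact_continuous_image compact_imp_bounded by blast+
  have "uniform_limit {0..c} (\<lambda>n t. poly (p n) t * poly (q n) t) (\<lambda>t. f t * g t) sequentially"
    by (rule uniform_lim_mult[OF p(1) q(1) bd])
  moreover have "(\<lambda>n t. poly (p n) t * poly (q n) t) = (\<lambda>n. poly (p n * q n))" by (simp add: fun_eq_iff)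
  ultimately have "uniform_limit {0..c} (\<lambda>n. poly (p n * q n)) (\<lambda>t. f t * g t) sequentially" by simp
  moreover have "(\<lambda>n. peval (p n * q n) A) \<longlonglongrightarrow> fcal c f A * fcal c g A"
    unfolding peval_mult by (intro tendsto_mult p q)
  ultimately show ?thesis by (intro fcal_eqI[OF A] continuous_on_mult f g)
qed

lemma fcal_norm:
  assumes A: "spec_in c A" and f: "continuous_on {0..c} f" and M: "\<And>t. 0 \<le> t \<Longrightarrow> t \<le> c \<Longrightarrow> \<bar>f t\<bar> \<le> M"
  shows "norm (fcal c f A) \<le> M"
proof (rule field_le_epsilon)
  fix e :: real assume e: "e > 0"
  obtain p where p: "uniform_limit {0..c} (\<lambda>n. poly (p n)) f sequentially" "(\<lambda>n. peval (p n) A) \<longlonglongrightarrow> fcal c f A"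
    using fcal_approx[OF A f] .
  obtain N where N: "\<And>n t. n \<ge> N \<Longrightarrow> t \<in> {0..c} \<Longrightarrow> dist (poly (p n) t) (f t) < e"
    using p(1) e by (rule uniform_limit_sequentiallyE) blast
  have "norm (peval (p n) A) \<le> M + e" if "n \<ge> N" for n
  proof (rule spec_inD[OF A])
    fix t assume "0 \<le> t" "t \<le> c"
    then show "\<bar>poly (p n) t\<bar> \<le> M + e"
      using N[OF that, of t] M[of t] by (auto simp: dist_real_def)
  qed
  then show "norm (fcal c f A) \<le> M + e"
    by (intro Lim_bounded[OF tendsto_norm[OF p(2)]]) auto
qed

lemma fcal_selfadj:
  assumes A: "spec_in c A" and f: "continuous_on {0..c} f"
  shows "selfadj (fcal c f A)"
proof -
  obtain p where p: "uniform_limit {0..c} (\<lambda>n. poly (p n)) f sequentially" "(\<lambda>n. peval (p n) A) \<longlonglongrightarrow> fcal c f A"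
    using fcal_approx[OF A f] .
  show ?thesis
    by (rule selfadj_limit[OF p(2)]) (use A in \<open>auto simp: spec_in_def intro: peval_selfadj\<close>)
qed

lemma fcal_commute:
  assumes A: "spec_in c A" and f: "continuous_on {0..c} f" and R: "A * R = R * A"
  shows "fcal c f A * R = R * fcal c f A"
proof -
  obtain p where p: "uniform_limit {0..c} (\<lambda>n. poly (p n)) f sequentially" "(\<lambda>n. peval (p n) A) \<longlonglongrightarrow> fcal c f A"
    using fcal_approx[OF A f] .
  have "(\<lambda>n. R * peval (p n) A) \<longlonglongrightarrow> R * fcal c f A" by (intro tendsto_mult tendsto_const p)
  then have "(\<lambda>n. peval (p n) A * R) \<longlonglongrightarrow> R * fcal c f A" by (simp only: peval_commute[OF R])
  moreover have "(\<lambda>n. peval (p n) A * R) \<longlonglongrightarrow> fcal c f A * R" by (intro tendsto_mult tendsto_const p)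
  ultimately show ?thesis using LIMSEQ_unique by blast
qed

text \<open>\<open>f (A)\<close> is the square of the self-adjoint operator obtained from the square root of \<open>f\<close>.\<close>

lemma fcal_spec_in:
  assumes A: "spec_in c A" and f: "continuous_on {0..c} f" and pos: "\<And>t. 0 \<le> t \<Longrightarrow> t \<le> c \<Longrightarrow> 0 \<le> f t"
  shows "spec_in (norm (fcal c f A)) (fcal c f A)"
proof -
  have g: "continuous_on {0..c} (\<lambda>t. sqrt (f t))" by (intro continuous_intros f)
  have "fcal c f A = fcal c (\<lambda>t. sqrt (f t) * sqrt (f t)) A"
    by (rule fcal_cong[OF A]) (use pos in \<open>auto intro!: continuous_intros f\<close>)
  also have "\<dots> = fcal c (\<lambda>t. sqrt (f t)) A * fcal c (\<lambda>t. sqrt (f t)) A"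
    by (rule fcal_mult[OF A g g])
  finally show ?thesis using spec_in_square[OF fcal_selfadj[OF A g]] by simp
qed

section \<open>Powers of a positive operator\<close>

definition pw :: "'e endo \<Rightarrow> real \<Rightarrow> 'e endo" where
  "pw b s = (if s = 0 then 1 else fcal (norm b) (\<lambda>t. t powr s) b)"

abbreviation positive :: "'e endo \<Rightarrow> bool" where "positive b \<equiv> spec_in (norm b) b"

lemma continuous_on_powr_const: "0 < s \<Longrightarrow> continuous_on {0..c} (\<lambda>t::real. t powr s)"
  by (intro continuous_on_powr' continuous_on_id continuous_on_const) auto

lemma pw_0: "pw b 0 = 1" by (simp add: pw_def)

lemma pw_pos: "0 < s \<Longrightarrow> pw b s = fcal (norm b) (\<lambda>t. t powr s) b" by (simp add: pw_def)

lemma pw_1: "positive b \<Longrightarrow> pw b 1 = b"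
  using fcal_poly[of "norm b" b "\<lambda>t. t powr 1" "[:0, 1:]"] by (simp add: pw_def peval_pCons)

lemma pw_add:
  assumes "positive b" "0 \<le> s" "0 \<le> t"
  shows "pw b (s + t) = pw b s * pw b t"
proof (cases "s = 0 \<or> t = 0")
  case True then show ?thesis by (auto simp: pw_0)
next
  case False
  then have "s > 0" "t > 0" using assms by auto
  then show ?thesis
    using fcal_mult[OF assms(1) continuous_on_powr_const[of s] continuous_on_powr_const[of t]]
    by (simp add: pw_pos powr_add)
qed

lemma pw_commute: "positive b \<Longrightarrow> 0 \<le> s \<Longrightarrow> 0 \<le> t \<Longrightarrow> pw b s * pw b t = pw b t * pw b s"
  by (metis pw_add add.commute)

lemma pw_selfadj: "positive b \<Longrightarrow> 0 \<le> s \<Longrightarrow> selfadj (pw b s)"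
  by (auto simp: pw_def adj_one intro!: fcal_selfadj continuous_on_powr_const)

lemma pw_commute_with:
  assumes "positive b" "0 \<le> s" "b * R = R * b"
  shows "pw b s * R = R * pw b s"
  using assms by (auto simp: pw_def intro!: fcal_commute continuous_on_powr_const)

lemma pw_split: "positive b \<Longrightarrow> 0 \<le> s \<Longrightarrow> s \<le> t \<Longrightarrow> pw b t = pw b s * pw b (t - s)"
  using pw_add[of b s "t - s"] by simp

lemma dense_range_mult:
  assumes "dense_range (X * Y)" shows "dense_range X"
proof -
  have "range (app (X * Y)) \<subseteq> range (app X)" by auto
  then show ?thesis using assms closure_mono by blast
qed

lemma pw_dense:
  assumes b: "positive b" and d: "dense_range b" and s: "0 \<le> s" "s \<le> 1"
  shows "dense_range (pw b s)"
proof (rule dense_range_mult[of _ "pw b (1 - s)"])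
  show "dense_range (pw b s * pw b (1 - s))"
    using d pw_split[OF b s] by (simp add: pw_1[OF b])
qed

lemma pw_inj:
  assumes b: "positive b" and d: "dense_range b" and s: "0 \<le> s" "s \<le> 1"
  shows "inj (app (pw b s))"
  by (rule selfadj_dense_inj[OF pw_selfadj[OF b s(1)] pw_dense[OF b d s]])

text \<open>Near \<open>s > 0\<close> the function \<open>t\<^sup>s\<close> is uniformly continuous in both variables on \<open>[0, norm b]\<close>.\<close>

lemma pw_continuous:
  assumes b: "positive b" and s: "0 < s" and lim: "S \<longlonglongrightarrow> s"
  shows "(\<lambda>n. pw b (S n)) \<longlonglongrightarrow> pw b s"
proof (rule LIMSEQ_I)
  fix e :: real assume e: "e > 0"
  define K where "K = {s / 2..s + 1} \<times> {0..norm b}"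
  have "continuous_on K (\<lambda>z. snd z powr fst z)"
    unfolding K_def using s by (intro continuous_on_powr' continuous_intros) auto
  then have "uniformly_continuous_on K (\<lambda>z. snd z powr fst z)"
    by (rule compact_uniformly_continuous) (simp add: K_def compact_Times)
  then obtain d where d: "d > 0"
    "\<And>z z'. z \<in> K \<Longrightarrow> z' \<in> K \<Longrightarrow> dist z' z < d \<Longrightarrow> dist (snd z' powr fst z') (snd z powr fst z) < e / 2"
    using e unfolding uniformly_continuous_on_def by (metis half_gt_zero)
  obtain N where N: "\<And>n. n \<ge> N \<Longrightarrow> \<bar>S n - s\<bar> < min d (min (s / 2) 1)"
    using LIMSEQ_D[OF lim, of "min d (min (s / 2) 1)"] d(1) s by auto
  have "norm (pw b (S n) - pw b s) < e" if "n \<ge> N" for n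
  proof -
    have n: "\<bar>S n - s\<bar> < d" "S n \<in> {s / 2..s + 1}" "S n > 0" using N[OF that] s unfolding abs_less_iff by auto
    have "norm (fcal (norm b) (\<lambda>t. t powr S n - t powr s) b) \<le> e / 2"
    proof (rule fcal_norm[OF b])
      fix t assume t: "0 \<le> t" "t \<le> norm b"
      have "dist (snd (S n, t) powr fst (S n, t)) (snd (s, t) powr fst (s, t)) < e / 2"
        by (rule d(2)) (use n t s in \<open>auto simp: K_def dist_Pair_Pair dist_real_def\<close>)
      then show "\<bar>t powr S n - t powr s\<bar> \<le> e / 2" by (simp add: dist_real_def)
    qed (intro continuous_on_diff continuous_on_powr_const n s)
    then show ?thesis
      using fcal_diff[OF b continuous_on_powr_const[OF n(3)] continuous_on_powr_const[OF s]] n s e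
      by (simp add: pw_pos)
  qed
  then show "\<exists>no. \<forall>n\<ge>no. norm (pw b (S n) - pw b s) < e" by blast
qed

text \<open>High-frequency cutoffs: \<open>t\<^sup>s (1 - t)\<^sup>n\<close> is at most \<open>d\<^sup>s\<close> for \<open>t \<le> d\<close> and at most \<open>(1 - d)\<^sup>n\<close> for larger
  \<open>t\<close>, hence tends to zero uniformly on \<open>[0, 1]\<close>.\<close>

lemma cutoff_limit:
  assumes b: "positive b" and n1: "norm b \<le> 1" and s: "0 < s"
  shows "(\<lambda>n. pw b s * (1 - b) ^ n) \<longlonglongrightarrow> 0"
proof (rule LIMSEQ_I)
  fix e :: real assume e: "e > 0"
  define d where "d = min 1 ((e / 2) powr (1 / s))"
  have d: "0 < d" "d \<le> 1" "d powr s \<le> e / 2"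
  proof -
    have "d powr s \<le> ((e / 2) powr (1 / s)) powr s"
      using s e by (intro powr_mono2) (auto simp: d_def)
    then show "d powr s \<le> e / 2" using s e by (simp add: powr_powr)
  qed (use e in \<open>auto simp: d_def\<close>)
  have "(\<lambda>n. (1 - d) ^ n) \<longlonglongrightarrow> 0" using d by (intro LIMSEQ_power_zero) auto
  then obtain N where N: "\<And>n. n \<ge> N \<Longrightarrow> (1 - d) ^ n < e / 2"
    using LIMSEQ_D[of "\<lambda>n. (1 - d) ^ n" 0 "e / 2"] e d by auto
  have "norm (pw b s * (1 - b) ^ n - 0) < e" if "n \<ge> N" for n
  proof -
    have "(1 - b) ^ n = peval ([:1, -1:] ^ n) b"
      by (simp add: peval_power peval_pCons)
    also have "\<dots> = fcal (norm b) (poly ([:1, -1:] ^ n)) b" by (rule fcal_poly[OF b, symmetric]) simp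
    finally have eq: "(1 - b) ^ n = fcal (norm b) (poly ([:1, -1:] ^ n)) b" .
    have "pw b s * (1 - b) ^ n = fcal (norm b) (\<lambda>t. t powr s * poly ([:1, -1:] ^ n) t) b"
      unfolding pw_pos[OF s] eq
      by (rule fcal_mult[OF b, symmetric]) (intro continuous_on_powr_const s continuous_intros)+
    also have "norm \<dots> \<le> e / 2"
    proof (rule fcal_norm[OF b])
      fix t assume t: "0 \<le> t" "t \<le> norm b"
      then have t1: "t \<le> 1" using n1 by simp
      have "t powr s * (1 - t) ^ n \<le> e / 2"
      proof (cases "t \<le> d")
        case True
        have "t powr s * (1 - t) ^ n \<le> d powr s * 1"
          using True t t1 s by (intro mult_mono powr_mono2 power_le_one) auto
        then show ?thesis using d by simp
      next
        case False
        have "t powr s * (1 - t) ^ n \<le> 1 * (1 - d) ^ n"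
          using False t t1 s by (intro mult_mono power_mono powr_le1) auto
        then show ?thesis using N[OF that] by simp
      qed
      then show "\<bar>t powr s * poly ([:1, - 1:] ^ n) t\<bar> \<le> e / 2" using t t1 by (simp add: poly_power abs_mult)
    qed (intro continuous_on_mult continuous_on_powr_const s continuous_intros)
    finally show ?thesis using e by simp
  qed
  then show "\<exists>no. \<forall>n\<ge>no. norm (pw b s * (1 - b) ^ n - 0) < e" by blast
qed

lemma cutoff_norm:
  assumes b: "positive b" and n1: "norm b \<le> 1"
  shows "norm ((1 - b) ^ n) \<le> 1"
proof -
  have "norm (peval ([:1, -1:] ^ n) b) \<le> 1"
    by (rule spec_inD[OF b]) (use n1 in \<open>simp add: poly_power power_le_one abs_le_iff power_abs\<close>)
  then show ?thesis by (simp add: peval_power peval_pCons)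
qed

section \<open>Interpolation\<close>

text \<open>Reid's inequality. \<open>L\<close> is symmetric for the semi-inner product \<open>\<langle>r x, r y\<rangle>\<close>; Cauchy--Schwarz for
  it bounds \<open>norm (r L y)\<close> by the geometric mean of \<open>norm (r y)\<close> and \<open>norm (r L\<^sup>2 y)\<close>, and
  iterating this along the powers \<open>L ^ 2 ^ n\<close> leaves only \<open>norm L\<close>.\<close>

lemma reid_inequality:
  assumes r: "selfadj r" and L: "adj L L'" and sym: "r * r * L = L' * (r * r)"
  shows "norm (r \<cdot> L \<cdot> y) \<le> 3 * norm L * norm (r \<cdot> y)"
proof -
  define z where "z n = norm (r \<cdot> (L ^ n) \<cdot> y)" for n
  have L_move: "ip (r \<cdot> x) (r \<cdot> L \<cdot> w) = ip (r \<cdot> L \<cdot> x) (r \<cdot> w)" for x w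
  proof -
    have "ip (r \<cdot> x) (r \<cdot> L \<cdot> w) = ip x ((r * r * L) \<cdot> w)" by (simp add: adjD[OF r])
    also have "\<dots> = ip (L \<cdot> x) (r \<cdot> r \<cdot> w)" unfolding sym by (simp add: adjD[OF L])
    finally show ?thesis by (simp add: adjD[OF r])
  qed
  have step: "(z n)\<^sup>2 \<le> 3 * z 0 * z (2 * n)" for n
  proof -
    have pow: "ip (r \<cdot> (L ^ n) \<cdot> x) (r \<cdot> w) = ip (r \<cdot> x) (r \<cdot> (L ^ n) \<cdot> w)" for x w
    proof (induction n arbitrary: x)
      case (Suc n)
      have "ip (r \<cdot> (L ^ Suc n) \<cdot> x) (r \<cdot> w) = ip (r \<cdot> (L ^ n) \<cdot> L \<cdot> x) (r \<cdot> w)"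
        by (simp add: power_commutes[symmetric] del: app_simps(7) flip: app_simps(7))
      also have "\<dots> = ip (r \<cdot> x) (r \<cdot> L \<cdot> (L ^ n) \<cdot> w)" by (simp add: Suc L_move)
      finally show ?case by simp
    qed simp
    have "(z n)\<^sup>2 = norm (ip (r \<cdot> y) (r \<cdot> (L ^ n) \<cdot> (L ^ n) \<cdot> y))"
      unfolding z_def norm_ip_self[symmetric] by (simp add: pow)
    also have "\<dots> \<le> 3 * norm (r \<cdot> y) * norm (r \<cdot> (L ^ n) \<cdot> (L ^ n) \<cdot> y)" by (rule cauchy_schwarz)
    finally show ?thesis by (simp add: z_def mult_2 power_add)
  qed
  show ?thesis
  proof (cases "z 0 = 0")
    case True
    then have "z 1 = 0" using step[of 1] by simp
    then show ?thesis by (simp add: z_def)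
  next
    case False
    then have z0: "z 0 > 0" by (simp add: z_def)
    define q where "q = z 1 / (3 * z 0)"
    have q0: "q \<ge> 0" using z0 by (simp add: q_def z_def)
    have iter: "q ^ (2 ^ n) \<le> z (2 ^ n) / (3 * z 0)" for n
    proof (induction n)
      case (Suc n)
      have "q ^ (2 ^ Suc n) = (q ^ (2 ^ n))\<^sup>2" by (simp flip: power_mult add: mult.commute)
      also have "\<dots> \<le> (z (2 ^ n) / (3 * z 0))\<^sup>2" using Suc q0 by (intro power_mono) auto
      also have "\<dots> = (z (2 ^ n))\<^sup>2 / (9 * (z 0)\<^sup>2)" by (simp add: power_divide power_mult_distrib)
      also have "\<dots> \<le> (3 * z 0 * z (2 * 2 ^ n)) / (9 * (z 0)\<^sup>2)"
        by (intro divide_right_mono step) simp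
      also have "\<dots> = z (2 ^ Suc n) / (3 * z 0)" using z0 by (simp add: power2_eq_square)
      finally show ?case .
    qed (simp add: q_def)
    have "q \<le> norm L"
    proof (rule ccontr)
      assume "\<not> q \<le> norm L"
      then have less: "norm L < q" by simp
      define x where "x = norm L / q"
      have qpos: "q > 0" using less norm_ge_zero[of L] by linarith
      then have x: "norm x < 1" using less by (simp add: x_def)
      define C where "C = norm r * norm y / (3 * z 0)"
      have "1 \<le> C * x ^ (2 ^ n)" for n
      proof -
        have "z (2 ^ n) \<le> norm r * (norm L ^ (2 ^ n) * norm y)"
          unfolding z_def
          by (rule order_trans[OF norm_app], intro mult_left_mono norm_ge_zero,
              rule order_trans[OF norm_app], intro mult_right_mono norm_power_endo norm_ge_zero)
        then have "q ^ (2 ^ n) \<le> norm r * (norm L ^ (2 ^ n) * norm y) / (3 * z 0)"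
          using iter[of n] z0 by (meson divide_right_mono order_trans less_imp_le mult_pos_pos zero_less_numeral)
        then have "q ^ (2 ^ n) \<le> C * norm L ^ (2 ^ n)" by (simp add: C_def mult_ac)
        then show ?thesis using qpos by (simp add: x_def power_divide pos_le_divide_eq)
      qed
      moreover have "(\<lambda>n. C * x ^ (2 ^ n)) \<longlonglongrightarrow> C * 0"
      proof (intro tendsto_mult tendsto_const)
        have "filterlim (\<lambda>n::nat. 2 ^ n :: nat) sequentially sequentially"
          by (rule filterlim_subseq) (simp add: strict_mono_def)
        then show "(\<lambda>n. x ^ (2 ^ n)) \<longlonglongrightarrow> 0"
          by (rule filterlim_compose[OF LIMSEQ_power_zero[OF x]])
      qed
      ultimately have "(1::real) \<le> C * 0" by (intro LIMSEQ_le_const) auto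
      then show False by simp
    qed
    then have "z 1 \<le> norm L * (3 * z 0)" using z0 by (simp add: q_def pos_divide_le_eq)
    then show ?thesis by (simp add: z_def mult_ac)
  qed
qed

lemma reid_form:
  assumes r: "selfadj r" and L: "adj L L'" and sym: "r * r * L = L' * (r * r)"
  shows "norm (ip y (r \<cdot> r \<cdot> L \<cdot> y)) \<le> 9 * norm L * (norm (r \<cdot> y))\<^sup>2"
proof -
  have "norm (ip y (r \<cdot> r \<cdot> L \<cdot> y)) = norm (ip (r \<cdot> y) (r \<cdot> L \<cdot> y))" by (simp add: adjD[OF r])
  also have "\<dots> \<le> 3 * norm (r \<cdot> y) * norm (r \<cdot> L \<cdot> y)" by (rule cauchy_schwarz)
  also have "\<dots> \<le> 3 * norm (r \<cdot> y) * (3 * norm L * norm (r \<cdot> y))"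
    by (intro mult_left_mono reid_inequality[OF assms]) auto
  finally show ?thesis by (simp add: power2_eq_square mult_ac)
qed

text \<open>The operator \<open>M = r1\<^sup>-\<^sup>1 X r2\<close> is determined by \<open>M r2 = r1 Y\<close>, and Reid's inequality for
  \<open>L = X\<^sup>* Y\<close> bounds \<open>norm (r1 Y y)\<close> by \<open>norm (r2 y)\<close>. The constant is a geometric mean of the two
  endpoint norms, so that smallness of \<open>X\<close> alone makes \<open>M\<close> small.\<close>

lemma heinz_half:
  assumes r1: "selfadj r1" and r2: "selfadj r2" and d1: "dense_range r1" and d2: "dense_range r2"
    and X: "adj X X'" and Y: "adj Y Y'" and XY: "X * (r2 * r2) = r1 * r1 * Y"
  obtains M M' where "adj M M'" "X * r2 = r1 * M" "(norm M)\<^sup>2 \<le> 9 * (norm X' * norm Y)"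
proof -
  define C where "C = 3 * sqrt (norm X' * norm Y)"
  have C0: "C \<ge> 0" and C2: "C\<^sup>2 = 9 * (norm X' * norm Y)" by (simp_all add: C_def power_mult_distrib)
  have "adj (X * (r2 * r2)) (r2 * r2 * X')" by (intro adj_mult X r2)
  moreover have "adj (r1 * r1 * Y) (Y' * (r1 * r1))" by (intro adj_mult Y r1)
  ultimately have XY': "r2 * r2 * X' = Y' * (r1 * r1)" unfolding XY by (rule adj_unique)
  have sym: "r2 * r2 * (X' * Y) = Y' * X * (r2 * r2)"
  proof -
    have "r2 * r2 * (X' * Y) = (r2 * r2 * X') * Y" by (simp only: mult.assoc)
    also have "\<dots> = Y' * (r1 * r1 * Y)" unfolding XY' by (simp only: mult.assoc)
    finally show ?thesis unfolding XY[symmetric] by (simp only: mult.assoc)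
  qed
  have bound: "norm ((r1 * Y) \<cdot> y) \<le> C * norm (r2 \<cdot> y)" for y
  proof (rule power2_le_imp_le)
    have "(norm ((r1 * Y) \<cdot> y))\<^sup>2 = norm (ip y ((Y' * (r1 * r1 * Y)) \<cdot> y))"
      unfolding norm_ip_self[symmetric] by (simp add: adjD[OF r1] adjD[OF Y])
    also have "Y' * (r1 * r1 * Y) = r2 * r2 * (X' * Y)" unfolding sym XY[symmetric] by (simp only: mult.assoc)
    also have "norm (ip y ((r2 * r2 * (X' * Y)) \<cdot> y)) \<le> 9 * norm (X' * Y) * (norm (r2 \<cdot> y))\<^sup>2"
      using reid_form[OF r2 adj_mult[OF adj_sym[OF X] Y] sym] by simp
    also have "\<dots> \<le> (9 * (norm X' * norm Y)) * (norm (r2 \<cdot> y))\<^sup>2"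
      by (intro mult_right_mono mult_left_mono norm_mult_ineq) auto
    finally show "(norm ((r1 * Y) \<cdot> y))\<^sup>2 \<le> (C * norm (r2 \<cdot> y))\<^sup>2" by (simp add: C2 power_mult_distrib)
  qed (simp add: C0)
  obtain M where M: "M * r2 = r1 * Y" "norm M \<le> C" using endo_factor[OF d2 C0 bound] by blast
  have "(r1 * M) * r2 = (X * r2) * r2" by (simp only: mult.assoc M XY)
  then have XM: "X * r2 = r1 * M" by (rule dense_range_cancel[OF d2, symmetric])
  have "ip (M \<cdot> v) (r1 \<cdot> z) = ip v ((r2 * X') \<cdot> z)" for v z
  proof -
    have "ip (M \<cdot> v) (r1 \<cdot> z) = ip ((r1 * M) \<cdot> v) z" by (simp add: adjD[OF r1])
    also have "\<dots> = ip v ((r2 * X') \<cdot> z)" unfolding XM[symmetric] by (simp add: adjD[OF X] adjD[OF r2])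
    finally show ?thesis .
  qed
  then obtain M' where "adj M M'" using adjointable_of_dense[OF d1] by blast
  moreover have "(norm M)\<^sup>2 \<le> 9 * (norm X' * norm Y)" unfolding C2[symmetric] using M(2) by (intro power_mono) auto
  ultimately show thesis using XM that by blast
qed

text \<open>The operator \<open>W\<close> is the closure of \<open>b\<^sup>s Y b\<^sup>-\<^sup>s\<close>.\<close>

definition conj_bounded :: "'e endo \<Rightarrow> 'e endo \<Rightarrow> real \<Rightarrow> real \<Rightarrow> bool" where
  "conj_bounded b Y C s \<longleftrightarrow> (\<exists>W W'. adj W W' \<and> W * pw b s = pw b s * Y \<and> norm W \<le> C)"

lemma conj_bounded_mono: "conj_bounded b Y C s \<Longrightarrow> C \<le> D \<Longrightarrow> conj_bounded b Y D s"
  unfolding conj_bounded_def by (meson order_trans)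

text \<open>If \<open>U\<close> and \<open>V\<close> are the conjugates of \<open>Y\<close> at \<open>s\<close> and \<open>t\<close>, then
  \<open>Y\<^sup>* b\<^sup>s\<^sup>+\<^sup>t Y = b\<^sup>t (b\<^sup>s\<^sup>-\<^sup>t U\<^sup>* V) b\<^sup>t\<close>. Reid's inequality with \<open>r\<^sup>2 = b\<^sup>s\<^sup>-\<^sup>t\<close> and \<open>L = U\<^sup>* V\<close> compares this form with
  \<open>b\<^sup>s\<^sup>+\<^sup>t\<close>. The operator \<open>W1\<close>, the conjugate at exponent 1, provides the adjoint.\<close>

lemma conj_bounded_midpoint:
  assumes b: "positive b" and d: "dense_range b" and Y: "adj Y Y'"
    and C: "conj_bounded b Y C s" and D: "conj_bounded b Y D t" and CD: "0 \<le> C" "0 \<le> D"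
    and W1: "adj W1 W1'" "W1 * b = b * Y"
    and t: "0 \<le> t" "t \<le> s" "s \<le> 1"
  shows "conj_bounded b Y (sqrt (27 * (C * D))) ((s + t) / 2)"
proof -
  obtain U U' where U: "adj U U'" "U * pw b s = pw b s * Y" "norm U \<le> C"
    using C unfolding conj_bounded_def by blast
  obtain V V' where V: "adj V V'" "V * pw b t = pw b t * Y" "norm V \<le> D"
    using D unfolding conj_bounded_def by blast
  define m where "m = (s + t) / 2"
  define h where "h = (s - t) / 2"
  have mh: "0 \<le> h" "m = t + h" "s = t + (h + h)" "0 \<le> m" "m \<le> 1" using t by (auto simp: m_def h_def field_simps)
  define r where "r = pw b h"
  have r: "selfadj r" unfolding r_def by (rule pw_selfadj[OF b mh(1)])
  have pm: "pw b m = r * pw b t" unfolding mh(2) r_def using pw_add[OF b mh(1) t(1)] by (simp add: add.commute)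
  have ps: "pw b s = r * r * pw b t"
    unfolding mh(3) r_def using pw_add[OF b mh(1) mh(1)] pw_add[OF b _ t(1), of "h + h"] mh(1) by (simp add: add.commute)
  have dt: "dense_range (pw b t)" using b d t by (intro pw_dense) auto
  have at: "selfadj (pw b t)" by (rule pw_selfadj[OF b t(1)])
  have asr: "selfadj (pw b s)" using t by (intro pw_selfadj[OF b]) auto
  have pmm: "pw b m * pw b m = pw b t * pw b s"
  proof -
    have "pw b m * pw b m = pw b (m + m)" using pw_add[OF b mh(4) mh(4)] by simp
    also have "m + m = t + s" by (simp add: m_def)
    also have "pw b (t + s) = pw b t * pw b s" using t by (intro pw_add[OF b]) auto
    finally show ?thesis .
  qed
  have V': "pw b t * V' = Y' * pw b t"
  proof -
    have "adj (V * pw b t) (pw b t * V')" by (intro adj_mult V at)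
    moreover have "adj (pw b t * Y) (Y' * pw b t)" by (intro adj_mult Y at)
    ultimately show ?thesis unfolding V(2) by (rule adj_unique)
  qed
  have U': "pw b s * U' = Y' * pw b s"
  proof -
    have "adj (U * pw b s) (pw b s * U')" by (intro adj_mult U asr)
    moreover have "adj (pw b s * Y) (Y' * pw b s)" by (intro adj_mult Y asr)
    ultimately show ?thesis unfolding U(2) by (rule adj_unique)
  qed
  have rt: "r * pw b t = pw b t * r" unfolding r_def by (rule pw_commute[OF b mh(1) t(1)])
  have rrt: "r * r * pw b t = pw b t * (r * r)" using rt by (metis mult.assoc)
  \<comment> \<open>\<open>L = U\<^sup>* V\<close> is symmetric with respect to \<open>r\<^sup>2\<close>\<close>
  have e1: "pw b t * (r * r * (U' * V)) * pw b t = Y' * (pw b s * pw b t) * Y"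
  proof -
    have "pw b t * (r * r * (U' * V)) * pw b t = (pw b s * U') * (V * pw b t)"
      by (simp only: ps[unfolded rrt] mult.assoc)
    then show ?thesis unfolding U' V(2) by (simp only: mult.assoc)
  qed
  have e2: "pw b t * (V' * U * (r * r)) * pw b t = Y' * (pw b t * pw b s) * Y"
  proof -
    have "pw b t * (V' * U * (r * r)) * pw b t = (pw b t * V') * (U * pw b s)"
      by (simp only: ps mult.assoc)
    then show ?thesis unfolding V' U(2) by (simp only: mult.assoc)
  qed
  have ts: "pw b s * pw b t = pw b t * pw b s" using t by (intro pw_commute[OF b]) auto
  have "pw b t * (r * r * (U' * V)) = pw b t * (V' * U * (r * r))"
    by (rule dense_range_cancel[OF dt]) (simp only: e1 e2 ts)
  then have sym: "r * r * (U' * V) = V' * U * (r * r)"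
    by (rule inj_cancel[OF selfadj_dense_inj[OF at dt]])
  define K where "K = sqrt (27 * (C * D))"
  have K0: "K \<ge> 0" and K2: "K\<^sup>2 = 27 * (C * D)" using CD by (simp_all add: K_def)
  have bound: "norm ((pw b m * Y) \<cdot> y) \<le> K * norm (pw b m \<cdot> y)" for y
  proof (rule power2_le_imp_le)
    define z where "z = pw b t \<cdot> y"
    have am: "selfadj (pw b m)" by (rule pw_selfadj[OF b mh(4)])
    have "(norm ((pw b m * Y) \<cdot> y))\<^sup>2 = norm (ip y ((Y' * (pw b m * pw b m) * Y) \<cdot> y))"
      unfolding norm_ip_self[symmetric] by (simp add: adjD[OF am] adjD[OF Y])
    also have "Y' * (pw b m * pw b m) * Y = pw b t * (r * r * (U' * V)) * pw b t"
      by (simp only: pmm e1 ts)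
    also have "ip y (\<dots> \<cdot> y) = ip z (r \<cdot> r \<cdot> (U' * V) \<cdot> z)"
      by (simp add: z_def adjD[OF at])
    also have "norm \<dots> \<le> 9 * norm (U' * V) * (norm (r \<cdot> z))\<^sup>2"
      by (rule reid_form[OF r adj_mult[OF adj_sym[OF U(1)] V(1)] sym])
    also have "\<dots> \<le> (27 * (C * D)) * (norm (r \<cdot> z))\<^sup>2"
    proof (intro mult_right_mono)
      have "norm (U' * V) \<le> norm U' * norm V" by (rule norm_mult_ineq)
      also have "\<dots> \<le> (3 * C) * D"
        using adj_norm[OF U(1)] U(3) V(3) CD by (intro mult_mono) auto
      finally show "9 * norm (U' * V) \<le> 27 * (C * D)" by simp
    qed simp
    also have "\<dots> = (K * norm (pw b m \<cdot> y))\<^sup>2" by (simp add: K2 power_mult_distrib pm z_def)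
    finally show "(norm ((pw b m * Y) \<cdot> y))\<^sup>2 \<le> (K * norm (pw b m \<cdot> y))\<^sup>2" .
  qed (simp add: K0)
  obtain W where W: "W * pw b m = pw b m * Y" "norm W \<le> K"
    using endo_factor[OF pw_dense[OF b d mh(4,5)] K0 bound] by blast
  have m1: "0 \<le> 1 - m" "1 - m \<le> 1" using mh by auto
  have b1: "pw b (1 - m) * pw b m = b" "pw b m * pw b (1 - m) = b"
    using pw_add[OF b m1(1) mh(4)] pw_add[OF b mh(4) m1(1)] by (simp_all add: pw_1[OF b])
  have "(pw b (1 - m) * W) * pw b m = (W1 * pw b (1 - m)) * pw b m"
    by (simp only: mult.assoc W(1) b1 W1(2)) (simp only: b1 flip: mult.assoc)
  then have WW: "pw b (1 - m) * W = W1 * pw b (1 - m)" by (rule dense_range_cancel[OF pw_dense[OF b d mh(4,5)]])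
  have a1: "selfadj (pw b (1 - m))" by (rule pw_selfadj[OF b m1(1)])
  have "ip (W \<cdot> v) (pw b (1 - m) \<cdot> z) = ip v ((pw b (1 - m) * W1') \<cdot> z)" for v z
  proof -
    have "ip (W \<cdot> v) (pw b (1 - m) \<cdot> z) = ip ((pw b (1 - m) * W) \<cdot> v) z" by (simp add: adjD[OF a1])
    then show ?thesis unfolding WW by (simp add: adjD[OF W1(1)] adjD[OF a1])
  qed
  then obtain W' where "adj W W'" using adjointable_of_dense[OF pw_dense[OF b d m1]] by blast
  with W show ?thesis unfolding conj_bounded_def K_def m_def by blast
qed

text \<open>Every dyadic exponent is the midpoint of another one and an endpoint, which keeps the constants
  bounded; continuity of \<open>s \<mapsto> b\<^sup>s\<close> then reaches all exponents.\<close>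

lemma heinz_interpolation:
  assumes b: "positive b" and d: "dense_range b" and Y: "adj Y Y'"
    and W1: "adj W1 W1'" "W1 * b = b * Y" and s: "0 \<le> s" "s \<le> 1"
  obtains W where "W * pw b s = pw b s * Y" "mlin W"
proof -
  define c where "c = max 1 (max (norm Y) (norm W1))"
  define C where "C = 27 * c"
  have c: "c \<ge> 1" "norm Y \<le> c" "norm W1 \<le> c" by (auto simp: c_def)
  have e0: "conj_bounded b Y c 0" using Y c by (auto simp: conj_bounded_def pw_0)
  have e1: "conj_bounded b Y c 1" using W1 c by (auto simp: conj_bounded_def pw_1[OF b])
  have "sqrt (27 * (C * c)) = C"
    by (rule real_sqrt_unique) (use c in \<open>auto simp: C_def power2_eq_square\<close>)
  then have K: "sqrt (27 * (C * c)) = C" "sqrt (27 * (c * C)) = C" by (simp_all add: mult.commute)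
  have pos: "0 \<le> C" "0 \<le> c" "c \<le> C" using c by (auto simp: C_def)
  have dyadic: "conj_bounded b Y C (real k / 2 ^ n)" if "k \<le> 2 ^ n" for k n
    using that
  proof (induction n arbitrary: k)
    case 0
    then have "k = 0 \<or> k = 1" by auto
    then show ?case using conj_bounded_mono[OF e0 pos(3)] conj_bounded_mono[OF e1 pos(3)] by auto
  next
    case (Suc n)
    show ?case
    proof (cases "k \<le> 2 ^ n")
      case True
      have "conj_bounded b Y (sqrt (27 * (C * c))) ((real k / 2 ^ n + 0) / 2)"
        using True by (intro conj_bounded_midpoint[OF b d Y Suc.IH[OF True] e0 pos(1,2) W1]) auto
      then show ?thesis unfolding K by (simp add: mult.commute)
    next
      case False
      define j where "j = k - 2 ^ n"
      have j: "j \<le> 2 ^ n" "real k = real j + 2 ^ n" using False Suc.prems by (auto simp: j_def of_nat_diff)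
      have "conj_bounded b Y (sqrt (27 * (c * C))) ((1 + real j / 2 ^ n) / 2)"
        using j by (intro conj_bounded_midpoint[OF b d Y e1 Suc.IH[OF j(1)] pos(2,1) W1]) auto
      moreover have "(1 + real j / 2 ^ n) / 2 = real k / 2 ^ Suc n"
        unfolding j(2) by (simp add: field_simps)
      ultimately show ?thesis unfolding K by simp
    qed
  qed
  have bound: "norm ((pw b s * Y) \<cdot> y) \<le> C * norm (pw b s \<cdot> y)" for y
  proof (cases "s = 0")
    case True
    have "norm (Y \<cdot> y) \<le> C * norm y"
      by (rule order_trans[OF norm_app]) (use c pos in \<open>auto intro!: mult_right_mono\<close>)
    then show ?thesis using True by (simp add: pw_0)
  next
    case False
    then have s0: "s > 0" using s by simp
    define S where "S n = real (nat \<lfloor>s * 2 ^ n\<rfloor>) / 2 ^ n" for n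
    have fl: "s - (1/2) ^ n \<le> S n" "S n \<le> s" for n
    proof -
      have nn: "0 \<le> s * 2 ^ n" using s by simp
      have "s * 2 ^ n - 1 \<le> real (nat \<lfloor>s * 2 ^ n\<rfloor>)" "real (nat \<lfloor>s * 2 ^ n\<rfloor>) \<le> s * 2 ^ n"
        using nn by linarith+
      then have "(s * 2 ^ n - 1) / 2 ^ n \<le> S n" "S n \<le> s * 2 ^ n / 2 ^ n"
        unfolding S_def by (intro divide_right_mono; simp)+
      then show "s - (1/2) ^ n \<le> S n" "S n \<le> s" by (simp_all add: diff_divide_distrib power_one_over)
    qed
    have "(\<lambda>n. s - (1/2) ^ n) \<longlonglongrightarrow> s - 0" by (intro tendsto_intros LIMSEQ_power_zero) auto
    then have S: "S \<longlonglongrightarrow> s"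
      by (intro tendsto_sandwich[of "\<lambda>n. s - (1/2) ^ n" S sequentially "\<lambda>_. s"]) (use fl in auto)
    have "norm ((pw b (S n) * Y) \<cdot> y) \<le> C * norm (pw b (S n) \<cdot> y)" for n
    proof -
      have "nat \<lfloor>s * 2 ^ n\<rfloor> \<le> 2 ^ n"
      proof -
        have "real (nat \<lfloor>s * 2 ^ n\<rfloor>) \<le> s * 2 ^ n" using fl(2)[of n] by (simp add: S_def divide_le_eq)
        also have "\<dots> \<le> real (2 ^ n)" using s by simp
        finally show ?thesis by (simp only: of_nat_le_iff)
      qed
      then have "conj_bounded b Y C (S n)" unfolding S_def by (rule dyadic)
      then obtain W where W: "W * pw b (S n) = pw b (S n) * Y" "norm W \<le> C" unfolding conj_bounded_def by blast
      have "norm (W \<cdot> pw b (S n) \<cdot> y) \<le> C * norm (pw b (S n) \<cdot> y)"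
        by (rule order_trans[OF norm_app]) (intro mult_right_mono W norm_ge_zero)
      then show ?thesis by (simp flip: W(1))
    qed
    moreover have "(\<lambda>n. norm ((pw b (S n) * Y) \<cdot> y)) \<longlonglongrightarrow> norm ((pw b s * Y) \<cdot> y)"
      by (intro tendsto_norm tendsto_app tendsto_mult tendsto_const pw_continuous[OF b s0 S])
    moreover have "(\<lambda>n. C * norm (pw b (S n) \<cdot> y)) \<longlonglongrightarrow> C * norm (pw b s \<cdot> y)"
      by (intro tendsto_mult tendsto_const tendsto_norm tendsto_app pw_continuous[OF b s0 S])
    ultimately show ?thesis by (intro LIMSEQ_le) auto
  qed
  obtain W where W: "W * pw b s = pw b s * Y"
    using endo_factor[OF pw_dense[OF b d s] pos(1) bound] by blast
  have "mlin W"
    using pw_dense[OF b d s] adj_mlin[OF pw_selfadj[OF b s(1)]] 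
      mlin_mult[OF adj_mlin[OF pw_selfadj[OF b s(1)]] adj_mlin[OF Y]] W by (rule mlin_factor)
  with W show thesis by (rule that)
qed

end

section \<open>Self-adjoint regular operators through their bounded transform\<close>

lemma op_add_Some: "(S +\<^sub>o T) x = Some u \<longleftrightarrow> (\<exists>v w. S x = Some v \<and> T x = Some w \<and> u = v + w)"
  by (auto simp: op_add_def split: option.splits)

lemma one_minus_power_poly: "\<exists>p. 1 - [:1, -1:] ^ n = [:0, 1:] * (p::real poly)"
proof (induction n)
  case (Suc n)
  then obtain p where p: "1 - [:1, -1:] ^ n = [:0, 1:] * (p::real poly)" by blast
  have "1 - [:1, -1:] ^ Suc n = (1 - [:1, -1:] ^ n) + ([:1::real:] - [:1, -1:]) * [:1, -1:] ^ n"
    by (simp only: power_Suc algebra_simps one_pCons[symmetric])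
  also have "[:1::real:] - [:1, -1:] = [:0, 1:]" by simp
  also have "(1 - [:1, -1:] ^ n) + [:0, 1:] * [:1, -1:] ^ n = [:0, 1:] * (p + [:1, -1:] ^ n)"
    unfolding p by (simp only: distrib_left)
  finally show ?case by blast
qed (auto intro: exI[of _ 0])

text \<open>The cutoffs \<open>(1 - X) ^ n\<close> differ from the identity by a multiple of \<open>X\<close>.\<close>

lemma one_minus_power:
  obtains p where "1 - (1 - X) ^ n = X * peval p X"
proof -
  obtain p where p: "1 - [:1, -1:] ^ n = [:0, 1:] * (p::real poly)" using one_minus_power_poly by blast
  have "peval (1 - [:1, -1:] ^ n) X = 1 - (1 - X) ^ n"
    by (simp add: peval_diff peval_power peval_pCons)
  moreover have "peval ([:0, 1:] * p) X = X * peval p X"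
    unfolding peval_mult by (simp add: peval_pCons)
  ultimately have "1 - (1 - X) ^ n = X * peval p X" unfolding p by simp
  then show thesis by (rule that)
qed

context hilbert_module
begin

lemma fcal_restrict:
  assumes A: "spec_in c A" and A': "spec_in c' A" and le: "c' \<le> c" and f: "continuous_on {0..c} f"
  shows "fcal c' f A = fcal c f A"
proof -
  obtain p where p: "uniform_limit {0..c} (\<lambda>n. poly (p n)) f sequentially" "(\<lambda>n. peval (p n) A) \<longlonglongrightarrow> fcal c f A"
    using fcal_approx[OF A f] .
  show ?thesis
  proof (rule fcal_eqI[OF A' _ _ p(2)])
    show "continuous_on {0..c'} f" by (rule continuous_on_subset[OF f]) (use le in auto)
    show "uniform_limit {0..c'} (\<lambda>n. poly (p n)) f sequentially"
      by (rule uniform_limit_on_subset[OF p(1)]) (use le in auto)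
  qed
qed

lemma selfadj_regularD:
  assumes "self_adjoint_regular ip act D"
  shows "D 0 = Some 0"
    and "\<And>x y u v. D x = Some u \<Longrightarrow> D y = Some v \<Longrightarrow> D (x + y) = Some (u + v)"
    and "\<And>x u c. D x = Some u \<Longrightarrow> D (c *\<^sub>C x) = Some (c *\<^sub>C u)"
    and "closure (dom D) = UNIV" and "closed (Map.graph D)"
    and "\<And>x y u v. D x = Some u \<Longrightarrow> D y = Some v \<Longrightarrow> ip u y = ip x v"
    and "closure (ran (Some +\<^sub>o (D \<circ>\<^sub>m D))) = UNIV"
proof -
  have reg: "regular_op ip act D" and sa: "op_adjoint ip D = D"
    using assms by (auto simp: self_adjoint_regular_def)
  have ml: "module_linear act D" using reg by (simp add: regular_op_def)
  show "D 0 = Some 0" "\<And>x y u v. D x = Some u \<Longrightarrow> D y = Some v \<Longrightarrow> D (x + y) = Some (u + v)"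
    "\<And>x u c. D x = Some u \<Longrightarrow> D (c *\<^sub>C x) = Some (c *\<^sub>C u)"
    using ml unfolding module_linear_def by blast+
  show "closure (dom D) = UNIV" "closed (Map.graph D)" "closure (ran (Some +\<^sub>o (D \<circ>\<^sub>m D))) = UNIV"
    using reg sa by (simp_all add: regular_op_def densely_defined_def)
  fix x y u v assume D: "D x = Some u" "D y = Some v"
  have "op_adjoint ip D y = Some v" using D sa by simp
  then have ex: "\<exists>!z. \<forall>x\<in>dom D. ip (the (D x)) y = ip x z"
    and v: "v = (THE z. \<forall>x\<in>dom D. ip (the (D x)) y = ip x z)"
    by (auto simp: op_adjoint_def split: if_splits)
  have "\<forall>x\<in>dom D. ip (the (D x)) y = ip x v" unfolding v by (rule theI'[OF ex])
  then show "ip u y = ip x v" using D(1) by force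
qed

text \<open>By symmetry \<open>norm ((D + i) x) = norm ((D - i) x)\<close>, and half the sum of these two norms dominates both
  \<open>norm x\<close> and \<open>norm (D x)\<close>. As \<open>(D + i)(D - i) = 1 + D\<^sup>2\<close>, two applications bound the resolvent.\<close>

lemma resolvent_bound:
  assumes D: "self_adjoint_regular ip act D" and u: "D x = Some u"
  shows "norm x \<le> norm (u + \<i> *\<^sub>C x)" "norm x \<le> norm (u - \<i> *\<^sub>C x)"
    "norm u \<le> norm (u + \<i> *\<^sub>C x)" "norm u \<le> norm (u - \<i> *\<^sub>C x)"
proof -
  note d = selfadj_regularD[OF D]
  have ux: "ip u x = ip x u" by (rule d(6)[OF u u])
  have iux: "ip (\<i> *\<^sub>C x) u = - ip u (\<i> *\<^sub>C x)"
    using adjD[OF adj_imag, of x u] ux by (simp add: ip_scaleC_right)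
  have "ip (u + \<i> *\<^sub>C x) (u + \<i> *\<^sub>C x) = ip (u - \<i> *\<^sub>C x) (u - \<i> *\<^sub>C x)"
    using iux by simp
  then have eq: "norm (u + \<i> *\<^sub>C x) = norm (u - \<i> *\<^sub>C x)" by (simp only: norm_ip)
  have "2 *\<^sub>R u = (u + \<i> *\<^sub>C x) + (u - \<i> *\<^sub>C x)" by (simp add: scaleR_2)
  then have "norm (2 *\<^sub>R u) \<le> norm (u + \<i> *\<^sub>C x) + norm (u - \<i> *\<^sub>C x)" by (metis norm_triangle_ineq)
  then show "norm u \<le> norm (u + \<i> *\<^sub>C x)" "norm u \<le> norm (u - \<i> *\<^sub>C x)" using eq by simp_all
  have "2 *\<^sub>R (\<i> *\<^sub>C x) = (u + \<i> *\<^sub>C x) - (u - \<i> *\<^sub>C x)" by (simp add: scaleR_2)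
  then have "norm (2 *\<^sub>R (\<i> *\<^sub>C x)) \<le> norm (u + \<i> *\<^sub>C x) + norm (u - \<i> *\<^sub>C x)" by (metis norm_triangle_ineq4)
  then show "norm x \<le> norm (u + \<i> *\<^sub>C x)" "norm x \<le> norm (u - \<i> *\<^sub>C x)"
    using eq by (simp_all add: norm_scaleC_module)
qed

lemma one_plus_square_bound:
  assumes D: "self_adjoint_regular ip act D" and u: "D x = Some u" and w: "D u = Some w"
  shows "norm x \<le> norm (x + w)" "norm u \<le> norm (x + w)" "norm w \<le> 2 * norm (x + w)"
proof -
  note d = selfadj_regularD[OF D]
  define z where "z = u - \<i> *\<^sub>C x"
  have "D (u + (- \<i>) *\<^sub>C x) = Some (w + (- \<i>) *\<^sub>C u)" by (intro d(2,3) u w)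
  moreover have neg: "(- \<i>) *\<^sub>C y = - (\<i> *\<^sub>C y)" for y :: 'e
  proof -
    have "(- \<i>) *\<^sub>C y = \<i> *\<^sub>C complex_of_real (-1) *\<^sub>C y" by (simp only: scaleC_scaleC) simp
    then show ?thesis unfolding scaleC_of_real by (simp add: scaleC_linear)
  qed
  ultimately have Dz: "D z = Some (w - \<i> *\<^sub>C u)" by (simp add: z_def)
  have "\<i> *\<^sub>C \<i> *\<^sub>C x = - x" using arg_cong[OF imag_sq, of "\<lambda>X. X \<cdot> x"] by simp
  then have "w - \<i> *\<^sub>C u + \<i> *\<^sub>C z = x + w" by (simp add: z_def scaleC_linear)
  with resolvent_bound(1)[OF D Dz] have "norm z \<le> norm (x + w)" by (simp only:)
  then show n: "norm x \<le> norm (x + w)" "norm u \<le> norm (x + w)"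
    using resolvent_bound(2,4)[OF D u] unfolding z_def by linarith+
  show "norm w \<le> 2 * norm (x + w)" using n(1) norm_triangle_ineq4[of "x + w" x] by simp
qed

lemma selfadj_regular_diff:
  assumes D: "self_adjoint_regular ip act D" and "D x = Some u" "D y = Some v"
  shows "D (x - y) = Some (u - v)"
proof -
  note d = selfadj_regularD[OF D]
  have "D (x + complex_of_real (-1) *\<^sub>C y) = Some (u + complex_of_real (-1) *\<^sub>C v)" by (intro d(2,3) assms)
  then show ?thesis unfolding scaleC_of_real by simp
qed

lemma selfadj_regular_closed:
  assumes D: "self_adjoint_regular ip act D" and "\<And>n. D (X n) = Some (U n)" "X \<longlonglongrightarrow> x" "U \<longlonglongrightarrow> u"
  shows "D x = Some u"
proof -
  have "(x, u) \<in> Map.graph D"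
  proof (rule closed_sequentially[OF selfadj_regularD(5)[OF D]])
    show "(X n, U n) \<in> Map.graph D" for n using assms(2) by (simp add: Map.graph_def)
    show "(\<lambda>n. (X n, U n)) \<longlonglongrightarrow> (x, u)" by (intro tendsto_Pair assms)
  qed
  then show ?thesis by (simp add: Map.graph_def)
qed

text \<open>The range is dense by regularity; it is closed because the preceding bounds turn convergence of
  \<open>x + D\<^sup>2 x\<close> into convergence of \<open>x\<close>, \<open>D x\<close> and \<open>D\<^sup>2 x\<close>, to which closedness of \<open>D\<close> applies.\<close>

lemma one_plus_square_surj:
  assumes D: "self_adjoint_regular ip act D"
  shows "\<exists>x u w. D x = Some u \<and> D u = Some w \<and> y = x + w"
proof -
  note d = selfadj_regularD[OF D]
  have "y \<in> closure (ran (Some +\<^sub>o (D \<circ>\<^sub>m D)))" using d(7) by simp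
  then obtain Y where Y: "\<And>n. Y n \<in> ran (Some +\<^sub>o (D \<circ>\<^sub>m D))" "Y \<longlonglongrightarrow> y"
    unfolding closure_sequential by blast
  have "\<exists>x u w. D x = Some u \<and> D u = Some w \<and> Y n = x + w" for n
    using Y(1)[of n] by (auto simp: ran_def op_add_Some map_comp_Some_iff)
  then obtain X U W where XUW: "\<And>n. D (X n) = Some (U n)" "\<And>n. D (U n) = Some (W n)" "\<And>n. Y n = X n + W n"
    by metis
  have diff: "D (X m - X n) = Some (U m - U n)" "D (U m - U n) = Some (W m - W n)" for m n
    by (intro selfadj_regular_diff[OF D] XUW)+
  have bd: "norm (X m - X n) \<le> 2 * norm (Y m - Y n)" "norm (U m - U n) \<le> 2 * norm (Y m - Y n)"
    "norm (W m - W n) \<le> 2 * norm (Y m - Y n)" for m n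
  proof -
    have "Y m - Y n = (X m - X n) + (W m - W n)" by (simp add: XUW(3))
    then show "norm (X m - X n) \<le> 2 * norm (Y m - Y n)" "norm (U m - U n) \<le> 2 * norm (Y m - Y n)"
      "norm (W m - W n) \<le> 2 * norm (Y m - Y n)"
      using one_plus_square_bound[OF D diff[of m n]] norm_ge_zero[of "Y m - Y n"] by (auto simp del: norm_ge_zero)
  qed
  have conv: "convergent Z" if "\<And>m n. norm (Z m - Z n) \<le> 2 * norm (Y m - Y n)" for Z :: "nat \<Rightarrow> 'e"
  proof (rule Cauchy_convergent, rule metric_CauchyI)
    fix e :: real assume "e > 0"
    then obtain N where N: "\<And>m n. m \<ge> N \<Longrightarrow> n \<ge> N \<Longrightarrow> dist (Y m) (Y n) < e / 2"
      using metric_CauchyD[OF LIMSEQ_imp_Cauchy[OF Y(2)], of "e / 2"] by auto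
    have "dist (Z m) (Z n) < e" if "m \<ge> N" "n \<ge> N" for m n
      using N[OF that] \<open>norm (Z m - Z n) \<le> 2 * norm (Y m - Y n)\<close> by (simp add: dist_norm)
    then show "\<exists>M. \<forall>m\<ge>M. \<forall>n\<ge>M. dist (Z m) (Z n) < e" by blast
  qed
  obtain x where x: "X \<longlonglongrightarrow> x" using conv[OF bd(1)] by (auto simp: convergent_def)
  obtain u where u: "U \<longlonglongrightarrow> u" using conv[OF bd(2)] by (auto simp: convergent_def)
  obtain w where w: "W \<longlonglongrightarrow> w" using conv[OF bd(3)] by (auto simp: convergent_def)
  have "(\<lambda>n. X n + W n) \<longlonglongrightarrow> x + w" by (intro tendsto_add x w)
  then have "Y \<longlonglongrightarrow> x + w" by (simp add: XUW(3)[abs_def])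
  then have "y = x + w" using Y(2) LIMSEQ_unique by blast
  moreover have "D x = Some u" by (rule selfadj_regular_closed[OF D XUW(1) x u])
  moreover have "D u = Some w" by (rule selfadj_regular_closed[OF D XUW(2) u w])
  ultimately show ?thesis by blast
qed

text \<open>With \<open>a = (1 + D\<^sup>2)\<^sup>-\<^sup>1\<close> and \<open>C = D a\<close>: surjectivity of \<open>1 + D\<^sup>2\<close> makes both everywhere defined, and the
  estimates for \<open>x + D\<^sup>2 x\<close> make them contractions.\<close>

lemma resolvent_exists:
  assumes D: "self_adjoint_regular ip act D"
  obtains a C where "\<And>y. D (a \<cdot> y) = Some (C \<cdot> y)" "\<And>y. D (C \<cdot> y) = Some (y - a \<cdot> y)"
    "\<And>x u w. D x = Some u \<Longrightarrow> D u = Some w \<Longrightarrow> a \<cdot> (x + w) = x \<and> C \<cdot> (x + w) = u"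
    "norm a \<le> 1" "norm C \<le> 1"
proof -
  note d = selfadj_regularD[OF D]
  obtain x u w where xuw: "\<And>y. D (x y) = Some (u y)" "\<And>y. D (u y) = Some (w y)" "\<And>y. y = x y + w y"
    using one_plus_square_surj[OF D] by metis
  have uniq: "x (p + r) = p \<and> u (p + r) = q" if "D p = Some q" "D q = Some r" for p q r
  proof -
    let ?y = "p + r"
    have "D (x ?y - p) = Some (u ?y - q)" "D (u ?y - q) = Some (w ?y - r)"
      by (intro selfadj_regular_diff[OF D] xuw that)+
    note b = one_plus_square_bound[OF D this]
    have "(x ?y - p) + (w ?y - r) = 0" using xuw(3)[of ?y] by (simp add: algebra_simps)
    then show ?thesis using b by simp
  qed
  have add: "x (y + z) = x y + x z \<and> u (y + z) = u y + u z" for y z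
  proof -
    have "x ((x y + x z) + (w y + w z)) = x y + x z \<and> u ((x y + x z) + (w y + w z)) = u y + u z"
      by (intro uniq d(2) xuw)
    moreover have "(x y + x z) + (w y + w z) = y + z" using xuw(3)[of y] xuw(3)[of z] by (simp add: algebra_simps)
    ultimately show ?thesis by simp
  qed
  have scale: "x (c *\<^sub>R y) = c *\<^sub>R x y \<and> u (c *\<^sub>R y) = c *\<^sub>R u y" for c y
  proof -
    have "x (complex_of_real c *\<^sub>C x y + complex_of_real c *\<^sub>C w y) = complex_of_real c *\<^sub>C x y \<and>
        u (complex_of_real c *\<^sub>C x y + complex_of_real c *\<^sub>C w y) = complex_of_real c *\<^sub>C u y"
      by (intro uniq d(3) xuw)
    moreover have "c *\<^sub>R x y + c *\<^sub>R w y = c *\<^sub>R y" using xuw(3)[of y] by (metis scaleR_add_right)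
    ultimately show ?thesis by (simp add: scaleC_of_real)
  qed
  have bx: "norm (x y) \<le> norm y * 1" and bu: "norm (u y) \<le> norm y * 1" for y
    using one_plus_square_bound(1,2)[OF D xuw(1,2)] xuw(3)[of y] by (metis mult.right_neutral)+
  have blx: "bounded_linear x" and blu: "bounded_linear u"
    using add scale bx bu by (auto intro!: bounded_linear_intro[where K = 1])
  show thesis
  proof (rule that[of "Endo x" "Endo u"])
    show "D (Endo x \<cdot> y) = Some (Endo u \<cdot> y)" "D (Endo u \<cdot> y) = Some (y - Endo x \<cdot> y)" for y
      using xuw(1)[of y] xuw(2)[of y] xuw(3)[of y] by (simp_all add: app_Endo blx blu) (metis add_diff_cancel_left')
    show "Endo x \<cdot> (p + r) = p \<and> Endo u \<cdot> (p + r) = q" if "D p = Some q" "D q = Some r" for p q r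
      using uniq[OF that] by (simp only: app_Endo[OF blx] app_Endo[OF blu])
    show "norm (Endo x) \<le> 1" "norm (Endo u) \<le> 1"
      by (rule norm_endo_bound; use bx bu in \<open>simp add: app_Endo blx blu\<close>)+
  qed
qed

text \<open>\<open>2 a - 1\<close> and \<open>2 C\<close> are the real and imaginary part of the Cayley transform of \<open>D\<close>.\<close>

lemma resolvent_spec_in:
  assumes a: "selfadj a" and C: "selfadj C" and aC: "a * C = C * a" and sq: "C * C = a - a * a"
  shows "spec_in 1 a"
  unfolding spec_in_def
proof (intro conjI allI impI a)
  fix p :: "real poly" and M assume M: "\<forall>t\<in>{0..1}. \<bar>poly p t\<bar> \<le> M"
  have "norm (peval (pcompose p [:1/2, 1/2:]) (2 *\<^sub>R a - 1)) \<le> M"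
  proof (rule peval_bound_symmetric)
    show "selfadj (2 *\<^sub>R a - 1)" "selfadj (2 *\<^sub>R C)" by (intro adj_intros a C)+
    show "(2 *\<^sub>R a - 1) * (2 *\<^sub>R C) = (2 *\<^sub>R C) * (2 *\<^sub>R a - 1)" by (simp add: algebra_simps aC)
    have "(2 *\<^sub>R a - 1) * (2 *\<^sub>R a - 1) = 4 *\<^sub>R (a * a) - 4 *\<^sub>R a + 1"
      by (simp add: algebra_simps flip: scaleR_add_left)
    then show "(2 *\<^sub>R a - 1) * (2 *\<^sub>R a - 1) + (2 *\<^sub>R C) * (2 *\<^sub>R C) = 1"
      by (simp add: sq scaleR_diff_right)
    show "\<bar>poly (pcompose p [:1 / 2, 1 / 2:]) t\<bar> \<le> M" if "\<bar>t\<bar> \<le> 1" for t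
      using that M[rule_format, of "1/2 + t/2"] by (simp add: poly_pcompose abs_le_iff)
  qed
  then show "norm (peval p a) \<le> M"
    by (simp add: peval_pcompose peval_pCons scaleR_diff_right flip: scaleR_add_left)
qed simp

text \<open>Here \<open>b = \<langle>D\<rangle>\<^sup>-\<^sup>1\<close> is the square root of the resolvent \<open>a\<close>, and \<open>F = D b\<close> is found as the factor in
  \<open>F b = C\<close>, which exists since \<open>C\<^sup>2 = b (1 - a) b\<close>. The factorization and the identities for \<open>F\<close> rest on
  the density of \<open>ran a = dom D\<^sup>2\<close>, which follows from that of \<open>dom D\<close> by the cutoffs \<open>(1 - a) ^ n\<close>.\<close>

lemma bounded_transform_exists:
  assumes D: "self_adjoint_regular ip act D"
  obtains b F where "positive b" "norm b \<le> 1" "dense_range b" "selfadj F" "b * F = F * b"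
    "F * F = 1 - b * b" "\<And>y. D (b \<cdot> y) = Some (F \<cdot> y)" "dom D = range (app b)"
    "\<And>x y. (Some +\<^sub>o (D \<circ>\<^sub>m D)) x = Some y \<longleftrightarrow> x = (b * b) \<cdot> y"
    "b = fcal (norm (b * b)) (\<lambda>t. t powr (1/2)) (b * b)"
proof -
  note d = selfadj_regularD[OF D]
  obtain a C where Da: "\<And>y. D (a \<cdot> y) = Some (C \<cdot> y)" and DC: "\<And>y. D (C \<cdot> y) = Some (y - a \<cdot> y)"
    and uniq: "\<And>x u w. D x = Some u \<Longrightarrow> D u = Some w \<Longrightarrow> a \<cdot> (x + w) = x \<and> C \<cdot> (x + w) = u"
    and na: "norm a \<le> 1" and nC: "norm C \<le> 1" using resolvent_exists[OF D] by blast
  have half: "ip (a \<cdot> y) z = ip (a \<cdot> y) (a \<cdot> z) + ip (C \<cdot> y) (C \<cdot> z)" for y z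
    using d(6)[OF Da[of y] DC[of z]] by simp
  have half': "ip y (a \<cdot> z) = ip (a \<cdot> y) (a \<cdot> z) + ip (C \<cdot> y) (C \<cdot> z)" for y z
    using d(6)[OF DC[of y] Da[of z]] by (simp add: diff_eq_eq add.commute)
  have a: "selfadj a" unfolding adj_def by (intro allI trans[OF half half'[symmetric]])
  have C: "selfadj C" unfolding adj_def
  proof (intro allI)
    fix y z
    have "ip (C \<cdot> y) (z - a \<cdot> z) = ip (y - a \<cdot> y) (C \<cdot> z)" using d(6)[OF DC[of y] DC[of z]] by simp
    moreover have "ip (C \<cdot> y) (a \<cdot> z) = ip (a \<cdot> y) (C \<cdot> z)" using d(6)[OF Da[of y] Da[of z]] by simp
    ultimately show "ip (C \<cdot> y) z = ip y (C \<cdot> z)" by (simp add: algebra_simps)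
  qed
  \<comment> \<open>\<open>a D \<subseteq> D a = C\<close> and \<open>C D \<subseteq> 1 - a\<close>\<close>
  have onD: "a \<cdot> u = C \<cdot> x \<and> C \<cdot> u = x - a \<cdot> x" if "D x = Some u" for x u
  proof -
    have "D (x - a \<cdot> x) = Some (u - C \<cdot> x)" by (intro selfadj_regular_diff[OF D] that Da)
    from uniq[OF DC this] show ?thesis by simp
  qed
  have aC: "a * C = C * a" by (rule endo_eqI) (use onD[OF Da] in simp)
  have CC: "C * C = a - a * a" by (rule endo_eqI) (use onD[OF Da] in simp)
  have s1: "spec_in 1 a" by (rule resolvent_spec_in[OF a C aC CC])
  have csqrt: "continuous_on {0..1} (\<lambda>t::real. t powr (1/2))" by (rule continuous_on_powr_const) simp
  define b where "b = fcal 1 (\<lambda>t. t powr (1/2)) a"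
  have b: "selfadj b" unfolding b_def by (rule fcal_selfadj[OF s1 csqrt])
  have "b * b = fcal 1 (\<lambda>t. t powr (1/2) * t powr (1/2)) a"
    unfolding b_def by (rule fcal_mult[OF s1 csqrt csqrt, symmetric])
  also have "\<dots> = peval [:0, 1:] a"
    by (rule fcal_poly[OF s1]) (simp flip: powr_add)
  finally have bb: "b * b = a" by (simp add: peval_pCons)
  have pb: "positive b" unfolding b_def by (rule fcal_spec_in[OF s1 csqrt]) simp
  have nb: "norm b \<le> 1" unfolding b_def by (rule fcal_norm[OF s1 csqrt]) (auto intro: powr_le1)
  have pa: "positive a" using spec_in_square[OF b] by (simp add: bb)
  have ba: "b = fcal (norm a) (\<lambda>t. t powr (1/2)) a"
    unfolding b_def by (rule fcal_restrict[OF s1 pa na csqrt, symmetric])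
  have bC: "b * C = C * b" unfolding b_def by (rule fcal_commute[OF s1 csqrt aC])
  \<comment> \<open>\<open>(1 - a)\<^sup>n\<close> tends to zero on \<open>dom D \<subseteq> ran a + ran C\<close>, and \<open>1 - (1 - a)\<^sup>n\<close> maps into \<open>ran a\<close>\<close>
  have lim_a: "(\<lambda>n. (1 - a) ^ n * a) \<longlonglongrightarrow> 0"
  proof -
    have "(1 - a) ^ n * a = a * (1 - a) ^ n" for n by (rule power_intertwine) (simp add: algebra_simps)
    then show ?thesis using cutoff_limit[OF pa na, of 1] by (simp add: pw_1[OF pa])
  qed
  have lim_C: "(\<lambda>n. (1 - a) ^ n * C) \<longlonglongrightarrow> 0"
  proof -
    have com: "(1 - a) ^ n * C = C * (1 - a) ^ n" "(1 - a) ^ n * (1 - a) = (1 - a) * (1 - a) ^ n" for n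
      by (rule power_intertwine, simp add: algebra_simps aC)+
    have bound: "(norm ((1 - a) ^ n * C))\<^sup>2 \<le> norm ((1 - a) ^ n * a) * 2" for n
    proof -
      have "adj ((1 - a) ^ n * C) (C * (1 - a) ^ n)" by (intro adj_intros a C)
      then have "selfadj ((1 - a) ^ n * C)" by (simp add: com)
      then have "(norm ((1 - a) ^ n * C))\<^sup>2 \<le> norm ((1 - a) ^ n * C * ((1 - a) ^ n * C))"
        by (rule selfadj_norm_sq)
      also have "(1 - a) ^ n * C * ((1 - a) ^ n * C) = (1 - a) ^ n * (C * C) * (1 - a) ^ n"
        by (subst (2) com(1)) (simp only: mult.assoc)
      also have "C * C = a * (1 - a)" by (simp add: CC algebra_simps)
      also have "norm ((1 - a) ^ n * (a * (1 - a)) * (1 - a) ^ n) \<le> norm ((1 - a) ^ n * a) * norm ((1 - a) * (1 - a) ^ n)"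
        using norm_mult_ineq[of "(1 - a) ^ n * a" "(1 - a) * (1 - a) ^ n"] by (simp only: mult.assoc)
      also have "\<dots> \<le> norm ((1 - a) ^ n * a) * 2"
        using cutoff_norm[OF pa na, of "Suc n"] by (intro mult_left_mono) auto
      finally show ?thesis .
    qed
    have "(\<lambda>n. norm ((1 - a) ^ n * a) * 2) \<longlonglongrightarrow> norm (0::'e endo) * 2"
      by (intro tendsto_mult tendsto_norm lim_a tendsto_const)
    then have "(\<lambda>n. norm ((1 - a) ^ n * a) * 2) \<longlonglongrightarrow> 0" by simp
    then have "(\<lambda>n. (norm ((1 - a) ^ n * C))\<^sup>2) \<longlonglongrightarrow> 0"
      by (rule Lim_null_comparison[rotated]) (use bound in auto)
    then have "(\<lambda>n. sqrt ((norm ((1 - a) ^ n * C))\<^sup>2)) \<longlonglongrightarrow> sqrt 0" by (rule tendsto_real_sqrt)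
    then show ?thesis by (simp add: tendsto_norm_zero_iff)
  qed
  have "dom D \<subseteq> closure (range (app a))"
  proof
    fix x assume "x \<in> dom D"
    then obtain u where u: "D x = Some u" by blast
    have x: "x = a \<cdot> x + C \<cdot> u" using onD[OF u] by simp
    have "(\<lambda>n. ((1 - a) ^ n * a) \<cdot> x + ((1 - a) ^ n * C) \<cdot> u) \<longlonglongrightarrow> 0 \<cdot> x + 0 \<cdot> u"
      by (intro tendsto_add tendsto_app lim_a lim_C tendsto_const)
    moreover have "((1 - a) ^ n * a) \<cdot> x + ((1 - a) ^ n * C) \<cdot> u = (1 - a) ^ n \<cdot> x" for n
    proof -
      have "(1 - a) ^ n \<cdot> x = (1 - a) ^ n \<cdot> (a \<cdot> x + C \<cdot> u)" by (simp only: x[symmetric])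
      then show ?thesis by (simp only: app_linear app_simps)
    qed
    ultimately have "(\<lambda>n. (1 - a) ^ n \<cdot> x) \<longlonglongrightarrow> 0 \<cdot> x + 0 \<cdot> u" by (simp only:)
    then have "(\<lambda>n. (1 - a) ^ n \<cdot> x) \<longlonglongrightarrow> 0" by simp
    then have lim: "(\<lambda>n. x - (1 - a) ^ n \<cdot> x) \<longlonglongrightarrow> x - 0" by (intro tendsto_diff tendsto_const)
    have "x - (1 - a) ^ n \<cdot> x \<in> range (app a)" for n
    proof -
      obtain p where "1 - (1 - a) ^ n = a * peval p a" using one_minus_power by blast
      then have "(1 - (1 - a) ^ n) \<cdot> x = (a * peval p a) \<cdot> x" by (simp only:)
      then have "x - (1 - a) ^ n \<cdot> x = a \<cdot> peval p a \<cdot> x" by (simp only: app_simps)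
      then show ?thesis by (simp only: rangeI)
    qed
    then show "x \<in> closure (range (app a))"
      unfolding closure_sequential using lim by (intro exI[of _ "\<lambda>n. x - (1 - a) ^ n \<cdot> x"]) auto
  qed
  then have "closure (dom D) \<subseteq> closure (range (app a))" by (rule closure_minimal) simp
  then have da: "dense_range a" using d(4) by auto
  have db: "dense_range b" by (rule dense_range_mult[of b b]) (simp add: bb da)
  have "norm (C \<cdot> z) \<le> sqrt 6 * norm (b \<cdot> z)" for z
  proof (rule power2_le_imp_le)
    have "(norm (C \<cdot> z))\<^sup>2 = norm (ip z ((C * C) \<cdot> z))" by (simp flip: norm_ip_self add: adjD[OF C])
    also have "C * C = b * (1 - a) * b"
    proof -
      have "b * (1 - b * b) * b = b * b - (b * b) * (b * b)" by (simp add: algebra_simps)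
      then show ?thesis by (simp add: bb CC)
    qed
    also have "norm (ip z ((b * (1 - a) * b) \<cdot> z)) = norm (ip (b \<cdot> z) ((1 - a) \<cdot> b \<cdot> z))"
      by (simp add: adjD[OF b])
    also have "\<dots> \<le> 3 * norm (b \<cdot> z) * norm ((1 - a) \<cdot> b \<cdot> z)" by (rule cauchy_schwarz)
    also have "\<dots> \<le> 3 * norm (b \<cdot> z) * (2 * norm (b \<cdot> z))"
    proof (intro mult_left_mono)
      have "norm (1 - a) \<le> 1" using cutoff_norm[OF pa na, of 1] by simp
      then have "norm (1 - a) * norm (b \<cdot> z) \<le> 2 * norm (b \<cdot> z)" by (intro mult_right_mono) auto
      then show "norm ((1 - a) \<cdot> b \<cdot> z) \<le> 2 * norm (b \<cdot> z)" by (rule order_trans[OF norm_app])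
    qed simp
    also have "\<dots> = (sqrt 6 * norm (b \<cdot> z))\<^sup>2" by (simp add: power2_eq_square)
    finally show "(norm (C \<cdot> z))\<^sup>2 \<le> (sqrt 6 * norm (b \<cdot> z))\<^sup>2" .
  qed simp
  then obtain F where F: "F * b = C" using endo_factor[OF db, of "sqrt 6" C] by (metis real_sqrt_ge_zero zero_le_numeral)
  have "(b * F) * b = (F * b) * b" by (simp only: mult.assoc F bC)
  then have bF: "b * F = F * b" by (rule dense_range_cancel[OF db])
  have "ip (F \<cdot> v) (b \<cdot> z) = ip v (C \<cdot> z)" for v z
  proof -
    have "ip (F \<cdot> v) (b \<cdot> z) = ip ((b * F) \<cdot> v) z" by (simp add: adjD[OF b])
    then show ?thesis unfolding bF F by (simp add: adjD[OF C])
  qed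
  then obtain F' where F': "adj F F'" "F' * b = C" using adjointable_of_dense[OF db] by blast
  have "F' = F" by (rule dense_range_cancel[OF db]) (simp add: F' F)
  then have sF: "selfadj F" using F' by simp
  have "(F * F) * a = (1 - a) * a"
  proof -
    have "(F * F) * a = F * (F * b) * b" by (simp only: bb[symmetric] mult.assoc)
    also have "\<dots> = F * (b * C)" by (simp only: F mult.assoc bC)
    also have "\<dots> = C * C" by (simp only: F flip: mult.assoc)
    finally show ?thesis by (simp add: CC algebra_simps)
  qed
  then have FF: "F * F = 1 - a" by (rule dense_range_cancel[OF da])
  have Db: "D (b \<cdot> y) = Some (F \<cdot> y)" for y
  proof -
    have "y \<in> closure (range (app b))" using db by simp
    then obtain Y where "\<And>n. Y n \<in> range (app b)" and Y: "Y \<longlonglongrightarrow> y" unfolding closure_sequential by blast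
    then have "\<exists>z. Y n = b \<cdot> z" for n by blast
    then obtain z where z: "\<And>n. Y n = b \<cdot> z n" by metis
    show ?thesis
    proof (rule selfadj_regular_closed[OF D])
      show "D (b \<cdot> Y n) = Some (F \<cdot> Y n)" for n
        using Da[of "z n"] unfolding z F[symmetric] bb[symmetric] by simp
      show "(\<lambda>n. b \<cdot> Y n) \<longlonglongrightarrow> b \<cdot> y" "(\<lambda>n. F \<cdot> Y n) \<longlonglongrightarrow> F \<cdot> y"
        by (intro tendsto_app tendsto_const Y)+
    qed
  qed
  have dom: "dom D = range (app b)"
  proof
    show "range (app b) \<subseteq> dom D" using Db by auto
    show "dom D \<subseteq> range (app b)"
    proof
      fix x assume "x \<in> dom D"
      then obtain u where u: "D x = Some u" by blast
      have "b \<cdot> (b \<cdot> x + F \<cdot> u) = (b * b) \<cdot> x + (b * F) \<cdot> u" by simp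
      also have "\<dots> = x" unfolding bb bF F using onD[OF u] by simp
      finally show "x \<in> range (app b)" by (metis rangeI)
    qed
  qed
  have inv: "(Some +\<^sub>o (D \<circ>\<^sub>m D)) x = Some y \<longleftrightarrow> x = (b * b) \<cdot> y" for x y
    unfolding bb using Da[of y] DC[of y] uniq
    by (auto simp: op_add_Some map_comp_Some_iff)
  show thesis
  proof (rule that[of b F])
    show "b = fcal (norm (b * b)) (\<lambda>t. t powr (1/2)) (b * b)" unfolding bb by (rule ba)
    show "F * F = 1 - b * b" unfolding bb by (rule FF)
  qed (fact pb nb db sF bF Db dom inv)+
qed

section \<open>Operators respecting the scale of a positive operator\<close>

lemma adj_swap: "A * B = C * D \<Longrightarrow> adj A A' \<Longrightarrow> adj B B' \<Longrightarrow> adj C C' \<Longrightarrow> adj D D' \<Longrightarrow> B' * A' = D' * C'"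
  by (metis adj_mult adj_unique)

text \<open>For \<open>r = \<langle>D\<rangle>\<^sup>-\<^sup>1\<^sup>/\<^sup>2\<close>: \<open>preserves r A\<close> holds if \<open>A\<close> and its adjoint leave \<open>dom \<langle>D\<rangle>\<^sup>1\<^sup>/\<^sup>2\<close>
  invariant, and \<open>smoothing r K\<close> if \<open>\<langle>D\<rangle>\<^sup>1\<^sup>/\<^sup>2 K \<langle>D\<rangle>\<^sup>1\<^sup>/\<^sup>2\<close> is bounded. The smoothing operators form a
  two-sided ideal among the preserving ones, and the algebra of the proof is done modulo this ideal.\<close>

definition preserves :: "'e endo \<Rightarrow> 'e endo \<Rightarrow> bool" where
  "preserves r A \<longleftrightarrow> (\<exists>P P' Q Q'. adj P P' \<and> adj Q Q' \<and> A * r = r * P \<and> r * A = Q * r)"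

definition smoothing :: "'e endo \<Rightarrow> 'e endo \<Rightarrow> bool" where
  "smoothing r K \<longleftrightarrow> (\<exists>k k'. adj k k' \<and> K = r * k * r)"

lemma preservesE:
  assumes "preserves r A"
  obtains P P' Q Q' where "adj P P'" "adj Q Q'" "A * r = r * P" "r * A = Q * r"
  using assms unfolding preserves_def by blast

lemma preserves_commute: "adj A A' \<Longrightarrow> A * r = r * A \<Longrightarrow> preserves r A"
  unfolding preserves_def by metis

lemma preserves_mult:
  assumes "preserves r A" "preserves r B" shows "preserves r (A * B)"
proof -
  obtain P P' Q Q' where A: "adj P P'" "adj Q Q'" "A * r = r * P" "r * A = Q * r"
    using assms(1) by (rule preservesE)
  obtain R R' S S' where B: "adj R R'" "adj S S'" "B * r = r * R" "r * B = S * r"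
    using assms(2) by (rule preservesE)
  have "A * B * r = (A * r) * R" by (simp only: mult.assoc B(3))
  then have 1: "A * B * r = r * (P * R)" by (simp only: A(3) mult.assoc)
  have "r * (A * B) = Q * (r * B)" by (simp only: A(4) flip: mult.assoc)
  then have 2: "r * (A * B) = (Q * S) * r" by (simp only: B(4) mult.assoc)
  show ?thesis unfolding preserves_def using 1 2 adj_mult[OF A(1) B(1)] adj_mult[OF A(2) B(2)] by blast
qed

lemma preserves_diff:
  assumes "preserves r A" "preserves r B" shows "preserves r (A - B)"
proof -
  obtain P P' Q Q' where A: "adj P P'" "adj Q Q'" "A * r = r * P" "r * A = Q * r"
    using assms(1) by (rule preservesE)
  obtain R R' S S' where B: "adj R R'" "adj S S'" "B * r = r * R" "r * B = S * r"
    using assms(2) by (rule preservesE)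
  have "(A - B) * r = r * (P - R)" "r * (A - B) = (Q - S) * r"
    using A B by (simp_all add: left_diff_distrib right_diff_distrib)
  then show ?thesis unfolding preserves_def using adj_diff[OF A(1) B(1)] adj_diff[OF A(2) B(2)] by blast
qed

lemma smoothing_diff: "smoothing r K \<Longrightarrow> smoothing r L \<Longrightarrow> smoothing r (K - L)"
proof -
  assume "smoothing r K" "smoothing r L"
  then obtain k k' l l' where "adj k k'" "K = r * k * r" "adj l l'" "L = r * l * r"
    unfolding smoothing_def by blast
  moreover from this have "K - L = r * (k - l) * r" by (simp add: left_diff_distrib right_diff_distrib)
  ultimately show ?thesis unfolding smoothing_def using adj_diff by blast
qed

lemma smoothing_add: "smoothing r K \<Longrightarrow> smoothing r L \<Longrightarrow> smoothing r (K + L)"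
proof -
  assume "smoothing r K" "smoothing r L"
  then obtain k k' l l' where "adj k k'" "K = r * k * r" "adj l l'" "L = r * l * r"
    unfolding smoothing_def by blast
  moreover from this have "K + L = r * (k + l) * r" by (simp add: distrib_left distrib_right)
  ultimately show ?thesis unfolding smoothing_def using adj_add by blast
qed

lemma smoothing_scaleR: "smoothing r K \<Longrightarrow> smoothing r (c *\<^sub>R K)"
proof -
  assume "smoothing r K"
  then obtain k k' where "adj k k'" "K = r * k * r" unfolding smoothing_def by blast
  moreover from this have "c *\<^sub>R K = r * (c *\<^sub>R k) * r" by simp
  ultimately show ?thesis unfolding smoothing_def using adj_scaleR by blast
qed

lemma smoothing_mult_left:
  assumes "preserves r A" "smoothing r K" shows "smoothing r (A * K)"
proof -
  obtain P P' Q Q' where A: "adj P P'" "adj Q Q'" "A * r = r * P" "r * A = Q * r"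
    using assms(1) by (rule preservesE)
  obtain k k' where k: "adj k k'" "K = r * k * r" using assms(2) unfolding smoothing_def by blast
  have "A * K = (A * r) * (k * r)" by (simp only: k mult.assoc)
  then have "A * K = r * (P * k) * r" by (simp only: A(3) mult.assoc)
  then show ?thesis unfolding smoothing_def using adj_mult[OF A(1) k(1)] by blast
qed

lemma smoothing_mult_right:
  assumes "smoothing r K" "preserves r A" shows "smoothing r (K * A)"
proof -
  obtain P P' Q Q' where A: "adj P P'" "adj Q Q'" "A * r = r * P" "r * A = Q * r"
    using assms(2) by (rule preservesE)
  obtain k k' where k: "adj k k'" "K = r * k * r" using assms(1) unfolding smoothing_def by blast
  have "K * A = r * k * (r * A)" by (simp only: k mult.assoc)
  then have "K * A = r * (k * Q) * r" by (simp only: A(4) mult.assoc)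
  then show ?thesis unfolding smoothing_def using adj_mult[OF k(1) A(2)] by blast
qed

text \<open>Correcting an approximate intertwiner \<open>1 - E\<close> of \<open>F1\<close> and \<open>F2\<close> to a unitary \<open>Z\<close>. The defect
  \<open>Y = 1 - (1 - E)(1 - E)\<^sup>*\<close> is small also on the scale, so that its inverse square root is a power
  series that again respects the scale; and \<open>Y\<close> commutes with \<open>F2\<close> modulo smoothing operators, hence so
  does the series.\<close>

lemma unitary_intertwiner:
  assumes r: "selfadj r" "dense_range r" and F: "selfadj F1" "selfadj F2"
    and E: "adj E E'" and Ep: "adj Ep Ep'" "E * r = r * Ep" and Eq: "adj Eq Eq'" "E' * r = r * Eq"
    and small: "norm E \<le> 1/16" "norm E' \<le> 1/16" "norm Ep \<le> 1/16" "norm Eq \<le> 1/16"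
    and inter: "smoothing r (F2 * (1 - E) - (1 - E) * F1)"
  obtains Z Z' Zp Zp' Zq Zq' k k' L L' where
    "adj Z Z'" "Z * Z' = 1" "Z' * Z = 1" "adj Zp Zp'" "adj Zq Zq'" "Z * r = r * Zp" "Z' * r = r * Zq"
    "adj k k'" "F2 * Z - Z * F1 = r * k * r"
    "adj L L'" "Z = (1 + L * (E + E' - E * E')) * (1 - E)" "Z' = (1 - E') * (1 + L * (E + E' - E * E'))"
proof -
  obtain k k' where k: "adj k k'" "F2 * (1 - E) - (1 - E) * F1 = r * k * r"
    using inter unfolding smoothing_def by blast
  define Y where "Y = E + E' - E * E'"
  define Yp where "Yp = Ep + Eq - Ep * Eq"
  define Yp' where "Yp' = Ep' + Eq' - Eq' * Ep'"
  have sY: "selfadj Y" unfolding Y_def using adj_diff[OF adj_add[OF E adj_sym[OF E]] adj_mult[OF E adj_sym[OF E]]]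
    by (simp add: add.commute)
  have aYp: "adj Yp Yp'" unfolding Yp_def Yp'_def by (intro adj_intros Ep Eq)
  have nest: "norm (A + B - A * B) \<le> 1/4" if "norm A \<le> 1/16" "norm B \<le> 1/16" for A B :: "'e endo"
  proof -
    have "norm (A * B) \<le> (1/16) * (1/16)"
      by (rule order_trans[OF norm_mult_ineq]) (intro mult_mono that, auto)
    then show ?thesis
      using norm_triangle_ineq4[of "A + B" "A * B"] norm_triangle_ineq[of A B] that by simp
  qed
  have nY: "norm Y \<le> 1/4" and nYp: "norm Yp \<le> 1/4"
    unfolding Y_def Yp_def by (intro nest small)+
  then have nYp': "norm Yp' \<le> 3/4" using adj_norm[OF aYp] by simp
  have Y1: "norm Y < 1" "norm Yp < 1" "norm Yp' < 1" using nY nYp nYp' by auto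
  have Yr: "Y * r = r * Yp"
  proof -
    have "E * E' * r = r * (Ep * Eq)" by (simp only: mult.assoc Eq(2)) (simp only: Ep(2) flip: mult.assoc)
    then show ?thesis by (simp add: Y_def Yp_def distrib_left distrib_right left_diff_distrib right_diff_distrib Ep Eq)
  qed
  have rY: "r * Y = Yp' * r" by (rule adj_swap[OF Yr sY r(1) r(1) aYp])
  have rE': "r * E' = Ep' * r" by (rule adj_swap[OF Ep(2) E r(1) r(1) Ep(1)])
  have rE: "r * E = Eq' * r" by (rule adj_swap[OF Eq(2) adj_sym[OF E] r(1) r(1) Eq(1)])
  define Z0 where "Z0 = 1 - E"
  define Z0' where "Z0' = 1 - E'"
  have aZ0: "adj Z0 Z0'" unfolding Z0_def Z0'_def by (intro adj_intros E)
  have ZZ0: "Z0 * Z0' = 1 - Y" by (simp add: Z0_def Z0'_def Y_def algebra_simps)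
  have Z0r: "Z0 * r = r * (1 - Ep)" "Z0' * r = r * (1 - Eq)" "r * Z0 = (1 - Eq') * r" "r * Z0' = (1 - Ep') * r"
    by (simp_all add: Z0_def Z0'_def left_diff_distrib right_diff_distrib Ep Eq rE rE')
  have i1: "F2 * Z0 = Z0 * F1 + r * k * r" using k(2) by (simp add: Z0_def diff_eq_eq add.commute)
  have i2: "Z0' * F2 = F1 * Z0' + r * k' * r"
  proof -
    have "adj (F2 * Z0) (Z0' * F2)" by (intro adj_intros aZ0 F)
    moreover have "adj (Z0 * F1 + r * k * r) (F1 * Z0' + r * (k' * r))" by (intro adj_intros aZ0 F r k)
    ultimately show ?thesis unfolding i1 by (simp add: adj_unique mult.assoc)
  qed
  define c where "c = (1 - Ep) * k' - k * (1 - Ep')"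
  have ac: "adj c (k * (1 - Ep') - (1 - Ep) * k')" unfolding c_def
    by (intro adj_intros adj_sym[OF k(1)] k(1) Ep(1) adj_sym[OF Ep(1)])
  have comm: "F2 * Y - Y * F2 = r * c * r"
  proof -
    have "F2 * Y - Y * F2 = Z0 * Z0' * F2 - F2 * (Z0 * Z0')" unfolding ZZ0 by (simp add: algebra_simps)
    also have "\<dots> = Z0 * (Z0' * F2) - (F2 * Z0) * Z0'" by (simp only: mult.assoc)
    also have "\<dots> = (Z0 * r) * k' * r - r * k * (r * Z0')"
      unfolding i1 i2 by (simp add: distrib_left distrib_right mult.assoc)
    also have "\<dots> = r * c * r" unfolding Z0r c_def by (simp only: left_diff_distrib right_diff_distrib mult.assoc)
    finally show ?thesis .
  qed
  define Q where "Q = isq Y"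
  define Qp where "Qp = isq Yp"
  have sQ: "selfadj Q" unfolding Q_def by (rule isq_selfadj[OF Y1(1) sY])
  obtain Qp' where aQp: "adj Qp Qp'" unfolding Qp_def using isq_adjointable[OF Y1(2) aYp] by blast
  have Qr: "Q * r = r * Qp" unfolding Q_def Qp_def by (rule isq_intertwine[OF Y1(1,2) Yr])
  have QY: "Q * (1 - Y) = (1 - Y) * Q" unfolding Q_def by (rule isq_intertwine) (simp_all add: Y1 algebra_simps isq_intertwine[OF Y1(1) Y1(1) refl])
  obtain K K' where K: "F2 * Q - Q * F2 = r * K * r" "adj K K'"
    unfolding Q_def using isq_commutator[OF comm Yr rY Y1 ac aYp adj_sym[OF aYp]] by blast
  obtain L L' where L: "Q = 1 + L * Y" "adj L L'" unfolding Q_def using isq_tail[OF Y1(1) sY] by blast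
  define Z where "Z = Q * Z0"
  define Z' where "Z' = Z0' * Q"
  have aZ: "adj Z Z'" unfolding Z_def Z'_def by (intro adj_mult sQ aZ0)
  have ZZ': "Z * Z' = 1"
  proof -
    have "Z * Z' = Q * ((Z0 * Z0') * Q)" by (simp only: Z_def Z'_def mult.assoc)
    also have "\<dots> = Q * Q * (1 - Y)" unfolding ZZ0 QY[symmetric] by (simp only: mult.assoc)
    finally show ?thesis unfolding Q_def by (simp only: isq_sq[OF Y1(1)])
  qed
  have E1: "norm E < 1" using small by simp
  \<comment> \<open>\<open>W\<close> inverts \<open>Z\<close> from the left, so that \<open>Z Z\<^sup>* = 1\<close> makes \<open>Z\<close> unitary\<close>
  define W where "W = isq E * isq E * ((1 - Y) * Q)"
  have "W * Z = isq E * isq E * ((1 - Y) * (Q * Q)) * Z0" by (simp only: W_def Z_def mult.assoc)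
  also have "\<dots> = 1" unfolding Q_def by (simp add: isq_sq(2)[OF Y1(1)] Z0_def isq_sq(1)[OF E1])
  finally have WZ: "W * Z = 1" .
  have "W = W * (Z * Z')" by (simp add: ZZ')
  also have "\<dots> = Z'" by (simp add: WZ flip: mult.assoc)
  finally have Z'Z: "Z' * Z = 1" using WZ by simp
  have Zr: "Z * r = r * (Qp * (1 - Ep))"
    by (simp only: Z_def mult.assoc Z0r(1)) (simp only: Qr flip: mult.assoc)
  have Z'r: "Z' * r = r * ((1 - Eq) * Qp)"
    by (simp only: Z'_def mult.assoc Qr) (simp only: Z0r(2) flip: mult.assoc)
  have "F2 * Z - Z * F1 = (F2 * Q - Q * F2) * Z0 + Q * (F2 * Z0 - Z0 * F1)"
    by (simp add: Z_def left_diff_distrib right_diff_distrib mult.assoc)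
  also have "F2 * Z0 - Z0 * F1 = r * k * r" using i1 by simp
  also have "(F2 * Q - Q * F2) * Z0 = r * K * (r * Z0)" by (simp only: K mult.assoc)
  also have "\<dots> + Q * (r * k * r) = r * K * (r * Z0) + (Q * r) * (k * r)" by (simp only: mult.assoc)
  also have "\<dots> = r * (K * (1 - Eq') + Qp * k) * r"
    unfolding Z0r Qr by (simp only: distrib_left distrib_right mult.assoc)
  finally have FZ: "F2 * Z - Z * F1 = r * (K * (1 - Eq') + Qp * k) * r" .
  show thesis
  proof (rule that[OF aZ ZZ' Z'Z _ _ Zr Z'r _ FZ L(2)])
    show "adj (Qp * (1 - Ep)) ((1 - Ep') * Qp')" "adj ((1 - Eq) * Qp) (Qp' * (1 - Eq'))"
      "adj (K * (1 - Eq') + Qp * k) ((1 - Eq) * K' + k' * Qp')"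
      by (intro adj_intros aQp Ep(1) Eq(1) adj_sym[OF Eq(1)] K(2) k(1))+
    show "Z = (1 + L * (E + E' - E * E')) * (1 - E)" "Z' = (1 - E') * (1 + L * (E + E' - E * E'))"
      unfolding Z_def Z'_def L(1) Y_def Z0_def Z0'_def by (rule refl)+
  qed
qed

section \<open>The perturbation theorem for bounded transforms\<close>

text \<open>This is how equality of the domains enters. The closed graph theorem yields \<open>Y = b1\<^sup>-\<^sup>1 b2\<close>,
  self-adjointness of \<open>b1\<close> and \<open>b2\<close> its adjoint, and interpolation at exponent 1/2 the factor \<open>M\<close>.\<close>

lemma equal_range_factor:
  assumes b1: "positive b1" "dense_range b1" and b2: "positive b2" "dense_range b2"
    and ran: "range (app b2) \<subseteq> range (app b1)"
  obtains Y Y' M M' where "adj Y Y'" "b2 = b1 * Y" "adj M M'" "pw b2 (1/2) = pw b1 (1/2) * M"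
proof -
  have s: "selfadj b1" "selfadj b2" using b1 b2 by (auto simp: spec_in_def)
  obtain Y where Y: "b1 * Y = b2" using range_factor[OF selfadj_dense_inj[OF s(1) b1(2)] ran] .
  have "ip (Y \<cdot> v) (b1 \<cdot> z) = ip v (b2 \<cdot> z)" for v z
  proof -
    have "ip (Y \<cdot> v) (b1 \<cdot> z) = ip ((b1 * Y) \<cdot> v) z" by (simp add: adjD[OF s(1)])
    then show ?thesis unfolding Y by (simp add: adjD[OF s(2)])
  qed
  then obtain Y' where Y': "adj Y Y'" using adjointable_of_dense[OF b1(2)] by blast
  have sq: "pw b1 (1/2) * pw b1 (1/2) = b1" "pw b2 (1/2) * pw b2 (1/2) = b2"
    using pw_add[OF b1(1), of "1/2" "1/2"] pw_add[OF b2(1), of "1/2" "1/2"]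
    by (simp_all add: pw_1[OF b1(1)] pw_1[OF b2(1)])
  have h: "0 \<le> (1/2::real)" "(1/2::real) \<le> 1" by auto
  have eq: "1 * (pw b2 (1/2) * pw b2 (1/2)) = pw b1 (1/2) * pw b1 (1/2) * Y" by (simp add: sq Y)
  obtain M M' where M: "adj M M'" "1 * pw b2 (1/2) = pw b1 (1/2) * M"
    by (rule heinz_half[OF pw_selfadj[OF b1(1) h(1)] pw_selfadj[OF b2(1) h(1)] pw_dense[OF b1 h]
          pw_dense[OF b2 h] adj_one Y' eq]) blast
  show thesis using that[OF Y' Y[symmetric] M(1)] M(2) by simp
qed

text \<open>For \<open>b = \<langle>D\<rangle>\<^sup>-\<^sup>1\<close>, \<open>right_div b \<alpha> A\<close> is boundedness of \<open>A \<langle>D\<rangle>\<^sup>\<alpha>\<close>, and \<open>multiplier b B\<close> says that the adjoint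
  of \<open>B\<close> leaves \<open>dom D\<close> invariant. By interpolation multipliers act from the right on the former class,
  for every \<open>\<alpha>\<close> in \<open>[0, 1]\<close> at once.\<close>

definition right_div :: "'e endo \<Rightarrow> real \<Rightarrow> 'e endo \<Rightarrow> bool" where
  "right_div b \<alpha> A \<longleftrightarrow> (\<exists>R. mlin R \<and> A = R * pw b \<alpha>)"

definition multiplier :: "'e endo \<Rightarrow> 'e endo \<Rightarrow> bool" where
  "multiplier b B \<longleftrightarrow> (\<exists>B' W W'. adj B B' \<and> adj W W' \<and> W * b = b * B)"

lemma right_div_mult_left: "right_div b \<alpha> A \<Longrightarrow> mlin C \<Longrightarrow> right_div b \<alpha> (C * A)"
  unfolding right_div_def by (metis mlin_mult mult.assoc)

lemma right_div_add: "right_div b \<alpha> A \<Longrightarrow> right_div b \<alpha> B \<Longrightarrow> right_div b \<alpha> (A + B)"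
  unfolding right_div_def by (metis mlin_add distrib_right)

lemma right_div_diff: "right_div b \<alpha> A \<Longrightarrow> right_div b \<alpha> B \<Longrightarrow> right_div b \<alpha> (A - B)"
  unfolding right_div_def by (metis mlin_diff left_diff_distrib)

lemma right_div_minus: "right_div b \<alpha> A \<Longrightarrow> right_div b \<alpha> (- A)"
  unfolding right_div_def by (metis mlin_minus minus_mult_left)

lemma right_div_scaleR: "right_div b \<alpha> A \<Longrightarrow> right_div b \<alpha> (c *\<^sub>R A)"
  unfolding right_div_def by (metis mlin_scaleR mult_scaleR_left)

lemma right_div_mult_right:
  assumes b: "positive b" "dense_range b" and \<alpha>: "0 \<le> \<alpha>" "\<alpha> \<le> 1"
    and A: "right_div b \<alpha> A" and B: "multiplier b B"
  shows "right_div b \<alpha> (A * B)"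
proof -
  obtain R where R: "mlin R" "A = R * pw b \<alpha>" using A unfolding right_div_def by blast
  obtain B' W W' where B: "adj B B'" "adj W W'" "W * b = b * B" using B unfolding multiplier_def by blast
  obtain V where V: "V * pw b \<alpha> = pw b \<alpha> * B" "mlin V"
    using heinz_interpolation[OF b B \<alpha>] .
  have "A * B = (R * V) * pw b \<alpha>" by (simp only: R(2) mult.assoc V)
  then show ?thesis unfolding right_div_def using mlin_mult[OF R(1) V(2)] by blast
qed

lemma multiplierI:
  assumes "selfadj b" "adj B B'" "adj C C'" "B' * b = b * C" shows "multiplier b B"
proof -
  have "b * B = C' * b" using adj_swap[OF assms(4) adj_sym[OF assms(2)] assms(1) assms(1) assms(3)] by simp
  then show ?thesis unfolding multiplier_def using assms adj_sym by metis
qed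

lemma multiplier_mult: "multiplier b A \<Longrightarrow> multiplier b B \<Longrightarrow> multiplier b (A * B)"
proof -
  assume "multiplier b A" "multiplier b B"
  then obtain A' V V' B' W W' where A: "adj A A'" "adj V V'" "V * b = b * A"
    and B: "adj B B'" "adj W W'" "W * b = b * B" unfolding multiplier_def by blast
  have "(V * W) * b = V * b * B" by (simp only: mult.assoc B)
  then have "(V * W) * b = b * (A * B)" by (simp only: A mult.assoc)
  then show ?thesis unfolding multiplier_def using adj_mult[OF A(1) B(1)] adj_mult[OF A(2) B(2)] by blast
qed

lemma multiplier_diff: "multiplier b A \<Longrightarrow> multiplier b B \<Longrightarrow> multiplier b (A - B)"
proof -
  assume "multiplier b A" "multiplier b B"
  then obtain A' V V' B' W W' where A: "adj A A'" "adj V V'" "V * b = b * A"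
    and B: "adj B B'" "adj W W'" "W * b = b * B" unfolding multiplier_def by blast
  have "(V - W) * b = b * (A - B)" by (simp add: A B left_diff_distrib right_diff_distrib)
  then show ?thesis unfolding multiplier_def using adj_diff[OF A(1) B(1)] adj_diff[OF A(2) B(2)] by blast
qed

lemma multiplier_commute: "adj A A' \<Longrightarrow> A * b = b * A \<Longrightarrow> multiplier b A"
  unfolding multiplier_def by blast

text \<open>The approximate intertwiner \<open>1 - F2 (F2 - F1) h / 2\<close> with a high-frequency cutoff \<open>h\<close>. Without
  the cutoff it would be \<open>(1 + F2 F1) / 2\<close> up to smoothing operators, which intertwines symmetries exactly.
  The cutoff makes \<open>F2 (F2 - F1) h\<close> small in norm; as it is bounded on \<open>dom \<langle>D\<rangle>\<close>, interpolation
  makes it small on \<open>dom \<langle>D\<rangle>\<^sup>1\<^sup>/\<^sup>2\<close> too.\<close>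

lemma small_intertwiner:
  assumes b1: "positive b1" "norm b1 \<le> 1" "dense_range b1"
    and F1: "selfadj F1" "b1 * F1 = F1 * b1"
    and F2: "selfadj F2" "adj F21 F21'" "F2 * b1 = b1 * F21"
    and \<alpha>: "0 < \<alpha>" and G: "F2 - F1 = X * pw b1 \<alpha>"
  obtains n h E Ep Ep' E' Eq Eq' where "h = (1 - b1) ^ n" "E = (1/2) *\<^sub>R (F2 * (F2 - F1) * h)"
    "E' = (1/2) *\<^sub>R (h * (F2 - F1) * F2)" "adj E E'" "multiplier b1 E" "multiplier b1 E'"
    "adj Ep Ep'" "E * pw b1 (1/2) = pw b1 (1/2) * Ep" "adj Eq Eq'" "E' * pw b1 (1/2) = pw b1 (1/2) * Eq"
    "norm E \<le> 1/16" "norm E' \<le> 1/16" "norm Ep \<le> 1/16" "norm Eq \<le> 1/16"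
proof -
  have s1: "selfadj b1" using b1 by (simp add: spec_in_def)
  define G where "G = F2 - F1"
  define G1 where "G1 = F21 - F1"
  define G1' where "G1' = F21' - F1"
  have sG: "selfadj G" unfolding G_def by (intro adj_diff F1 F2)
  have aG1: "adj G1 G1'" unfolding G1_def G1'_def by (intro adj_diff F1 F2)
  have Gb: "G * b1 = b1 * G1" by (simp add: G_def G1_def left_diff_distrib right_diff_distrib F1 F2)
  define h where "h n = (1 - b1) ^ n" for n
  have sh: "selfadj (h n)" for n unfolding h_def by (intro adj_intros s1)
  have nh: "norm (h n) \<le> 1" for n unfolding h_def by (rule cutoff_norm[OF b1(1,2)])
  have hb: "h n * b1 = b1 * h n" for n unfolding h_def by (rule power_intertwine) (simp add: algebra_simps)
  define E where "E n = (1/2) *\<^sub>R (F2 * G * h n)" for n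
  define E' where "E' n = (1/2) *\<^sub>R (h n * G * F2)" for n
  define E1 where "E1 n = (1/2) *\<^sub>R (F21 * G1 * h n)" for n
  define E1' where "E1' n = (1/2) *\<^sub>R (h n * G1 * F21)" for n
  have aE: "adj (E n) (E' n)" for n
    using adj_scaleR[OF adj_mult[OF adj_mult[OF F2(1) sG] sh], of "1/2"] by (simp add: E_def E'_def mult.assoc)
  have aE1: "\<exists>A. adj (E1 n) A" "\<exists>A. adj (E1' n) A" for n
    unfolding E1_def E1'_def using adj_scaleR adj_mult F2(2) aG1 sh by metis+
  have Eb: "E n * b1 = b1 * E1 n" for n
  proof -
    have "F2 * G * h n * b1 = F2 * (G * b1) * h n" by (simp only: mult.assoc hb)
    also have "\<dots> = (F2 * b1) * G1 * h n" unfolding Gb by (simp only: mult.assoc)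
    finally show ?thesis by (simp add: E_def E1_def F2 mult.assoc)
  qed
  have E'b: "E' n * b1 = b1 * E1' n" for n
  proof -
    have "h n * G * F2 * b1 = h n * (G * b1) * F21" by (simp only: mult.assoc F2)
    also have "\<dots> = (h n * b1) * G1 * F21" unfolding Gb by (simp only: mult.assoc)
    finally show ?thesis by (simp add: E'_def E1'_def hb mult.assoc)
  qed
  have lim: "E \<longlonglongrightarrow> 0"
  proof -
    have "(\<lambda>n. (1/2) *\<^sub>R (F2 * (X * (pw b1 \<alpha> * (1 - b1) ^ n)))) \<longlonglongrightarrow> (1/2) *\<^sub>R (F2 * (X * 0))"
      by (intro tendsto_scaleR tendsto_mult tendsto_const cutoff_limit[OF b1(1,2) \<alpha>])
    then show ?thesis by (simp add: E_def[abs_def] G_def G h_def mult.assoc)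
  qed
  define c where "c = norm F21 * norm G1"
  have c0: "c \<ge> 0" by (simp add: c_def)
  have half: "norm ((1/2) *\<^sub>R A) \<le> c" if "norm A \<le> c" for A :: "'e endo"
    using that c0 by simp
  have nE1: "norm (E1 n) \<le> c" for n
  proof -
    have "norm (F21 * G1 * h n) \<le> norm F21 * norm G1 * 1"
      by (rule order_trans[OF norm_mult_ineq]) (intro mult_mono norm_mult_ineq nh, auto)
    then show ?thesis unfolding E1_def by (intro half) (simp add: c_def)
  qed
  have nE1': "norm (E1' n) \<le> c" for n
  proof -
    have "norm (h n * G1 * F21) \<le> norm (h n * G1) * norm F21" by (rule norm_mult_ineq)
    also have "\<dots> \<le> (1 * norm G1) * norm F21"
      by (intro mult_right_mono order_trans[OF norm_mult_ineq] nh) auto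
    finally show ?thesis unfolding E1'_def by (intro half) (simp add: c_def mult.commute)
  qed
  \<comment> \<open>\<open>3 \<epsilon> \<le> 1/16\<close> takes care of \<open>E'\<close>, and \<open>27 \<epsilon> c \<le> (1/16)\<^sup>2\<close> of \<open>Ep\<close> and \<open>Eq\<close>\<close>
  define \<epsilon> where "\<epsilon> = 1 / (6912 * (c + 1))"
  have \<epsilon>: "0 < \<epsilon>" "\<epsilon> \<le> 1/48" "27 * (\<epsilon> * c) \<le> (1/16)\<^sup>2"
    using c0 by (auto simp: \<epsilon>_def field_simps power2_eq_square)
  obtain n where n: "norm (E n) \<le> \<epsilon>"
    using LIMSEQ_D[OF lim \<epsilon>(1)] by (auto intro: less_imp_le)
  have nE': "norm (E' n) \<le> 3 * \<epsilon>" using adj_norm[OF aE[of n]] n by simp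
  define r where "r = pw b1 (1/2)"
  have r: "selfadj r" "dense_range r"
    using pw_selfadj[OF b1(1), of "1/2"] pw_dense[OF b1(1,3), of "1/2"] by (simp_all add: r_def)
  have rr: "r * r = b1" unfolding r_def using pw_add[OF b1(1), of "1/2" "1/2"] by (simp add: pw_1[OF b1(1)])
  obtain A1 where A1: "adj (E1 n) A1" using aE1 by blast
  obtain A2 where A2: "adj (E1' n) A2" using aE1 by blast
  have "E n * (r * r) = r * r * E1 n" "E' n * (r * r) = r * r * E1' n" by (simp_all add: rr Eb E'b)
  note eqs = this
  obtain Ep Ep' where Ep: "adj Ep Ep'" "E n * r = r * Ep" "(norm Ep)\<^sup>2 \<le> 9 * (norm (E' n) * norm (E1 n))"
    using heinz_half[OF r(1) r(1) r(2) r(2) aE A1 eqs(1)] .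
  obtain Eq Eq' where Eq: "adj Eq Eq'" "E' n * r = r * Eq" "(norm Eq)\<^sup>2 \<le> 9 * (norm (E n) * norm (E1' n))"
    using heinz_half[OF r(1) r(1) r(2) r(2) adj_sym[OF aE] A2 eqs(2)] .
  have "(norm Ep)\<^sup>2 \<le> (1/16)\<^sup>2"
  proof -
    have "norm (E' n) * norm (E1 n) \<le> (3 * \<epsilon>) * c" using nE' nE1 \<epsilon> by (intro mult_mono) auto
    then show ?thesis using Ep(3) \<epsilon>(3) by linarith
  qed
  then have nEp: "norm Ep \<le> 1/16" by (rule power2_le_imp_le) simp
  have "(norm Eq)\<^sup>2 \<le> (1/16)\<^sup>2"
  proof -
    have "norm (E n) * norm (E1' n) \<le> \<epsilon> * c" using n nE1' \<epsilon> by (intro mult_mono) auto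
    moreover have "\<epsilon> * c \<ge> 0" using \<epsilon>(1) c0 by simp
    ultimately show ?thesis using Eq(3) \<epsilon>(3) by linarith
  qed
  then have nEq: "norm Eq \<le> 1/16" by (rule power2_le_imp_le) simp
  show thesis
  proof (rule that[of "h n" n "E n" "E' n" Ep Ep' Eq Eq'])
    show "multiplier b1 (E n)" by (rule multiplierI[OF s1 aE A2 E'b])
    show "multiplier b1 (E' n)" by (rule multiplierI[OF s1 adj_sym[OF aE] A1 Eb])
    show "norm (E n) \<le> 1/16" "norm (E' n) \<le> 1/16" using n nE' \<epsilon>(2) by auto
  qed (use Ep Eq nEp nEq aE in \<open>simp_all add: h_def E_def E'_def G_def r_def\<close>)
qed

text \<open>Modulo smoothing operators, \<open>F1\<close> and \<open>F2\<close> are symmetries and \<open>h\<close> is the identity. So \<open>1 - E\<close> is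
  congruent to \<open>(1 + F2 F1) / 2\<close>, and both products are congruent to \<open>(F1 + F2) / 2\<close>.\<close>

lemma small_intertwiner_smoothing:
  assumes r: "selfadj r" and rr: "b1 = r * r" and F1: "selfadj F1" "F1 * r = r * F1" "F1 * F1 = 1 - b1 * b1"
    and F2: "preserves r F2" "F2 * F2 = 1 - b2 * b2" and b2: "smoothing r (b2 * b2)"
    and h: "h = (1 - b1) ^ n" and E: "E = (1/2) *\<^sub>R (F2 * (F2 - F1) * h)"
  shows "smoothing r (F2 * (1 - E) - (1 - E) * F1)"
proof -
  define G where "G = F2 - F1"
  obtain p where p: "1 - h = b1 * peval p b1" unfolding h by (rule one_minus_power)
  define q where "q = b1 * peval p b1"
  have hq: "h = 1 - q" using p by (simp add: q_def algebra_simps)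
  have sb: "selfadj b1" unfolding rr by (intro adj_mult r)
  have br: "b1 * r = r * b1" by (simp add: rr mult.assoc)
  have pr: "peval p b1 * r = r * peval p b1" by (rule peval_commute[OF br])
  have preF1: "preserves r F1" by (rule preserves_commute[OF F1(1,2)])
  have preG: "preserves r G" unfolding G_def by (intro preserves_diff F2 preF1)
  have preh: "preserves r h" unfolding h
  proof (rule preserves_commute)
    show "selfadj ((1 - b1) ^ n)" by (intro adj_intros sb)
    show "(1 - b1) ^ n * r = r * (1 - b1) ^ n" by (rule power_intertwine) (simp add: algebra_simps br)
  qed
  have sq: "smoothing r q"
  proof -
    have "q = r * peval p b1 * r" unfolding q_def rr by (simp only: mult.assoc pr[unfolded rr])
    then show ?thesis unfolding smoothing_def using peval_selfadj[OF sb] by blast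
  qed
  have sbb: "smoothing r (b1 * b1)"
  proof -
    have "b1 * b1 = r * b1 * r" by (simp add: rr mult.assoc)
    then show ?thesis unfolding smoothing_def using sb by blast
  qed
  have FGF: "F2 * G * F1 = - G - b2 * b2 * F1 + F2 * (b1 * b1)"
  proof -
    have "F2 * G * F1 = (F2 * F2) * F1 - F2 * (F1 * F1)" by (simp add: G_def algebra_simps)
    then show ?thesis unfolding F1 F2 by (simp add: G_def algebra_simps)
  qed
  have "F2 * (1 - E) - (1 - E) * F1 = G - (1/2) *\<^sub>R (F2 * F2 * (G * h)) + (1/2) *\<^sub>R (F2 * G * h * F1)"
    unfolding E G_def[symmetric] by (simp add: G_def left_diff_distrib right_diff_distrib mult.assoc)
  also have "F2 * F2 * (G * h) = G - G * q - b2 * b2 * (G * h)"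
    unfolding F2 hq by (simp add: algebra_simps)
  also have "F2 * G * h * F1 = F2 * G * F1 - F2 * G * q * F1"
    unfolding hq by (simp add: algebra_simps)
  also have "G - (1/2) *\<^sub>R (G - G * q - b2 * b2 * (G * h)) + (1/2) *\<^sub>R (F2 * G * F1 - F2 * G * q * F1) =
      (1/2) *\<^sub>R (G * q + b2 * b2 * (G * h) - b2 * b2 * F1 + F2 * (b1 * b1) - F2 * G * q * F1)"
  proof -
    have "G = (1/2) *\<^sub>R (G + G)" by (simp flip: scaleR_2)
    then have "G - (1/2) *\<^sub>R (G - G * q - b2 * b2 * (G * h)) + (1/2) *\<^sub>R (F2 * G * F1 - F2 * G * q * F1) =
      (1/2) *\<^sub>R ((G + G) - (G - G * q - b2 * b2 * (G * h)) + (F2 * G * F1 - F2 * G * q * F1))"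
      by (metis scaleR_add_right scaleR_diff_right)
    then show ?thesis unfolding FGF by (simp add: algebra_simps)
  qed
  finally have eq: "F2 * (1 - E) - (1 - E) * F1 =
      (1/2) *\<^sub>R (G * q + b2 * b2 * (G * h) - b2 * b2 * F1 + F2 * (b1 * b1) - F2 * G * q * F1)" .
  show ?thesis unfolding eq
    by (intro smoothing_scaleR smoothing_diff smoothing_add smoothing_mult_left[OF preG sq]
        smoothing_mult_right[OF b2 preserves_mult[OF preG preh]] smoothing_mult_right[OF b2 preF1]
        smoothing_mult_left[OF F2(1) sbb] 
        smoothing_mult_right[OF smoothing_mult_left[OF preserves_mult[OF F2(1) preG] sq] preF1])
qed

text \<open>In unbounded terms \<open>\<mu> = \<langle>D2\<rangle>\<^sup>1\<^sup>/\<^sup>2 Z \<langle>D1\<rangle>\<^sup>-\<^sup>1\<^sup>/\<^sup>2\<close> and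
  \<open>T = \<langle>D2\<rangle>\<^sup>1\<^sup>/\<^sup>2 (F2 - Z F1 Z\<^sup>*) \<langle>D2\<rangle>\<^sup>1\<^sup>/\<^sup>2\<close>, with inverse \<open>\<nu>\<close> of \<open>\<mu>\<close>. The equation for \<open>\<mu>' b2\<close> matches the
  domains of \<open>D2\<close> and \<open>\<mu> D1 \<mu>\<^sup>*\<close>, the one for \<open>F2\<close> is \<open>D2 = \<mu> D1 \<mu>\<^sup>* + T\<close> applied after \<open>b2\<close>.\<close>

lemma bounded_perturbation:
  assumes b1: "positive b1" "norm b1 \<le> 1" "dense_range b1" and b2: "positive b2" "dense_range b2"
    and F1: "selfadj F1" "b1 * F1 = F1 * b1" "F1 * F1 = 1 - b1 * b1"
    and F2: "selfadj F2" "b2 * F2 = F2 * b2" "F2 * F2 = 1 - b2 * b2"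
    and ran: "range (app b1) = range (app b2)"
    and \<alpha>: "0 < \<alpha>" "\<alpha> \<le> 1" and G: "right_div b1 \<alpha> (F2 - F1)"
  obtains \<mu> \<mu>' \<nu> \<nu>' T where "adj \<mu> \<mu>'" "adj \<nu> \<nu>'" "\<mu> * \<nu> = 1" "\<nu> * \<mu> = 1" "selfadj T"
    "\<mu>' * b2 = b1 * \<nu>" "\<mu> * F1 * \<nu> + T * b2 = F2"
    "right_div b1 \<alpha> (F1 * \<mu> - \<mu> * F1)" "right_div b1 \<alpha> b2"
    "1/2 < \<alpha> \<Longrightarrow> right_div b1 (\<alpha> - 1/2) (pw b1 (1/2) * T)"
proof -
  have s1: "selfadj b1" and s2: "selfadj b2" using b1 b2 by (auto simp: spec_in_def)
  obtain Y Y' M M' where Y: "adj Y Y'" "b2 = b1 * Y" and M: "adj M M'" "pw b2 (1/2) = pw b1 (1/2) * M"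
    using equal_range_factor[OF b1(1,3) b2] ran by blast
  obtain U U' N N' where U: "adj U U'" "b1 = b2 * U" and N: "adj N N'" "pw b1 (1/2) = pw b2 (1/2) * N"
    using equal_range_factor[OF b2 b1(1,3)] ran by blast
  define r where "r = pw b1 (1/2)"
  define r2 where "r2 = pw b2 (1/2)"
  have r: "selfadj r" "dense_range r" "inj (app r)"
    using pw_selfadj[OF b1(1), of "1/2"] pw_dense[OF b1(1,3), of "1/2"] pw_inj[OF b1(1,3), of "1/2"]
    by (simp_all add: r_def)
  have r2: "selfadj r2" "dense_range r2" "inj (app r2)"
    using pw_selfadj[OF b2(1), of "1/2"] pw_dense[OF b2, of "1/2"] pw_inj[OF b2, of "1/2"]
    by (simp_all add: r2_def)
  have rM: "r2 = r * M" and rN: "r = r2 * N" using M N by (simp_all add: r_def r2_def)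
  have rr: "b1 = r * r" and rr2: "b2 = r2 * r2"
    using pw_add[OF b1(1), of "1/2" "1/2"] pw_add[OF b2(1), of "1/2" "1/2"]
    by (simp_all add: pw_1[OF b1(1)] pw_1[OF b2(1)] r_def r2_def)
  have MN: "M * N = 1" by (rule inj_cancel[OF r(3)]) (simp add: rM[symmetric] rN[symmetric] flip: mult.assoc)
  have NM: "N * M = 1" by (rule inj_cancel[OF r2(3)]) (simp add: rM[symmetric] rN[symmetric] flip: mult.assoc)
  have Mr: "M' * r = r2" by (rule adj_unique[OF _ r2(1)]) (simp add: rM adj_mult[OF r(1) M(1)])
  have Nr: "N' * r2 = r" by (rule adj_unique[OF _ r(1)]) (simp add: rN adj_mult[OF r2(1) N(1)])
  have F1r: "F1 * r = r * F1" unfolding r_def by (rule pw_commute_with[OF b1(1) _ F1(2), symmetric]) simp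
  have F2r2: "F2 * r2 = r2 * F2" unfolding r2_def by (rule pw_commute_with[OF b2(1) _ F2(2), symmetric]) simp
  define F2p where "F2p = M * F2 * N"
  have aF2p: "adj F2p (N' * (F2 * M'))" unfolding F2p_def by (intro adj_mult M N F2)
  have F2r: "F2 * r = r * F2p"
  proof -
    have "F2 * r = r2 * (F2 * N)" by (subst rN) (simp only: F2r2 flip: mult.assoc)
    then show ?thesis by (simp only: rM F2p_def mult.assoc)
  qed
  have rF2: "r * F2 = (N' * (F2 * M')) * r" by (rule adj_swap[OF F2r F2(1) r(1) r(1) aF2p])
  have preF2: "preserves r F2" unfolding preserves_def using F2r rF2 aF2p adj_sym by blast
  have sbb2: "smoothing r (b2 * b2)"
  proof -
    have "b2 * b2 = r2 * (r2 * r2) * r2" by (simp only: rr2 mult.assoc)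
    also have "\<dots> = r * (M * (r2 * r2) * M') * r" 
      by (subst (1) rM, subst (3) Mr[symmetric]) (simp only: mult.assoc)
    finally show ?thesis unfolding smoothing_def using adj_mult[OF adj_mult[OF M(1) adj_mult[OF r2(1) r2(1)]] adj_sym[OF M(1)]] by blast
  qed
  have F2b: "F2 * b1 = b1 * (Y * F2 * U)"
  proof -
    have "F2 * b1 = F2 * b2 * U" by (subst U(2)) (simp only: mult.assoc)
    also have "\<dots> = b2 * F2 * U" by (simp only: F2(2))
    also have "\<dots> = b1 * Y * F2 * U" by (simp only: Y(2)[symmetric])
    finally show ?thesis by (simp only: mult.assoc)
  qed
  have aF21: "adj (Y * F2 * U) (U' * (F2 * Y'))" by (intro adj_mult Y U F2)
  obtain X where X: "mlin X" "F2 - F1 = X * pw b1 \<alpha>" using G unfolding right_div_def by blast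
  obtain n h E Ep Ep' E' Eq Eq' where h: "h = (1 - b1) ^ n" and E: "E = (1/2) *\<^sub>R (F2 * (F2 - F1) * h)"
    and E': "E' = (1/2) *\<^sub>R (h * (F2 - F1) * F2)" and aE: "adj E E'" and mE: "multiplier b1 E" "multiplier b1 E'"
    and Ep: "adj Ep Ep'" "E * pw b1 (1/2) = pw b1 (1/2) * Ep" and Eq: "adj Eq Eq'" "E' * pw b1 (1/2) = pw b1 (1/2) * Eq"
    and small: "norm E \<le> 1/16" "norm E' \<le> 1/16" "norm Ep \<le> 1/16" "norm Eq \<le> 1/16"
    by (rule small_intertwiner[OF b1 F1(1,2) F2(1) aF21 F2b \<alpha>(1) X(2)]) blast
  have inter: "smoothing r (F2 * (1 - E) - (1 - E) * F1)"
    by (rule small_intertwiner_smoothing[OF r(1) rr F1(1) F1r F1(3) preF2 F2(3) sbb2 h E])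
  obtain Z Z' Zp Zp' Zq Zq' k k' L L' where Z: "adj Z Z'" "Z * Z' = 1" "Z' * Z = 1"
    and Zp: "adj Zp Zp'" "Z * r = r * Zp" and Zq: "adj Zq Zq'" "Z' * r = r * Zq"
    and k: "adj k k'" "F2 * Z - Z * F1 = r * k * r" and L: "adj L L'"
    and ZL: "Z = (1 + L * (E + E' - E * E')) * (1 - E)" "Z' = (1 - E') * (1 + L * (E + E' - E * E'))"
    by (rule unitary_intertwiner[OF r(1,2) F1(1) F2(1) aE Ep[folded r_def] Eq[folded r_def] small inter]) blast
  have rZ': "r * Z' = Zp' * r" by (rule adj_swap[OF Zp(2) Z(1) r(1) r(1) Zp(1)])
  have ZpZq: "Zp * Zq = 1"
  proof (rule inj_cancel[OF r(3)])
    have "r * (Zp * Zq) = Z * (r * Zq)" by (simp only: Zp(2) flip: mult.assoc)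
    also have "\<dots> = (Z * Z') * r" by (simp only: Zq(2)[symmetric] mult.assoc)
    finally show "r * (Zp * Zq) = r * 1" by (simp add: Z)
  qed
  have ZqZp: "Zq * Zp = 1"
  proof (rule inj_cancel[OF r(3)])
    have "r * (Zq * Zp) = Z' * (r * Zp)" by (simp only: Zq(2) flip: mult.assoc)
    also have "\<dots> = (Z' * Z) * r" by (simp only: Zp(2)[symmetric] mult.assoc)
    finally show "r * (Zq * Zp) = r * 1" by (simp add: Z)
  qed
  have FZ: "F2p * Zp - Zp * F1 = k * b1"
  proof (rule inj_cancel[OF r(3)])
    have "r * (F2p * Zp - Zp * F1) = (r * F2p) * Zp - (r * Zp) * F1" by (simp only: right_diff_distrib mult.assoc)
    also have "\<dots> = F2 * (r * Zp) - Z * (r * F1)" by (simp only: F2r[symmetric] Zp(2)[symmetric] mult.assoc)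
    also have "\<dots> = (F2 * Z - Z * F1) * r" by (simp only: Zp(2)[symmetric] F1r[symmetric] left_diff_distrib mult.assoc)
    finally show "r * (F2p * Zp - Zp * F1) = r * (k * b1)" by (simp only: k(2) rr mult.assoc)
  qed
  \<comment> \<open>\<open>N = \<langle>D2\<rangle>\<^sup>1\<^sup>/\<^sup>2 \<langle>D1\<rangle>\<^sup>-\<^sup>1\<^sup>/\<^sup>2\<close>, \<open>Zp = \<langle>D1\<rangle>\<^sup>1\<^sup>/\<^sup>2 Z \<langle>D1\<rangle>\<^sup>-\<^sup>1\<^sup>/\<^sup>2\<close> and \<open>F2 Z - Z F1 = r k r\<close>\<close>
  define \<mu> where "\<mu> = N * Zp"
  define \<mu>' where "\<mu>' = Zp' * N'"
  define \<nu> where "\<nu> = Zq * M"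
  define T where "T = N * k * Zp' * N'"
  have a\<mu>: "adj \<mu> \<mu>'" unfolding \<mu>_def \<mu>'_def by (intro adj_mult N Zp)
  have a\<nu>: "adj \<nu> (M' * Zq')" unfolding \<nu>_def by (intro adj_mult M Zq)
  have \<mu>\<nu>: "\<mu> * \<nu> = 1"
  proof -
    have "\<mu> * \<nu> = N * (Zp * Zq) * M" by (simp only: \<mu>_def \<nu>_def mult.assoc)
    then show ?thesis by (simp add: ZpZq NM)
  qed
  have \<nu>\<mu>: "\<nu> * \<mu> = 1"
  proof -
    have "\<nu> * \<mu> = Zq * (M * N) * Zp" by (simp only: \<mu>_def \<nu>_def mult.assoc)
    then show ?thesis by (simp add: ZqZp MN)
  qed
  have \<mu>b: "\<mu>' * b2 = b1 * \<nu>"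
  proof -
    have "\<mu>' * b2 = Zp' * (N' * r2) * r2" by (simp only: \<mu>'_def rr2 mult.assoc)
    also have "\<dots> = (Zp' * r) * (r * M)" by (simp only: Nr rM[symmetric])
    also have "\<dots> = r * (Z' * r) * M" by (simp only: rZ'[symmetric] mult.assoc)
    finally show ?thesis by (simp only: Zq(2) rr \<nu>_def mult.assoc)
  qed
  have Tb: "T * b2 = N * k * b1 * \<nu>"
  proof -
    have "T * b2 = N * k * (\<mu>' * b2)" by (simp only: T_def \<mu>'_def mult.assoc)
    then show ?thesis by (simp only: \<mu>b mult.assoc)
  qed
  have dec: "\<mu> * F1 * \<nu> + T * b2 = F2"
  proof -
    have "\<mu> * F1 * \<nu> + T * b2 = N * (Zp * F1 + k * b1) * \<nu>"
      unfolding Tb by (simp only: \<mu>_def distrib_left distrib_right mult.assoc)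
    also have "Zp * F1 + k * b1 = F2p * Zp" unfolding FZ[symmetric] by simp
    also have "N * (F2p * Zp) * \<nu> = (N * M) * F2 * (N * (Zp * Zq) * M)" by (simp only: F2p_def \<nu>_def mult.assoc)
    finally show ?thesis by (simp add: NM ZpZq)
  qed
  \<comment> \<open>\<open>r2 T r2 = F2 - Z F1 Z\<^sup>*\<close>\<close>
  define G' where "G' = F2 - Z * F1 * Z'"
  have rTr: "r2 * T * r2 = G'"
  proof -
    have "r2 * T * r2 = (r2 * N) * k * (Zp' * (N' * r2))" by (simp only: T_def mult.assoc)
    also have "\<dots> = r * k * (Zp' * r)" by (simp only: rN[symmetric] Nr)
    also have "\<dots> = (F2 * Z - Z * F1) * Z'" by (simp only: rZ'[symmetric] k(2) mult.assoc)
    also have "\<dots> = F2 * (Z * Z') - Z * F1 * Z'" by (simp only: left_diff_distrib mult.assoc)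
    finally show ?thesis by (simp add: Z G'_def)
  qed
  have sG': "selfadj G'" unfolding G'_def
    using adj_diff[OF F2(1) adj_mult[OF adj_mult[OF Z(1) F1(1)] adj_sym[OF Z(1)]]] by (simp add: mult.assoc)
  obtain T' where T': "adj T T'" unfolding T_def using adj_mult N k Zp adj_sym by metis
  have sT: "selfadj T"
  proof -
    have "adj (r2 * T * r2) (r2 * T' * r2)" using adj_mult[OF adj_mult[OF r2(1) T'] r2(1)] by (simp add: mult.assoc)
    then have "r2 * T' * r2 = r2 * T * r2" unfolding rTr using sG' adj_unique by blast
    then have "r2 * T' = r2 * T" by (rule dense_range_cancel[OF r2(2)])
    then have "T' = T" by (rule inj_cancel[OF r2(3)])
    then show ?thesis using T' by simp
  qed
  have \<alpha>0: "0 \<le> \<alpha>" using \<alpha> by simp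
  note rdm = right_div_mult_right[OF b1(1,3) \<alpha>0 \<alpha>(2)]
  have mN: "multiplier b1 N"
  proof (rule multiplierI[OF s1 N(1)])
    show "adj (M * U) (U' * M')" by (intro adj_mult M U)
    have "N' * b1 = (N' * r2) * (r2 * U)" by (subst U(2)) (simp only: rr2 mult.assoc)
    also have "\<dots> = r * (r2 * U)" by (simp only: Nr)
    finally show "N' * b1 = b1 * (M * U)" by (simp only: rr rM mult.assoc)
  qed
  have m\<mu>: "multiplier b1 \<mu>"
  proof (rule multiplierI[OF s1 a\<mu>])
    show "adj (\<nu> * U) (U' * (M' * Zq'))" by (intro adj_mult a\<nu> U)
    have "\<mu>' * b1 = (\<mu>' * b2) * U" by (subst U(2)) (simp only: mult.assoc)
    then show "\<mu>' * b1 = b1 * (\<nu> * U)" by (simp only: \<mu>b mult.assoc)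
  qed
  have b1div: "right_div b1 \<alpha> (A * b1)" if "mlin A" for A
  proof -
    have "A * b1 = (A * pw b1 (1 - \<alpha>)) * pw b1 \<alpha>"
      using pw_add[OF b1(1), of "1 - \<alpha>" \<alpha>] \<alpha> by (simp add: pw_1[OF b1(1)] mult.assoc)
    moreover have "mlin (pw b1 (1 - \<alpha>))" by (rule adj_mlin[OF pw_selfadj[OF b1(1)]]) (simp add: \<alpha>)
    then have "mlin (A * pw b1 (1 - \<alpha>))" by (rule mlin_mult[OF that])
    ultimately show ?thesis unfolding right_div_def by blast
  qed
  have comm: "F1 * \<mu> - \<mu> * F1 = - ((F2 - F1) * \<mu>) + N * k * b1"
  proof -
    have "N * (F2p * Zp) = (N * M) * F2 * (N * Zp)" by (simp only: F2p_def mult.assoc)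
    then have "F2 * \<mu> = N * (F2p * Zp)" by (simp add: NM \<mu>_def)
    also have "F2p * Zp = Zp * F1 + k * b1" unfolding FZ[symmetric] by simp
    finally have "F2 * \<mu> = \<mu> * F1 + N * k * b1" by (simp only: \<mu>_def distrib_left mult.assoc)
    then show ?thesis by (simp add: left_diff_distrib)
  qed
  have c1: "right_div b1 \<alpha> (F1 * \<mu> - \<mu> * F1)" unfolding comm
    by (intro right_div_add right_div_minus rdm[OF G m\<mu>] b1div mlin_mult adj_mlin[OF N(1)] adj_mlin[OF k(1)])
  have c2: "right_div b1 \<alpha> b2"
  proof -
    have "b2 = Y' * b1" by (rule adj_unique[OF s2]) (simp add: Y(2) adj_mult[OF s1 Y(1), folded Y(2)] adj_mult[OF s1 Y(1)])
    then show ?thesis using b1div[OF adj_mlin[OF adj_sym[OF Y(1)]]] by simp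
  qed
  \<comment> \<open>\<open>F2 - Z F1 Z\<^sup>*\<close> gains \<open>\<langle>D1\<rangle>\<^sup>\<alpha>\<close> since each of \<open>F2 - F1\<close>, \<open>Z - 1\<close> and \<open>Z\<^sup>* - 1\<close> does\<close>
  have mh: "multiplier b1 h" unfolding h
  proof (rule multiplier_commute)
    show "selfadj ((1 - b1) ^ n)" by (intro adj_intros s1)
    show "(1 - b1) ^ n * b1 = b1 * (1 - b1) ^ n" by (rule power_intertwine) (simp add: algebra_simps)
  qed
  have mF1: "multiplier b1 F1" by (rule multiplier_commute[OF F1(1)]) (simp add: F1)
  have mF2: "multiplier b1 F2" by (rule multiplierI[OF s1 F2(1) aF21 F2b])
  have dE: "right_div b1 \<alpha> E"
  proof -
    have "right_div b1 \<alpha> (F2 * ((F2 - F1) * h))" by (intro right_div_mult_left rdm[OF G mh] adj_mlin[OF F2(1)])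
    then show ?thesis unfolding E by (simp add: right_div_scaleR mult.assoc)
  qed
  have sh: "selfadj h" unfolding h by (intro adj_intros s1)
  have dE': "right_div b1 \<alpha> E'"
  proof -
    have "right_div b1 \<alpha> (h * ((F2 - F1) * F2))" by (intro right_div_mult_left rdm[OF G mF2] adj_mlin[OF sh])
    then show ?thesis unfolding E' by (simp add: right_div_scaleR mult.assoc)
  qed
  define Yd where "Yd = E + E' - E * E'"
  have dY: "right_div b1 \<alpha> Yd" unfolding Yd_def
    by (intro right_div_diff right_div_add right_div_mult_left dE dE' adj_mlin[OF aE])
  have mlL: "mlin L" by (rule adj_mlin[OF L])
  have m1: "multiplier b1 1" by (rule multiplier_commute[OF adj_one]) simp
  have dG': "right_div b1 \<alpha> G'"
  proof -
    have e: "G' = (F2 - F1) - (L * (Yd * ((1 - E) * F1)) - E * F1) - Z * F1 * ((1 - E') * (L * Yd) - E')"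
    proof -
      have "Z' = 1 + ((1 - E') * (L * Yd) - E')" unfolding ZL(2) Yd_def[symmetric] by (simp add: distrib_left)
      then have "Z * F1 * Z' = Z * F1 + Z * F1 * ((1 - E') * (L * Yd) - E')" by (metis distrib_left mult.right_neutral)
      moreover have "Z * F1 = F1 + (L * (Yd * ((1 - E) * F1)) - E * F1)"
        unfolding ZL(1) Yd_def[symmetric] by (simp add: distrib_right left_diff_distrib mult.assoc)
      ultimately show ?thesis by (simp add: G'_def)
    qed
    show ?thesis unfolding e
      by (intro right_div_diff G right_div_mult_left rdm[OF dY] rdm[OF dE] multiplier_mult multiplier_diff
          m1 mE mF1 mlL dY dE' mlin_mult adj_mlin[OF Z(1)] adj_mlin[OF F1(1)] adj_mlin[OF adj_diff[OF adj_one adj_sym[OF aE]]])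
  qed
  have c3: "right_div b1 (\<alpha> - 1/2) (pw b1 (1/2) * T)" if half: "1/2 < \<alpha>"
  proof -
    have "right_div b1 \<alpha> (N' * (G' * N))" by (intro right_div_mult_left rdm[OF dG' mN] adj_mlin[OF adj_sym[OF N(1)]])
    then obtain R where R: "mlin R" "N' * (G' * N) = R * pw b1 \<alpha>" unfolding right_div_def by blast
    have "(r * T) * r = (N' * r2) * T * (r2 * N)" by (simp only: Nr rN[symmetric])
    also have "\<dots> = N' * ((r2 * T * r2) * N)" by (simp only: mult.assoc)
    also have "\<dots> = R * pw b1 \<alpha>" by (simp only: rTr R(2))
    also have "pw b1 \<alpha> = pw b1 (\<alpha> - 1/2) * r" unfolding r_def
      using pw_add[OF b1(1), of "\<alpha> - 1/2" "1/2"] half by simp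
    finally have "(r * T) * r = (R * pw b1 (\<alpha> - 1/2)) * r" by (simp only: mult.assoc)
    then have "r * T = R * pw b1 (\<alpha> - 1/2)" by (rule dense_range_cancel[OF r(2)])
    then show ?thesis unfolding right_div_def r_def using R(1) by blast
  qed
  show thesis by (rule that[OF a\<mu> a\<nu> \<mu>\<nu> \<nu>\<mu> sT \<mu>b dec c1 c2 c3])
qed

end

section \<open>Translation to unbounded operators\<close>

lemma op_inv_Some: "inj f \<Longrightarrow> op_inv (Some \<circ> f) (f x) = Some x"
proof -
  assume f: "inj f"
  then have "\<exists>!z. f z = f x" by (auto dest: injD)
  moreover have "(THE z. f z = f x) = x" using f by (auto dest: injD)
  ultimately show ?thesis by (simp add: op_inv_def)
qed

lemma op_inv_None: "y \<notin> range f \<Longrightarrow> op_inv (Some \<circ> f) y = None"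
  by (auto simp: op_inv_def)

lemma op_inv_eq_Some: "inj f \<Longrightarrow> op_inv (Some \<circ> f) y = Some x \<longleftrightarrow> y = f x"
  using op_inv_Some[of f] op_inv_None[of y f] by (cases "y \<in> range f") (auto dest: injD)

lemma op_inv_involutive: "inj f \<Longrightarrow> op_inv (op_inv (Some \<circ> f)) = Some \<circ> f"
  by (rule ext) (simp add: op_inv_def[of "op_inv _"] op_inv_eq_Some)

context hilbert_module
begin

lemma op_cfc_eq_fcal:
  assumes A: "positive A" and f: "continuous_on {0..norm A} f"
  shows "op_cfc f (app A) = app (fcal (norm A) f A)"
proof -
  have eq: "onorm (\<lambda>x. op_poly p (app A) x - app S x) = norm (peval p A - S)" for p S
  proof -
    have "(\<lambda>x. op_poly p (app A) x - app S x) = app (peval p A - S)" by (simp add: op_poly_app fun_eq_iff)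
    then show ?thesis by (simp only: norm_endo_onorm)
  qed
  have on: "onorm (app A) = norm A" by (simp add: norm_endo_onorm)
  show ?thesis
    unfolding op_cfc_def on
  proof (rule the_equality)
    show "bounded_linear (app (fcal (norm A) f A)) \<and> (\<forall>p. uniform_limit {0..norm A} (\<lambda>n. poly (p n)) f sequentially \<longrightarrow>
        (\<lambda>n. onorm (\<lambda>x. op_poly (p n) (app A) x - app (fcal (norm A) f A) x)) \<longlonglongrightarrow> 0)"
    proof (intro conjI allI impI bounded_linear_app)
      fix p assume "uniform_limit {0..norm A} (\<lambda>n. poly (p n)) f sequentially"
      then have "(\<lambda>n. peval (p n) A) \<longlonglongrightarrow> fcal (norm A) f A" by (rule fcal_lim[OF A f])
      then show "(\<lambda>n. onorm (\<lambda>x. op_poly (p n) (app A) x - app (fcal (norm A) f A) x)) \<longlonglongrightarrow> 0"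
        unfolding eq by (rule tendsto_norm_zero[OF LIM_zero])
    qed
  next
    fix S assume S: "bounded_linear S \<and> (\<forall>p. uniform_limit {0..norm A} (\<lambda>n. poly (p n)) f sequentially \<longrightarrow>
        (\<lambda>n. onorm (\<lambda>x. op_poly (p n) (app A) x - S x)) \<longlonglongrightarrow> 0)"
    then have SE: "S = app (Endo S)" by (auto simp: app_Endo)
    obtain p where p: "uniform_limit {0..norm A} (\<lambda>n. poly (p n)) f sequentially" "(\<lambda>n. peval (p n) A) \<longlonglongrightarrow> fcal (norm A) f A"
      using fcal_approx[OF A f] .
    have "(\<lambda>n. onorm (\<lambda>x. op_poly (p n) (app A) x - app (Endo S) x)) \<longlonglongrightarrow> 0" using S p(1) SE by simp
    then have "(\<lambda>n. norm (peval (p n) A - Endo S)) \<longlonglongrightarrow> 0" unfolding eq .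
    then have "(\<lambda>n. peval (p n) A) \<longlonglongrightarrow> Endo S" by (simp add: tendsto_norm_zero_iff LIM_zero_cancel)
    then have "Endo S = fcal (norm A) f A" using p(2) by (rule LIMSEQ_unique)
    then show "S = app (fcal (norm A) f A)" using SE by simp
  qed
qed

lemma op_cfc_powr: "positive b \<Longrightarrow> 0 < s \<Longrightarrow> op_cfc (\<lambda>t. t powr s) (app b) = app (pw b s)"
  by (simp add: op_cfc_eq_fcal continuous_on_powr_const pw_pos)

lemma op_pow_of_inverse:
  assumes P: "the \<circ> op_inv P = app b" and b: "positive b"
  shows "s < 0 \<Longrightarrow> op_pow P s = Some \<circ> app (pw b (- s))"
    and "0 < s \<Longrightarrow> op_pow P s = op_inv (Some \<circ> app (pw b s))"
    and "op_pow P 0 = Some"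
  using op_cfc_powr[OF b] by (auto simp: op_pow_def P)

text \<open>All data of a self-adjoint regular operator that occur in the theorem, in terms of
  \<open>b = \<langle>D\<rangle>\<^sup>-\<^sup>1\<close> and the bounded transform \<open>F\<close>.\<close>

lemma selfadj_regular_transform:
  assumes D: "self_adjoint_regular ip act D"
  obtains b F where "positive b" "norm b \<le> 1" "dense_range b" "selfadj F" "b * F = F * b"
    "F * F = 1 - b * b" "\<And>x u. D x = Some u \<longleftrightarrow> (\<exists>y. x = b \<cdot> y \<and> u = F \<cdot> y)" "dom D = range (app b)"
    "bounded_transform D = Some \<circ> app F"
    "\<And>s. s < 0 \<Longrightarrow> op_pow (bracket D) s = Some \<circ> app (pw b (- s))"
    "\<And>s. 0 < s \<Longrightarrow> op_pow (bracket D) s = op_inv (Some \<circ> app (pw b s))"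
    "op_pow (bracket D) 0 = Some"
proof -
  obtain b F where b: "positive b" "norm b \<le> 1" "dense_range b" and F: "selfadj F" "b * F = F * b"
    "F * F = 1 - b * b" and D': "\<And>y. D (b \<cdot> y) = Some (F \<cdot> y)" "dom D = range (app b)"
    and inv: "\<And>x y. (Some +\<^sub>o (D \<circ>\<^sub>m D)) x = Some y \<longleftrightarrow> x = (b * b) \<cdot> y"
    and sqrt: "b = fcal (norm (b * b)) (\<lambda>t. t powr (1/2)) (b * b)"
    by (rule bounded_transform_exists[OF D]) blast
  have sb: "selfadj b" using b by (simp add: spec_in_def)
  have ib: "inj (app b)" by (rule selfadj_dense_inj[OF sb b(3)])
  have a: "positive (b * b)" by (rule spec_in_square[OF sb])
  have P: "the \<circ> op_inv (Some +\<^sub>o (D \<circ>\<^sub>m D)) = app (b * b)"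
    by (rule ext) (simp add: op_inv_def inv)
  have half: "pw (b * b) (1/2) = b" using sqrt by (simp add: pw_pos)
  have br: "bracket D = op_inv (Some \<circ> app b)"
    unfolding bracket_def using op_pow_of_inverse(2)[OF P a, of "1/2"] half by simp
  have Q: "the \<circ> op_inv (bracket D) = app b"
    unfolding br op_inv_involutive[OF ib] by auto
  have bt: "bounded_transform D = Some \<circ> app F"
    unfolding bounded_transform_def using op_pow_of_inverse(1)[OF P a, of "- 1/2"] half D'(1)
    by (auto simp: fun_eq_iff map_comp_def)
  have gr: "D x = Some u \<longleftrightarrow> (\<exists>y. x = b \<cdot> y \<and> u = F \<cdot> y)" for x u
    using D' by (metis domI option.inject rangeE)
  show thesis
    by (rule that[OF b F gr D'(2) bt op_pow_of_inverse[OF Q b(1)]])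
qed

lemma bounded_op_app: "mlin X \<Longrightarrow> bounded_op act (app X)"
  by (auto simp: bounded_op_def bounded_linear_app module_linear_def mlin_def)

lemma bounded_op_Endo: "bounded_op act X \<Longrightarrow> mlin (Endo X) \<and> app (Endo X) = X"
proof -
  assume X: "bounded_op act X"
  then have "app (Endo X) = X" by (auto simp: bounded_op_def app_Endo)
  then show ?thesis using X by (auto simp: bounded_op_def module_linear_def mlin_def)
qed

lemma adjointable_app: "adj X Y \<Longrightarrow> adjointable ip act (app X)"
  unfolding adjointable_def
  by (intro conjI exI[of _ "app Y"] bounded_op_app adj_mlin[OF adj_sym] adj_mlin[of X]) (auto simp: adjD)

lemma op_adjoint_app:
  assumes "adj X Y" shows "op_adjoint ip (Some \<circ> app X) = Some \<circ> app Y"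
proof
  fix y
  have dom: "dom (Some \<circ> app X) = UNIV" by auto
  have iff: "(\<forall>x\<in>dom (Some \<circ> app X). ip (the ((Some \<circ> app X) x)) y = ip x z) \<longleftrightarrow> z = Y \<cdot> y" for z
    unfolding dom using adjD[OF assms] by (auto intro: ip_ext)
  show "op_adjoint ip (Some \<circ> app X) y = (Some \<circ> app Y) y"
    unfolding op_adjoint_def iff by simp
qed

lemma op_bounded_app: "mlin X \<Longrightarrow> op_bounded act (Some \<circ> app X)"
  unfolding op_bounded_def densely_defined_def
  by (intro conjI exI[of _ "app X"] bounded_op_app) (auto simp: dom_def map_le_def)

text \<open>The product of \<open>A = R b\<^sup>s\<close> with the unbounded inverse of \<open>b\<^sup>s\<close> lives on the dense set \<open>ran b\<^sup>s\<close> and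
  agrees with \<open>R\<close> there.\<close>

lemma op_bounded_right_div:
  assumes b: "positive b" "dense_range b" and s: "0 \<le> s" "s \<le> 1" and A: "right_div b s A"
  shows "op_bounded act ((Some \<circ> app A) \<circ>\<^sub>m op_inv (Some \<circ> app (pw b s)))"
proof -
  obtain R where R: "mlin R" "A = R * pw b s" using A unfolding right_div_def by blast
  have i: "inj (app (pw b s))" by (rule pw_inj[OF b s])
  have val: "op_inv (Some \<circ> app (pw b s)) x = Some y \<longleftrightarrow> x = pw b s \<cdot> y" for x y
    by (rule op_inv_eq_Some[OF i])
  have dom: "dom ((Some \<circ> app A) \<circ>\<^sub>m op_inv (Some \<circ> app (pw b s))) = range (app (pw b s))"
    by (auto simp: dom_def map_comp_Some_iff val)
  have "(Some \<circ> app A) \<circ>\<^sub>m op_inv (Some \<circ> app (pw b s)) \<subseteq>\<^sub>m Some \<circ> app R"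
    unfolding map_le_def dom by (auto simp: map_comp_def op_inv_Some[OF i] R(2))
  then show ?thesis
    unfolding op_bounded_def densely_defined_def dom using pw_dense[OF b s] bounded_op_app[OF R(1)] by blast
qed

text \<open>Surjectivity of \<open>1 + T\<^sup>2\<close> is again read off from the inverse square root series.\<close>

lemma selfadj_imp_regular:
  assumes T: "selfadj T" shows "self_adjoint_regular ip act (Some \<circ> app T)"
proof -
  have adjT: "op_adjoint ip (Some \<circ> app T) = Some \<circ> app T" by (rule op_adjoint_app[OF T])
  have ml: "module_linear act (Some \<circ> app T)" using bounded_op_app[OF adj_mlin[OF T]] by (simp add: bounded_op_def)
  have dd: "densely_defined (Some \<circ> app T)" unfolding densely_defined_def by (simp add: dom_def)
  have cl: "closed (Map.graph (Some \<circ> app T))"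
  proof -
    have "Map.graph (Some \<circ> app T) = {z. snd z = T \<cdot> fst z}" by (auto simp: Map.graph_def)
    then show ?thesis by (simp add: closed_Collect_eq continuous_intros)
  qed
  \<comment> \<open>\<open>1 + T\<^sup>2 = c (1 - X)\<close> with \<open>norm X < 1\<close>\<close>
  have surj: "\<exists>x. (1 + T * T) \<cdot> x = y" for y
  proof -
    define c where "c = 1 + norm (T * T)"
    have c: "c \<ge> 1" by (simp add: c_def)
    define X where "X = peval [:1 - 1 / c, - (1 / c):] (T * T)"
    have "norm X \<le> 1 - 1 / c" unfolding X_def
    proof (rule spec_inD[OF spec_in_square[OF T]])
      fix t assume "0 \<le> t" "t \<le> norm (T * T)"
      then have "0 \<le> (c - 1 - t) / c" "(c - 1 - t) / c \<le> (c - 1) / c"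
        using c by (auto simp: c_def intro: divide_right_mono)
      moreover have "poly [:1 - 1 / c, - (1 / c):] t = (c - 1 - t) / c" "1 - 1 / c = (c - 1) / c"
        using c by (simp_all add: field_simps)
      ultimately show "\<bar>poly [:1 - 1 / c, - (1 / c):] t\<bar> \<le> 1 - 1 / c" by simp
    qed
    then have X: "norm X < 1" using c by (smt (verit) divide_pos_pos)
    have "c *\<^sub>R (1 - X) = 1 + T * T"
      using c by (simp add: X_def peval_pCons scaleR_diff_right scaleR_diff_left algebra_simps)
    then have "(1 + T * T) * ((1 / c) *\<^sub>R (isq X * isq X)) = 1"
      using isq_sq(2)[OF X] c by (metis (no_types, lifting) mult_scaleR_left mult_scaleR_right nonzero_divide_eq_eq not_one_le_zero scaleR_one scaleR_scaleR)
    then have "(1 + T * T) \<cdot> (((1 / c) *\<^sub>R (isq X * isq X)) \<cdot> y) = y" by (metis app_simps(6,7))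
    then show ?thesis by blast
  qed
  have "ran (Some +\<^sub>o ((Some \<circ> app T) \<circ>\<^sub>m (Some \<circ> app T))) = UNIV"
  proof -
    have "(Some +\<^sub>o ((Some \<circ> app T) \<circ>\<^sub>m (Some \<circ> app T))) x = Some ((1 + T * T) \<cdot> x)" for x
      by (simp add: op_add_def)
    then show ?thesis using surj by (auto simp: ran_def)
  qed
  then show ?thesis
    unfolding self_adjoint_regular_def regular_op_def adjT using ml dd cl by simp
qed

end

theorem theorem2p45:
  fixes ip :: "'e::{complex_vector, banach} \<Rightarrow> 'e \<Rightarrow> 'b::cstar_algebra"
    and act :: "'e \<Rightarrow> 'b \<Rightarrow> 'e"
    and D1 D2 :: "'e \<rightharpoonup> 'e"
    and \<alpha> :: real
  assumes "hilbert_module ip act"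
    and "countably_generated act"
    and "self_adjoint_regular ip act D1"
    and "self_adjoint_regular ip act D2"
    and "dom D1 = dom D2"
    and "0 < \<alpha>" and "\<alpha> \<le> 1"
    and "op_bounded act
           ((bounded_transform D1 -\<^sub>o bounded_transform D2) \<circ>\<^sub>m op_pow (bracket D1) \<alpha>)"
  shows "\<exists>\<mu> T.
      bounded_invertible ip act \<mu> \<and>
      self_adjoint_regular ip act T \<and>
      D2 = ((Some \<circ> \<mu>) \<circ>\<^sub>m D1 \<circ>\<^sub>m op_adjoint ip (Some \<circ> \<mu>)) +\<^sub>o T \<and>
      op_bounded act
        (op_pow (bracket D1) (- 1/2) \<circ>\<^sub>m T \<circ>\<^sub>m op_pow (bracket D1) (- 1/2 + \<alpha>)) \<and>
      op_bounded act
        ((op_commutator (bounded_transform D1) (Some \<circ> \<mu>) -\<^sub>o (T \<circ>\<^sub>m op_pow (bracket D2) (- 1)))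
          \<circ>\<^sub>m op_pow (bracket D1) \<alpha>) \<and>
      (1/2 \<le> \<alpha> \<longrightarrow>
        op_bounded act (T \<circ>\<^sub>m op_pow (bracket D1) (- 1 + \<alpha>)) \<and>
        op_bounded act
          (op_commutator (bounded_transform D1) (Some \<circ> \<mu>) \<circ>\<^sub>m op_pow (bracket D1) \<alpha>))"
proof -
  interpret hilbert_module ip act by (rule assms(1))
  obtain b1 F1 where b1: "positive b1" "norm b1 \<le> 1" "dense_range b1"
    and F1: "selfadj F1" "b1 * F1 = F1 * b1" "F1 * F1 = 1 - b1 * b1"
    and D1: "\<And>x u. D1 x = Some u \<longleftrightarrow> (\<exists>y. x = b1 \<cdot> y \<and> u = F1 \<cdot> y)" "dom D1 = range (app b1)"
    and bt1: "bounded_transform D1 = Some \<circ> app F1"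
    and p1: "\<And>s. s < 0 \<Longrightarrow> op_pow (bracket D1) s = Some \<circ> app (pw b1 (- s))"
      "\<And>s. 0 < s \<Longrightarrow> op_pow (bracket D1) s = op_inv (Some \<circ> app (pw b1 s))"
      "op_pow (bracket D1) 0 = Some"
    by (rule selfadj_regular_transform[OF assms(3)]) blast
  obtain b2 F2 where b2: "positive b2" "norm b2 \<le> 1" "dense_range b2"
    and F2: "selfadj F2" "b2 * F2 = F2 * b2" "F2 * F2 = 1 - b2 * b2"
    and D2: "\<And>x u. D2 x = Some u \<longleftrightarrow> (\<exists>y. x = b2 \<cdot> y \<and> u = F2 \<cdot> y)" "dom D2 = range (app b2)"
    and bt2: "bounded_transform D2 = Some \<circ> app F2"
    and p2: "\<And>s. s < 0 \<Longrightarrow> op_pow (bracket D2) s = Some \<circ> app (pw b2 (- s))"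
      "\<And>s. 0 < s \<Longrightarrow> op_pow (bracket D2) s = op_inv (Some \<circ> app (pw b2 s))"
      "op_pow (bracket D2) 0 = Some"
    by (rule selfadj_regular_transform[OF assms(4)]) blast
  have ran: "range (app b1) = range (app b2)" using assms(5) D1(2) D2(2) by simp
  have \<alpha>: "0 \<le> \<alpha>" "\<alpha> \<le> 1" using assms by auto
  have i\<alpha>: "inj (app (pw b1 \<alpha>))" by (rule pw_inj[OF b1(1,3) \<alpha>])
  obtain X where X: "bounded_op act X" and hyp:
    "(bounded_transform D1 -\<^sub>o bounded_transform D2) \<circ>\<^sub>m op_pow (bracket D1) \<alpha> \<subseteq>\<^sub>m Some \<circ> X"
    using assms(8) unfolding op_bounded_def by blast
  have G: "right_div b1 \<alpha> (F2 - F1)"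
  proof -
    have "F1 \<cdot> y - F2 \<cdot> y = X (pw b1 \<alpha> \<cdot> y)" for y
    proof -
      have "((bounded_transform D1 -\<^sub>o bounded_transform D2) \<circ>\<^sub>m op_pow (bracket D1) \<alpha>) (pw b1 \<alpha> \<cdot> y) = Some (F1 \<cdot> y - F2 \<cdot> y)"
        by (simp add: p1(2)[OF assms(6)] bt1 bt2 map_comp_def op_inv_Some[OF i\<alpha>] op_diff_def)
      then show ?thesis using hyp by (force simp: map_le_def dom_def)
    qed
    then have "F1 - F2 = Endo X * pw b1 \<alpha>"
      using bounded_op_Endo[OF X] by (intro endo_eqI) simp
    then have "right_div b1 \<alpha> (F1 - F2)" unfolding right_div_def using bounded_op_Endo[OF X] by blast
    from right_div_minus[OF this] show ?thesis by simp
  qed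
  obtain \<mu> \<mu>' \<nu> \<nu>' T where \<mu>: "adj \<mu> \<mu>'" and \<nu>: "adj \<nu> \<nu>'" and \<mu>\<nu>: "\<mu> * \<nu> = 1" "\<nu> * \<mu> = 1" and T: "selfadj T"
    and \<mu>b: "\<mu>' * b2 = b1 * \<nu>" and dec: "\<mu> * F1 * \<nu> + T * b2 = F2"
    and comm: "right_div b1 \<alpha> (F1 * \<mu> - \<mu> * F1)" and b2div: "right_div b1 \<alpha> b2"
    and half: "1/2 < \<alpha> \<Longrightarrow> right_div b1 (\<alpha> - 1/2) (pw b1 (1/2) * T)"
    by (rule bounded_perturbation[OF b1 b2(1,3) F1 F2 ran assms(6,7) G]) blast
  have mT: "mlin T" by (rule adj_mlin[OF T])
  have inv: "bounded_invertible ip act (app \<mu>)"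
    unfolding bounded_invertible_def
  proof (intro conjI exI[of _ "app \<nu>"] adjointable_app[OF \<mu>] adjointable_app[OF \<nu>])
    show "app \<mu> \<circ> app \<nu> = id" "app \<nu> \<circ> app \<mu> = id"
      using \<mu>\<nu> by (auto simp: fun_eq_iff simp flip: app_simps(7))
  qed
  have D2eq: "D2 = ((Some \<circ> app \<mu>) \<circ>\<^sub>m D1 \<circ>\<^sub>m op_adjoint ip (Some \<circ> app \<mu>)) +\<^sub>o (Some \<circ> app T)"
  proof -
    let ?R = "((Some \<circ> app \<mu>) \<circ>\<^sub>m D1 \<circ>\<^sub>m op_adjoint ip (Some \<circ> app \<mu>)) +\<^sub>o (Some \<circ> app T)"
    have R: "?R x = Some u \<longleftrightarrow> (\<exists>w. \<mu>' \<cdot> x = b1 \<cdot> w \<and> u = \<mu> \<cdot> F1 \<cdot> w + T \<cdot> x)" for x u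
      unfolding op_adjoint_app[OF \<mu>] by (auto simp: op_add_Some map_comp_Some_iff D1(1))
    have "D2 x = Some u \<longleftrightarrow> ?R x = Some u" for x u
    proof
      assume "D2 x = Some u"
      then obtain y where y: "x = b2 \<cdot> y" "u = F2 \<cdot> y" using D2(1) by blast
      have "\<mu>' \<cdot> x = b1 \<cdot> \<nu> \<cdot> y" using arg_cong[OF \<mu>b, of "\<lambda>A. A \<cdot> y"] y by simp
      moreover have "u = \<mu> \<cdot> F1 \<cdot> (\<nu> \<cdot> y) + T \<cdot> x" using arg_cong[OF dec, of "\<lambda>A. A \<cdot> y"] y by simp
      ultimately show "?R x = Some u" unfolding R by blast
    next
      assume "?R x = Some u"
      then obtain w where w: "\<mu>' \<cdot> x = b1 \<cdot> w" "u = \<mu> \<cdot> F1 \<cdot> w + T \<cdot> x" unfolding R by blast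
      define y where "y = \<mu> \<cdot> w"
      have wy: "w = \<nu> \<cdot> y" using arg_cong[OF \<mu>\<nu>(2), of "\<lambda>A. A \<cdot> w"] by (simp add: y_def)
      have "\<mu>' \<cdot> x = \<mu>' \<cdot> b2 \<cdot> y" using arg_cong[OF \<mu>b, of "\<lambda>A. A \<cdot> y"] w wy by simp
      moreover have "\<nu>' * \<mu>' = 1" using adj_unique[OF adj_mult[OF \<mu> \<nu>, unfolded \<mu>\<nu>] adj_one] .
      ultimately have x: "x = b2 \<cdot> y" by (metis app_simps(6,7))
      have "u = F2 \<cdot> y" using arg_cong[OF dec, of "\<lambda>A. A \<cdot> y"] w(2) x wy by simp
      then show "D2 x = Some u" using x D2(1) by blast
    qed
    then have "D2 x = ?R x" for x by (metis not_None_eq)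
    then show ?thesis by blast
  qed
  have pow1: "op_pow (bracket D1) (- 1/2) = Some \<circ> app (pw b1 (1/2))" using p1(1)[of "- 1/2"] by simp
  have i: "op_bounded act
        (op_pow (bracket D1) (- 1/2) \<circ>\<^sub>m (Some \<circ> app T) \<circ>\<^sub>m op_pow (bracket D1) (- 1/2 + \<alpha>))"
  proof -
    have comp: "(Some \<circ> app A) \<circ>\<^sub>m (Some \<circ> app B) = Some \<circ> app (A * B)" for A B :: "'e endo"
      by (auto simp: map_comp_def fun_eq_iff)
    have mr: "mlin (pw b1 (1/2))" by (rule adj_mlin[OF pw_selfadj[OF b1(1)]]) simp
    consider "\<alpha> < 1/2" | "\<alpha> = 1/2" | "1/2 < \<alpha>" by linarith
    then show ?thesis
    proof cases
      case 1
      have "mlin (pw b1 (1/2 - \<alpha>))" by (rule adj_mlin[OF pw_selfadj[OF b1(1)]]) (use 1 in simp)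
      then have "mlin (pw b1 (1/2) * T * pw b1 (1/2 - \<alpha>))" by (intro mlin_mult mr mT)
      moreover have "op_pow (bracket D1) (- 1/2 + \<alpha>) = Some \<circ> app (pw b1 (1/2 - \<alpha>))"
        using p1(1)[of "- 1/2 + \<alpha>"] 1 by simp
      ultimately show ?thesis unfolding pow1 by (simp only: comp mult.assoc op_bounded_app)
    next
      case 2
      then have "- 1/2 + \<alpha> = 0" by simp
      then have "op_pow (bracket D1) (- 1/2 + \<alpha>) = Some" by (simp only: p1(3))
      then have "(op_pow (bracket D1) (- 1/2) \<circ>\<^sub>m (Some \<circ> app T) \<circ>\<^sub>m op_pow (bracket D1) (- 1/2 + \<alpha>)) = Some \<circ> app (pw b1 (1/2) * T)"
        unfolding pow1 by (simp only:) (auto simp: map_comp_def fun_eq_iff)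
      then show ?thesis using op_bounded_app[OF mlin_mult[OF mr mT]] by simp
    next
      case 3
      have e: "- 1/2 + \<alpha> = \<alpha> - 1/2" by simp
      have "op_bounded act ((Some \<circ> app (pw b1 (1/2) * T)) \<circ>\<^sub>m op_inv (Some \<circ> app (pw b1 (\<alpha> - 1/2))))"
        by (rule op_bounded_right_div[OF b1(1,3) _ _ half[OF 3]]) (use 3 assms in auto)
      moreover have "op_pow (bracket D1) (- 1/2) \<circ>\<^sub>m (Some \<circ> app T) \<circ>\<^sub>m op_pow (bracket D1) (- 1/2 + \<alpha>) =
          (Some \<circ> app (pw b1 (1/2) * T)) \<circ>\<^sub>m op_inv (Some \<circ> app (pw b1 (\<alpha> - 1/2)))"
        unfolding e pow1 p1(2)[of "\<alpha> - 1/2", simplified, OF 3[simplified]]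
        by (auto simp: map_comp_def fun_eq_iff split: option.splits)
      ultimately show ?thesis by simp
    qed
  qed
  have opc: "op_commutator (bounded_transform D1) (Some \<circ> app \<mu>) = Some \<circ> app (F1 * \<mu> - \<mu> * F1)"
    by (auto simp: op_commutator_def bt1 op_diff_def map_comp_def fun_eq_iff)
  have pow2: "op_pow (bracket D2) (- 1) = Some \<circ> app b2" using p2(1)[of "- 1"] by (simp add: pw_1[OF b2(1)])
  have powa: "op_pow (bracket D1) \<alpha> = op_inv (Some \<circ> app (pw b1 \<alpha>))" by (rule p1(2)[OF assms(6)])
  have ii: "op_bounded act
        ((op_commutator (bounded_transform D1) (Some \<circ> app \<mu>) -\<^sub>o ((Some \<circ> app T) \<circ>\<^sub>m op_pow (bracket D2) (- 1)))
          \<circ>\<^sub>m op_pow (bracket D1) \<alpha>)"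
  proof -
    have "op_commutator (bounded_transform D1) (Some \<circ> app \<mu>) -\<^sub>o ((Some \<circ> app T) \<circ>\<^sub>m op_pow (bracket D2) (- 1)) =
        Some \<circ> app ((F1 * \<mu> - \<mu> * F1) - T * b2)"
      unfolding opc pow2 by (auto simp: op_diff_def map_comp_def fun_eq_iff)
    then show ?thesis unfolding powa
      using op_bounded_right_div[OF b1(1,3) \<alpha> right_div_diff[OF comm right_div_mult_left[OF b2div mT]]] by simp
  qed
  have iii: "op_bounded act ((Some \<circ> app T) \<circ>\<^sub>m op_pow (bracket D1) (- 1 + \<alpha>))"
  proof (cases "\<alpha> = 1")
    case True
    then have "(Some \<circ> app T) \<circ>\<^sub>m op_pow (bracket D1) (- 1 + \<alpha>) = Some \<circ> app T"
      by (simp add: p1(3)) (auto simp: map_comp_def fun_eq_iff)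
    then show ?thesis using op_bounded_app[OF mT] by simp
  next
    case False
    then have neg: "- 1 + \<alpha> < 0" using \<alpha> by simp
    have "mlin (pw b1 (- (- 1 + \<alpha>)))" by (rule adj_mlin[OF pw_selfadj[OF b1(1)]]) (use neg in simp)
    then have "op_bounded act (Some \<circ> app (T * pw b1 (- (- 1 + \<alpha>))))" by (intro op_bounded_app mlin_mult mT)
    moreover have "(Some \<circ> app T) \<circ>\<^sub>m op_pow (bracket D1) (- 1 + \<alpha>) = Some \<circ> app (T * pw b1 (- (- 1 + \<alpha>)))"
      unfolding p1(1)[OF neg] by (auto simp: map_comp_def fun_eq_iff)
    ultimately show ?thesis by simp
  qed
  have iv: "op_bounded act (op_commutator (bounded_transform D1) (Some \<circ> app \<mu>) \<circ>\<^sub>m op_pow (bracket D1) \<alpha>)"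
    unfolding opc powa by (rule op_bounded_right_div[OF b1(1,3) \<alpha> comm])
  show ?thesis
    by (intro exI[of _ "app \<mu>"] exI[of _ "Some \<circ> app T"] conjI impI inv selfadj_imp_regular[OF T] D2eq i ii iii iv)
qed

end
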